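(* Assume the reward takes values in $[0,1]$ and the user-task distribution does not depend on the agent. Run step $k$ by the one-candidate update protocol with Two-Gate validation (thresholds $\tau,\delta>0$) under the standard evaluation conditions (all defined in the context). Let $\mathsf{Acc}_k$ be the event that the candidate is adopted, $I_k=J_{\mathrm{user}}(A_{k+1})-J_{\mathrm{user}}(A_k)$, and $$\beta_{\mathrm{step},k}=2\beta_Z+\beta_{F,k}+\beta_R+2(n_F+n_R)\beta_V^{(1)} .$$ Then $$\mathbb P\bigl(\mathsf{Acc}_k\cap\{I_k<\Delta_k\}\bigr)\le\beta_{\mathrm{step},k}.$$ In particular, since adoption requires $\Delta_k>0$, $\mathbb P(\mathsf{Acc}_k\cap\{I_k\le0\})\le\beta_{\mathrm{step},k}$.
   Context: **Setting.** $\mathcal T_{\mathrm{user}}$ (user tasks) and $\mathcal O$ (outputs) are measurable spaces. An agent $A$ is a Markov kernel $A(\cdot\mid t)$ from tasks to outputs. The reward $r:\mathcal T_{\mathrm{user}}\times\mathcal O\to[0,1]$ and failure detector $\phi:\mathcal T_{\mathrm{user}}\times\mathcal O\to\{0,1\}$ are jointly measurable and fixed; $\mathcal D_{\mathrm{user}}$ is a probability measure on $\mathcal T_{\mathrm{user}}$, the same for all agents. Put $V(A,t)=\int r(t,o)A(do\mid t)$, $J_{\mathrm{user}}(A)=\int V(A,t)\mathcal D_{\mathrm{user}}(dt)$, $\psi_A(t)=\int\phi(t,o)A(do\mid t)$, $Z_k=\int\psi_{A_k}d\mathcal D_{\mathrm{user}}\in(0,1)$, $\mathcal D_{F,k}(dt)=\frac{\psi_{A_k}(t)}{Z_k}\mathcal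 D_{\mathrm{user}}(dt)$, $\mathcal D_{R,k}(dt)=\frac{1-\psi_{A_k}(t)}{1-Z_k}\mathcal D_{\mathrm{user}}(dt)$, $\mathrm{Adv}_{A_k}(\widetilde A,t)=V(\widetilde A,t)-V(A_k,t)$. **One-candidate update protocol.** $\mathcal M$ is the measurable space of valid modifications; $c\in\mathcal M$ gives an agent $A_k\oplus c$; $\bot$ denotes a failed generation output. (1) $A_k$ handles at most a fixed finite number of arriving user tasks; the first $n_F$ failure-marked tasks form the generation material (abstain if there are fewer). A terminal output $\Delta C\in\mathcal M\sqcup\{\bot\}$ is drawn from the current agent's generation kernel given this material; abstain if $\Delta C=\bot$. $\mathsf{Cand}_k=\{\Delta C\in\mathcal M\}$ and $\widetilde A=A_k\oplus\Delta C$. (2) A stored sample of $n_R$ labelled records $(t_j^R,\phi_j^R)$ is used; $S_R=\{j:\phi_j^R=0\}$. Abstain unless a valid stored sample with $|S_R|\ge1$ is available (event $\mathsf{Ready}_{R,k}$). (3) After the candidate, all radii, risks, horizon and return rule are frozen, a new window of $H_{F,k}<\infty$ task arrivals is observed with $A_k$ and $\phi$ fixed; the first $n_F$ failure-marked tasks $t^F_1,\dots,t^F_{n_F}$ are returned (event $\mathsf{Ret}_{F,k}$), otherwise abstain. $\mathsf{Ready}_k=\mathsf{Ret}_{F,k}\cap\mathsf{Ready}_{R,k}$. (4) On $\mathsf{Cand}_k\cap\mathsf{Ready}_k$, for each evaluation task $t$ and each $A\in\{A_k,\widetilde A\}$, given the frozen agents and records, compute $\hat V(A,t)=\frac1m\sum_{l=1}^m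 r(t,o_l)$ from $m$ fresh i.i.d. rollouts $o_l\sim A(\cdot\mid t)$, with independent groups for the two agents. Estimates: $\hat Z_k=\frac1{n_R}\sum_j\phi_j^R$, $\hat L_k=\hat Z_k\frac1{n_F}\sum_i[\hat V(\widetilde A,t_i^F)-\hat V(A_k,t_i^F)]$, $\hat D_R=\frac1{|S_R|}\sum_{j\in S_R}|\hat V(\widetilde A,t_j^R)-\hat V(A_k,t_j^R)|$. Radii, for risks $\beta_V^{(1)},\beta_Z,\beta_R,\beta_{F,k}\in(0,1)$ and block gap $\ell$: $\varepsilon_V=\sqrt{\log(2/\beta_V^{(1)})/(2m)}$; $\varepsilon_Z=\sqrt{\log(2/\widetilde\beta_Z)/(2n_R)}$ with $\widetilde\beta_Z=\beta_Z-2n_R\beta(\ell)$; $\varepsilon_R=\sqrt{\log(2/\widetilde\beta_R)/(2n_R)}$ with $\widetilde\beta_R=\beta_R-2n_R\beta(\ell)$; $\varepsilon_F$ a radius frozen before (3); $\varepsilon_L=\varepsilon_Z+(\hat Z_k+\varepsilon_Z)(2\varepsilon_V+\varepsilon_F)$; $\varepsilon_D=(2\varepsilon_V+\varepsilon_R+\varepsilon_Z)/(1-\hat Z_k)$. **Two-Gate validation:** on $\mathsf{Cand}_k\cap\mathsf{Ready}_k$, adopt if and only if $\hat L_k\ge\tau$, $\hat D_R\le\delta$ and $$\Delta_k:=\tau-\varepsilon_L-(1-\hat Z_k+\varepsilon_Z)(\delta+\varepsilon_D)>0 .$$ Off $\mathsf{Cand}_k\cap\mathsf{Ready}_k$ set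 $\Delta_k=0$ and do not adopt. $A_{k+1}=\widetilde A$ if adopted, $A_{k+1}=A_k$ otherwise. **Standard evaluation conditions.** (a) The task stream $(T_n)$ is stationary ergodic with marginal $\mathcal D_{\mathrm{user}}$ and $\beta$-mixing: $\beta(j)=\sup_n\mathbb E[\sup_{B\in\sigma(T_{n+j},T_{n+j+1},\dots)}|\mathbb P(B\mid T_1,\dots,T_n)-\mathbb P(B)|]\to0$. (b) $O_n\sim A_k(\cdot\mid T_n)$ and, given $T_n$, $O_n$ is conditionally independent of all other $(T_m,O_m)$, $m\neq n$, and of all fresh rollouts; the mark is $\Phi_n=\phi(T_n,O_n)$; repeated evaluations of $\phi$ and $r$ for a fixed agent and task are i.i.d. (c) The generation material is disjoint from the failure batch and stored sample. Let $\mathcal G_k$ contain the current agent, the frozen candidate, generation information and randomness, and any stored-sample offset. The joint law $\mathbb P$ of this information and the stored records is within total variation $2n_R\beta(\ell)$ of a reference law $\mathbb P^\circ$ with the same $\mathcal G_k$-marginal under which, conditionally on $\mathcal G_k$, the stored tasks are i.i.d. from $\mathcal D_{\mathrm{user}}$ and, given them, the labels are independent $\mathrm{Bernoulli}(\psi_{A_k}(t_j^R))$. (d) With $f=\mathrm{Adv}_{A_k}(\widetilde A,\cdot)$, $\mathbb P\bigl(\mathsf{Ret}_{F,k}\cap\{|\frac1{n_F}\sum_i f(t_i^F)-\mathbb E_{\mathcal D_{F,k}}f|>\varepsilon_F\}\bigr)\le\beta_{F,k}$, where $\widetilde A$, $\varepsilon_F$ and the return rule do not depend on outcomes of the window in (3).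 (e) $2n_R\beta(\ell)<\min\{\beta_Z,\beta_R\}$. *)

theory Defs
  imports "HOL-Probability.Probability"
begin

section \<open>Conditional probability, total variation and mixing\<close>

definition sigma_gen :: "'w measure \<Rightarrow> 'b measure \<Rightarrow> ('w \<Rightarrow> 'b) \<Rightarrow> 'w measure" where
  "sigma_gen M N X = vimage_algebra (space M) X N"

definition cprob :: "'w measure \<Rightarrow> 'w measure \<Rightarrow> 'w set \<Rightarrow> 'w \<Rightarrow> real" where
  "cprob M F A = real_cond_exp M F (indicator A)"

definition tv_dist :: "'b measure \<Rightarrow> 'b measure \<Rightarrow> real" where
  "tv_dist P Q = (SUP A\<in>sets P. \<bar>measure P A - measure Q A\<bar>)"

text \<open>
  The supremum over events in the definition of the mixing coefficient ranges over an uncountable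
  family of random variables, each determined only almost surely. It is therefore the essential
  supremum of the family, i.e. its least almost-sure measurable upper bound, which exists by the
  lemma below.
\<close>

definition is_ess_sup :: "'w measure \<Rightarrow> ('w \<Rightarrow> real) set \<Rightarrow> ('w \<Rightarrow> real) \<Rightarrow> bool" where
  "is_ess_sup M \<F> g \<longleftrightarrow>
     g \<in> borel_measurable M \<and> (\<forall>f\<in>\<F>. AE x in M. f x \<le> g x) \<and>
     (\<forall>h\<in>borel_measurable M. (\<forall>f\<in>\<F>. AE x in M. f x \<le> h x) \<longrightarrow> (AE x in M. g x \<le> h x))"

definition ess_sup :: "'w measure \<Rightarrow> ('w \<Rightarrow> real) set \<Rightarrow> 'w \<Rightarrow> real" where
  "ess_sup M \<F> = (SOME g. is_ess_sup M \<F> g)"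

lemma ex_is_ess_sup:
  assumes "prob_space M" and ne: "\<F> \<noteq> {}" and meas: "\<F> \<subseteq> borel_measurable M"
    and bnd: "\<And>f. f \<in> \<F> \<Longrightarrow> AE x in M. \<bar>f x\<bar> \<le> K"
  shows "\<exists>g. is_ess_sup M \<F> g"
proof -
  interpret prob_space M by fact
  have "0 \<le> K"
  proof -
    obtain f where "f \<in> \<F>" using ne by blast
    from bnd[OF this] have "AE x in M. 0 \<le> K" by eventually_elim auto
    then show ?thesis by simp
  qed
  define c where "c f x = max (- K) (min K (f x))" for f :: "'a \<Rightarrow> real" and x
  have c_le: "c f x \<le> K" and c_ge: "- K \<le> c f x" for f x
    using \<open>0 \<le> K\<close> by (auto simp: c_def)
  define S where "S C x = (SUP f\<in>C. c f x)" for C x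
  have bdd: "bdd_above ((\<lambda>f. c f x) ` C)" for C x
    using c_le by (intro bdd_aboveI[of _ K]) auto
  define Cs where "Cs = {C. C \<subseteq> \<F> \<and> C \<noteq> {} \<and> countable C}"
  have S_le: "S C x \<le> K" and S_ge: "- K \<le> S C x" if "C \<in> Cs" for C x
  proof -
    from that obtain f where f: "f \<in> C" by (auto simp: Cs_def)
    show "S C x \<le> K" unfolding S_def using f c_le by (intro cSUP_least) auto
    show "- K \<le> S C x" unfolding S_def using cSUP_upper[OF f bdd] c_ge order_trans by blast
  qed
  have S_meas: "S C \<in> borel_measurable M" if "C \<in> Cs" for C
    unfolding S_def
  proof (rule borel_measurable_cSUP)
    show "countable C" using that by (auto simp: Cs_def)
    show "(\<lambda>x. c i x) \<in> borel_measurable M" if "i \<in> C" for i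
    proof -
      have [measurable]: "i \<in> borel_measurable M"
        using that \<open>C \<in> Cs\<close> meas by (auto simp: Cs_def)
      show ?thesis unfolding c_def by measurable
    qed
  qed (use bdd in auto)
  have S_int: "integrable M (S C)" if "C \<in> Cs" for C
    using S_le[OF that] S_ge[OF that] S_meas[OF that]
    by (intro integrable_const_bound[of _ K]) (auto simp: abs_le_iff minus_le_iff)
  have S_mono: "S C x \<le> S C' x" if "C \<in> Cs" "C \<subseteq> C'" for C C' x
    unfolding S_def using that bdd by (intro cSUP_subset_mono) (auto simp: Cs_def)
  define s where "s = (SUP C\<in>Cs. integral\<^sup>L M (S C))"
  have Cs_ne: "Cs \<noteq> {}"
  proof -
    obtain f where "f \<in> \<F>" using ne by blast
    then have "{f} \<in> Cs" by (simp add: Cs_def)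
    then show ?thesis by blast
  qed
  have bdd_int: "bdd_above ((\<lambda>C. integral\<^sup>L M (S C)) ` Cs)"
  proof (rule bdd_aboveI2[of _ _ K])
    fix C assume "C \<in> Cs"
    have "integral\<^sup>L M (S C) \<le> integral\<^sup>L M (\<lambda>_. K)"
      using S_le[OF \<open>C \<in> Cs\<close>] by (intro integral_mono S_int \<open>C \<in> Cs\<close>) auto
    then show "integral\<^sup>L M (S C) \<le> K" by (simp add: prob_space)
  qed
  have "\<exists>C\<in>Cs. s - 1 / Suc n < integral\<^sup>L M (S C)" for n
    using less_cSUP_iff[OF Cs_ne bdd_int, of "s - 1 / Suc n"] by (simp add: s_def)
  then obtain D where D: "D n \<in> Cs" "s - 1 / Suc n < integral\<^sup>L M (S (D n))" for n
    by metis
  define U where "U = (\<Union>n. D n)"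
  have Dn: "D n \<subseteq> \<F>" "D n \<noteq> {}" "countable (D n)" for n
    using D(1)[of n] by (simp_all add: Cs_def)
  have "U \<subseteq> \<F>" "countable U" unfolding U_def using Dn(1,3) by blast+
  moreover have "U \<noteq> {}" unfolding U_def using Dn(2)[of 0] by blast
  ultimately have U: "U \<in> Cs" by (simp add: Cs_def)
  have s_le: "s \<le> integral\<^sup>L M (S U)"
  proof (rule LIMSEQ_le_const2)
    show "(\<lambda>n. s - 1 / Suc n) \<longlonglongrightarrow> s"
      using tendsto_diff[OF tendsto_const LIMSEQ_inverse_real_of_nat, of s]
      by (simp add: inverse_eq_divide)
    have "s - 1 / Suc n \<le> integral\<^sup>L M (S U)" for n
    proof -
      have "integral\<^sup>L M (S (D n)) \<le> integral\<^sup>L M (S U)"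
        using S_mono[OF D(1), of n U] by (intro integral_mono S_int D(1) U) (auto simp: U_def)
      then show ?thesis using D(2)[of n] by simp
    qed
    then show "\<exists>N. \<forall>n\<ge>N. s - 1 / real (Suc n) \<le> integral\<^sup>L M (S U)" by simp
  qed
  have upper: "AE x in M. f x \<le> S U x" if f: "f \<in> \<F>" for f
  proof -
    have V: "insert f U \<in> Cs" using U f by (auto simp: Cs_def)
    have "integral\<^sup>L M (S (insert f U)) \<le> s"
      unfolding s_def by (intro cSUP_upper V bdd_int)
    then have "integral\<^sup>L M (S (insert f U)) \<le> integral\<^sup>L M (S U)" using s_le by simp
    then have le0: "(\<integral>x. S (insert f U) x - S U x \<partial>M) \<le> 0"
      by (simp add: S_int U V)
    have nn: "0 \<le> S (insert f U) x - S U x" for x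
      using S_mono[OF U, of "insert f U" x] by auto
    have "(\<integral>x. S (insert f U) x - S U x \<partial>M) = 0"
      using le0 nn by (intro antisym integral_nonneg) auto
    then have "AE x in M. S (insert f U) x - S U x = 0"
      using integral_nonneg_eq_0_iff_AE[of M "\<lambda>x. S (insert f U) x - S U x"] nn S_int U V by auto
    with bnd[OF f] show ?thesis
    proof eventually_elim
      case (elim x)
      have "c f x \<le> S (insert f U) x" unfolding S_def by (intro cSUP_upper bdd) auto
      moreover have "c f x = f x" using elim(1) by (auto simp: c_def)
      ultimately show ?case using elim(2) by simp
    qed
  qed
  have least: "AE x in M. S U x \<le> h x"
    if "\<forall>f\<in>\<F>. AE x in M. f x \<le> h x" for h
  proof -
    have cU: "countable U" and UF: "U \<subseteq> \<F>" and Une: "U \<noteq> {}" using U by (auto simp: Cs_def)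
    have "AE x in M. \<forall>f\<in>U. f x \<le> h x \<and> \<bar>f x\<bar> \<le> K"
    proof (subst AE_ball_countable[OF cU], intro ballI)
      fix f assume "f \<in> U"
      then have "AE x in M. f x \<le> h x" "AE x in M. \<bar>f x\<bar> \<le> K" using UF that bnd by auto
      then show "AE x in M. f x \<le> h x \<and> \<bar>f x\<bar> \<le> K" by eventually_elim auto
    qed
    then show ?thesis
    proof eventually_elim
      case (elim x)
      have "c f x \<le> h x" if "f \<in> U" for f
        using elim that by (force simp: c_def)
      then show ?case unfolding S_def using Une by (intro cSUP_least) auto
    qed
  qed
  have "is_ess_sup M \<F> (S U)"
    unfolding is_ess_sup_def using S_meas[OF U] upper least by auto
  then show ?thesis by blast
qed

text \<open>Arrivals are numbered from 0, so the indices \<open>{..n}\<close> are the first \<open>n + 1\<close> arrivals.\<close>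

definition beta_mixing_coeff ::
    "'w measure \<Rightarrow> 't measure \<Rightarrow> (nat \<Rightarrow> 'w \<Rightarrow> 't) \<Rightarrow> nat \<Rightarrow> real" where
  "beta_mixing_coeff M N T j =
     (SUP n. \<integral>\<omega>. ess_sup M
        ((\<lambda>B \<omega>. \<bar>cprob M (sigma_gen M (PiM {..n} (\<lambda>_. N)) (\<lambda>\<omega>. \<lambda>i\<in>{..n}. T i \<omega>)) B \<omega> - measure M B\<bar>)
           ` sets (sigma_gen M (PiM {n + j..} (\<lambda>_. N)) (\<lambda>\<omega>. \<lambda>i\<in>{n + j..}. T i \<omega>))) \<omega> \<partial>M)"

definition stationary_process ::
    "'w measure \<Rightarrow> 't measure \<Rightarrow> (nat \<Rightarrow> 'w \<Rightarrow> 't) \<Rightarrow> bool" where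
  "stationary_process M N T \<longleftrightarrow>
     distr M (PiM UNIV (\<lambda>_. N)) (\<lambda>\<omega> i. T (Suc i) \<omega>) = distr M (PiM UNIV (\<lambda>_. N)) (\<lambda>\<omega> i. T i \<omega>)"

definition ergodic_process ::
    "'w measure \<Rightarrow> 't measure \<Rightarrow> (nat \<Rightarrow> 'w \<Rightarrow> 't) \<Rightarrow> bool" where
  "ergodic_process M N T \<longleftrightarrow>
     (\<forall>E\<in>sets (PiM UNIV (\<lambda>_. N)).
        (\<forall>x\<in>space (PiM UNIV (\<lambda>_. N)). (\<lambda>i. x (Suc i)) \<in> E \<longleftrightarrow> x \<in> E) \<longrightarrow>
        measure M {\<omega>\<in>space M. (\<lambda>i. T i \<omega>) \<in> E} \<in> {0, 1})"

text \<open>The measurable space \<open>N \<squnion> {\<bottom>}\<close>, with \<open>\<bottom>\<close> represented by \<open>None\<close>.\<close>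

definition option_space :: "'b measure \<Rightarrow> 'b option measure" where
  "option_space N = sigma (insert None (Some ` space N)) (insert {None} ((`) Some ` sets N))"


section \<open>Agents, rewards and failures\<close>

text \<open>
  The measurable space \<open>Agents\<close> parametrises a jointly measurable family of Markov kernels
  \<open>kern A\<close> from tasks to outputs, so that the current agent may be a random element. A single
  fixed current agent is the special case of a constant random element.
\<close>

record ('t, 'o, 'a) environment =
  Tasks :: "'t measure"
  Outputs :: "'o measure"
  Agents :: "'a measure"
  kern :: "'a \<Rightarrow> 't \<Rightarrow> 'o measure"
  reward :: "'t \<Rightarrow> 'o \<Rightarrow> real"
  failure :: "'t \<Rightarrow> 'o \<Rightarrow> bool"
  D_user :: "'t measure"

definition valid_environment :: "('t, 'o, 'a, 'z) environment_scheme \<Rightarrow> bool" where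
  "valid_environment E \<longleftrightarrow>
     (\<lambda>(A, t). kern E A t) \<in> Agents E \<Otimes>\<^sub>M Tasks E \<rightarrow>\<^sub>M prob_algebra (Outputs E) \<and>
     (\<lambda>(t, u). reward E t u) \<in> borel_measurable (Tasks E \<Otimes>\<^sub>M Outputs E) \<and>
     (\<forall>t\<in>space (Tasks E). \<forall>u\<in>space (Outputs E). 0 \<le> reward E t u \<and> reward E t u \<le> 1) \<and>
     (\<lambda>(t, u). failure E t u) \<in> Tasks E \<Otimes>\<^sub>M Outputs E \<rightarrow>\<^sub>M count_space UNIV \<and>
     prob_space (D_user E) \<and> sets (D_user E) = sets (Tasks E)"

definition V :: "('t, 'o, 'a, 'z) environment_scheme \<Rightarrow> 'a \<Rightarrow> 't \<Rightarrow> real" where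
  "V E A t = (\<integral>u. reward E t u \<partial>kern E A t)"

definition J_user :: "('t, 'o, 'a, 'z) environment_scheme \<Rightarrow> 'a \<Rightarrow> real" where
  "J_user E A = (\<integral>t. V E A t \<partial>D_user E)"

definition psi :: "('t, 'o, 'a, 'z) environment_scheme \<Rightarrow> 'a \<Rightarrow> 't \<Rightarrow> real" where
  "psi E A t = (\<integral>u. of_bool (failure E t u) \<partial>kern E A t)"

definition Z :: "('t, 'o, 'a, 'z) environment_scheme \<Rightarrow> 'a \<Rightarrow> real" where
  "Z E A = (\<integral>t. psi E A t \<partial>D_user E)"

definition D_F :: "('t, 'o, 'a, 'z) environment_scheme \<Rightarrow> 'a \<Rightarrow> 't measure" where
  "D_F E A = density (D_user E) (\<lambda>t. ennreal (psi E A t / Z E A))"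

definition Adv :: "('t, 'o, 'a, 'z) environment_scheme \<Rightarrow> 'a \<Rightarrow> 'a \<Rightarrow> 't \<Rightarrow> real" where
  "Adv E A A' t = V E A' t - V E A t"


section \<open>One step of the protocol\<close>

datatype role = Current | Candidate

text \<open>Evaluation slots: the \<open>i\<close>-th task of the failure batch, the \<open>j\<close>-th stored record.\<close>

datatype slot = FSlot nat | RSlot nat

text \<open>
  All random elements live on the probability space \<open>\<Omega>\<close>. The stream is indexed by the arrivals
  occurring while the current agent is in use. \<open>seed\<close> collects generation information and
  randomness that is external to the stream. The \<open>j\<close>-th stored record is the arrival with number
  \<open>stored_pos q j\<close>, where \<open>q\<close> is the stored-sample offset; \<open>avail\<close> is the event that the stored
  sample is valid and available.
\<close>

record ('t, 'o, 'a, 'c, 'x, 'w) step = "('t, 'o, 'a) environment" +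
  \<Omega> :: "'w measure"
  Mods :: "'c measure"
  apply_mod :: "'a \<Rightarrow> 'c \<Rightarrow> 'a"
  gen_kern :: "'a \<Rightarrow> (nat \<Rightarrow> 't) \<Rightarrow> 'c option measure"
  Seeds :: "'x measure"
  task :: "nat \<Rightarrow> 'w \<Rightarrow> 't"
  outp :: "nat \<Rightarrow> 'w \<Rightarrow> 'o"
  current :: "'w \<Rightarrow> 'a"
  seed :: "'w \<Rightarrow> 'x"
  gen_start :: "'w \<Rightarrow> nat"
  gen_budget :: nat
  delta_C :: "'w \<Rightarrow> 'c option"
  offset :: "'w \<Rightarrow> nat"
  stored_pos :: "nat \<Rightarrow> nat \<Rightarrow> nat"
  avail :: "'w set"
  win_start :: "'w \<Rightarrow> nat"
  horizon :: "'w \<Rightarrow> nat"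
  rollout :: "role \<Rightarrow> slot \<Rightarrow> nat \<Rightarrow> 'w \<Rightarrow> 'o"
  n_F :: nat
  n_R :: nat
  n_roll :: nat
  block_gap :: nat
  risk_V :: real
  risk_Z :: real
  risk_R :: real
  risk_F :: real
  eps_F :: "'w \<Rightarrow> real"
  tau :: real
  delta :: real

type_synonym ('t, 'o, 'a, 'c, 'x, 'w, 'b) step_fun = "('t, 'o, 'a, 'c, 'x, 'w) step \<Rightarrow> 'b"

definition mark :: "('t, 'o, 'a, 'c, 'x, 'w, nat \<Rightarrow> 'w \<Rightarrow> bool) step_fun" where
  "mark S n \<omega> = failure S (task S n \<omega>) (outp S n \<omega>)"

text \<open>Positions of the first \<open>n_F\<close> (or of all, if fewer) failure-marked tasks among arrivals
  \<open>s, \<dots>, s + h - 1\<close>.\<close>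

definition first_failures :: "('t, 'o, 'a, 'c, 'x, 'w, nat \<Rightarrow> nat \<Rightarrow> 'w \<Rightarrow> nat list) step_fun" where
  "first_failures S s h \<omega> = take (n_F S) (filter (\<lambda>n. mark S n \<omega>) [s..<s + h])"

definition gen_pos :: "('t, 'o, 'a, 'c, 'x, 'w, 'w \<Rightarrow> nat list) step_fun" where
  "gen_pos S \<omega> = first_failures S (gen_start S \<omega>) (gen_budget S) \<omega>"

definition batch_pos :: "('t, 'o, 'a, 'c, 'x, 'w, 'w \<Rightarrow> nat list) step_fun" where
  "batch_pos S \<omega> = first_failures S (win_start S \<omega>) (horizon S \<omega>) \<omega>"

definition material :: "('t, 'o, 'a, 'c, 'x, 'w, 'w \<Rightarrow> (nat \<Rightarrow> 't) option) step_fun" where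
  "material S \<omega> =
     (if length (gen_pos S \<omega>) = n_F S
      then Some (\<lambda>i\<in>{..<n_F S}. task S (gen_pos S \<omega> ! i) \<omega>) else None)"

definition t_F :: "('t, 'o, 'a, 'c, 'x, 'w, nat \<Rightarrow> 'w \<Rightarrow> 't) step_fun" where
  "t_F S i \<omega> = task S (batch_pos S \<omega> ! i) \<omega>"

definition t_R :: "('t, 'o, 'a, 'c, 'x, 'w, nat \<Rightarrow> 'w \<Rightarrow> 't) step_fun" where
  "t_R S j \<omega> = task S (stored_pos S (offset S \<omega>) j) \<omega>"

definition phi_R :: "('t, 'o, 'a, 'c, 'x, 'w, nat \<Rightarrow> 'w \<Rightarrow> bool) step_fun" where
  "phi_R S j \<omega> = mark S (stored_pos S (offset S \<omega>) j) \<omega>"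

definition S_R :: "('t, 'o, 'a, 'c, 'x, 'w, 'w \<Rightarrow> nat set) step_fun" where
  "S_R S \<omega> = {j. j < n_R S \<and> \<not> phi_R S j \<omega>}"

definition Cand :: "('t, 'o, 'a, 'c, 'x, 'w, 'w set) step_fun" where
  "Cand S = {\<omega>\<in>space (\<Omega> S). delta_C S \<omega> \<noteq> None}"

definition Ret_F :: "('t, 'o, 'a, 'c, 'x, 'w, 'w set) step_fun" where
  "Ret_F S = {\<omega>\<in>space (\<Omega> S). length (batch_pos S \<omega>) = n_F S}"

definition Ready_R :: "('t, 'o, 'a, 'c, 'x, 'w, 'w set) step_fun" where
  "Ready_R S = {\<omega>\<in>space (\<Omega> S). \<omega> \<in> avail S \<and> 1 \<le> card (S_R S \<omega>)}"

definition Ready :: "('t, 'o, 'a, 'c, 'x, 'w, 'w set) step_fun" where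
  "Ready S = Ret_F S \<inter> Ready_R S"

text \<open>Only meaningful on \<open>Cand S\<close>; the value off that event is irrelevant.\<close>

definition candidate :: "('t, 'o, 'a, 'c, 'x, 'w, 'w \<Rightarrow> 'a) step_fun" where
  "candidate S \<omega> =
     (case delta_C S \<omega> of None \<Rightarrow> current S \<omega> | Some c \<Rightarrow> apply_mod S (current S \<omega>) c)"

primrec agent_of :: "('t, 'o, 'a, 'c, 'x, 'w) step \<Rightarrow> role \<Rightarrow> 'w \<Rightarrow> 'a" where
  "agent_of S Current = current S"
| "agent_of S Candidate = candidate S"

primrec task_of :: "('t, 'o, 'a, 'c, 'x, 'w) step \<Rightarrow> slot \<Rightarrow> 'w \<Rightarrow> 't" where
  "task_of S (FSlot i) = t_F S i"
| "task_of S (RSlot j) = t_R S j"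

definition eval_slots :: "('t, 'o, 'a, 'c, 'x, 'w, 'w \<Rightarrow> slot set) step_fun" where
  "eval_slots S \<omega> = FSlot ` {..<n_F S} \<union> RSlot ` S_R S \<omega>"


subsection \<open>Estimates, radii and the two gates\<close>

definition V_hat :: "('t, 'o, 'a, 'c, 'x, 'w, role \<Rightarrow> slot \<Rightarrow> 'w \<Rightarrow> real) step_fun" where
  "V_hat S b e \<omega> =
     (1 / real (n_roll S)) * (\<Sum>l<n_roll S. reward S (task_of S e \<omega>) (rollout S b e l \<omega>))"

definition Z_hat :: "('t, 'o, 'a, 'c, 'x, 'w, 'w \<Rightarrow> real) step_fun" where
  "Z_hat S \<omega> = (1 / real (n_R S)) * (\<Sum>j<n_R S. of_bool (phi_R S j \<omega>))"

definition L_hat :: "('t, 'o, 'a, 'c, 'x, 'w, 'w \<Rightarrow> real) step_fun" where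
  "L_hat S \<omega> = Z_hat S \<omega> *
     ((1 / real (n_F S)) * (\<Sum>i<n_F S. V_hat S Candidate (FSlot i) \<omega> - V_hat S Current (FSlot i) \<omega>))"

definition D_R_hat :: "('t, 'o, 'a, 'c, 'x, 'w, 'w \<Rightarrow> real) step_fun" where
  "D_R_hat S \<omega> = (1 / real (card (S_R S \<omega>))) *
     (\<Sum>j\<in>S_R S \<omega>. \<bar>V_hat S Candidate (RSlot j) \<omega> - V_hat S Current (RSlot j) \<omega>\<bar>)"

definition beta :: "('t, 'o, 'a, 'c, 'x, 'w, nat \<Rightarrow> real) step_fun" where
  "beta S = beta_mixing_coeff (\<Omega> S) (Tasks S) (task S)"

definition coupling_cost :: "('t, 'o, 'a, 'c, 'x, 'w, real) step_fun" where
  "coupling_cost S = 2 * real (n_R S) * beta S (block_gap S)"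

definition eps_V :: "('t, 'o, 'a, 'c, 'x, 'w, real) step_fun" where
  "eps_V S = sqrt (ln (2 / risk_V S) / (2 * real (n_roll S)))"

definition eps_Z :: "('t, 'o, 'a, 'c, 'x, 'w, real) step_fun" where
  "eps_Z S = sqrt (ln (2 / (risk_Z S - coupling_cost S)) / (2 * real (n_R S)))"

definition eps_R :: "('t, 'o, 'a, 'c, 'x, 'w, real) step_fun" where
  "eps_R S = sqrt (ln (2 / (risk_R S - coupling_cost S)) / (2 * real (n_R S)))"

definition eps_L :: "('t, 'o, 'a, 'c, 'x, 'w, 'w \<Rightarrow> real) step_fun" where
  "eps_L S \<omega> = eps_Z S + (Z_hat S \<omega> + eps_Z S) * (2 * eps_V S + eps_F S \<omega>)"

definition eps_D :: "('t, 'o, 'a, 'c, 'x, 'w, 'w \<Rightarrow> real) step_fun" where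
  "eps_D S \<omega> = (2 * eps_V S + eps_R S + eps_Z S) / (1 - Z_hat S \<omega>)"

definition Delta :: "('t, 'o, 'a, 'c, 'x, 'w, 'w \<Rightarrow> real) step_fun" where
  "Delta S \<omega> =
     (if \<omega> \<in> Cand S \<inter> Ready S
      then tau S - eps_L S \<omega> - (1 - Z_hat S \<omega> + eps_Z S) * (delta S + eps_D S \<omega>)
      else 0)"

definition Acc :: "('t, 'o, 'a, 'c, 'x, 'w, 'w set) step_fun" where
  "Acc S = {\<omega> \<in> Cand S \<inter> Ready S.
     tau S \<le> L_hat S \<omega> \<and> D_R_hat S \<omega> \<le> delta S \<and> 0 < Delta S \<omega>}"

definition next_agent :: "('t, 'o, 'a, 'c, 'x, 'w, 'w \<Rightarrow> 'a) step_fun" where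
  "next_agent S \<omega> = (if \<omega> \<in> Acc S then candidate S \<omega> else current S \<omega>)"

definition improvement :: "('t, 'o, 'a, 'c, 'x, 'w, 'w \<Rightarrow> real) step_fun" where
  "improvement S \<omega> = J_user S (next_agent S \<omega>) - J_user S (current S \<omega>)"

definition beta_step :: "('t, 'o, 'a, 'c, 'x, 'w, real) step_fun" where
  "beta_step S =
     2 * risk_Z S + risk_F S + risk_R S + 2 * real (n_F S + n_R S) * risk_V S"


subsection \<open>Information\<close>

text \<open>What is known before arrival \<open>n\<close> is handled.\<close>

definition history :: "('t, 'o, 'a, 'c, 'x, 'w, nat \<Rightarrow> 'w measure) step_fun" where
  "history S n = sigma_gen (\<Omega> S)
     (Agents S \<Otimes>\<^sub>M Seeds S \<Otimes>\<^sub>M PiM {..<n} (\<lambda>_. Tasks S) \<Otimes>\<^sub>M PiM {..<n} (\<lambda>_. Outputs S))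
     (\<lambda>\<omega>. (current S \<omega>, seed S \<omega>, \<lambda>i\<in>{..<n}. task S i \<omega>, \<lambda>i\<in>{..<n}. outp S i \<omega>))"

text \<open>What is known when the window starts, \<open>win_start\<close> being a stopping time for \<open>history\<close>.\<close>

definition frozen_info :: "('t, 'o, 'a, 'c, 'x, 'w, 'w measure) step_fun" where
  "frozen_info S = filtration.pre_sigma (space (\<Omega> S)) (history S) (win_start S)"

text \<open>Agent, seed, all tasks, and all outputs except the one of arrival \<open>n\<close>.\<close>

definition all_but_output :: "('t, 'o, 'a, 'c, 'x, 'w, nat \<Rightarrow> 'w measure) step_fun" where
  "all_but_output S n = sigma_gen (\<Omega> S)
     (Agents S \<Otimes>\<^sub>M Seeds S \<Otimes>\<^sub>M PiM UNIV (\<lambda>_. Tasks S) \<Otimes>\<^sub>M PiM (- {n}) (\<lambda>_. Outputs S))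
     (\<lambda>\<omega>. (current S \<omega>, seed S \<omega>, \<lambda>i. task S i \<omega>, \<lambda>i\<in>- {n}. outp S i \<omega>))"

text \<open>Everything except the rollouts. By the freezing conditions below, it determines the agents,
  the stored records, the failure batch and the events \<open>Cand\<close> and \<open>Ready\<close>.\<close>

definition pre_rollout :: "('t, 'o, 'a, 'c, 'x, 'w, 'w measure) step_fun" where
  "pre_rollout S = sigma_gen (\<Omega> S)
     (Agents S \<Otimes>\<^sub>M Seeds S \<Otimes>\<^sub>M PiM UNIV (\<lambda>_. Tasks S) \<Otimes>\<^sub>M PiM UNIV (\<lambda>_. Outputs S))
     (\<lambda>\<omega>. (current S \<omega>, seed S \<omega>, \<lambda>i. task S i \<omega>, \<lambda>i. outp S i \<omega>))"

abbreviation material_space :: "('t, 'o, 'a, 'c, 'x, 'w, (nat \<Rightarrow> 't) measure) step_fun" where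
  "material_space S \<equiv> PiM {..<n_F S} (\<lambda>_. Tasks S)"

definition G_space :: "('t, 'o, 'a, 'c, 'x, 'w,
    ('a \<times> 'c option \<times> (nat \<Rightarrow> 't) option \<times> nat \<times> 'x) measure) step_fun" where
  "G_space S = Agents S \<Otimes>\<^sub>M option_space (Mods S) \<Otimes>\<^sub>M option_space (material_space S)
     \<Otimes>\<^sub>M count_space UNIV \<Otimes>\<^sub>M Seeds S"

text \<open>\<open>G_info\<close> generates the sigma-algebra \<open>\<G>\<close> of frozen information.\<close>

definition G_info ::
    "('t, 'o, 'a, 'c, 'x, 'w, 'w \<Rightarrow> 'a \<times> 'c option \<times> (nat \<Rightarrow> 't) option \<times> nat \<times> 'x) step_fun" where
  "G_info S \<omega> = (current S \<omega>, delta_C S \<omega>, material S \<omega>, offset S \<omega>, seed S \<omega>)"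

abbreviation stored_tasks_space :: "('t, 'o, 'a, 'c, 'x, 'w, (nat \<Rightarrow> 't) measure) step_fun" where
  "stored_tasks_space S \<equiv> PiM {..<n_R S} (\<lambda>_. Tasks S)"

definition records_space ::
    "('t, 'o, 'a, 'c, 'x, 'w, ((nat \<Rightarrow> 't) \<times> (nat \<Rightarrow> bool)) measure) step_fun" where
  "records_space S = stored_tasks_space S \<Otimes>\<^sub>M PiM {..<n_R S} (\<lambda>_. count_space UNIV)"

definition records ::
    "('t, 'o, 'a, 'c, 'x, 'w, 'w \<Rightarrow> (nat \<Rightarrow> 't) \<times> (nat \<Rightarrow> bool)) step_fun" where
  "records S \<omega> = (\<lambda>j\<in>{..<n_R S}. t_R S j \<omega>, \<lambda>j\<in>{..<n_R S}. phi_R S j \<omega>)"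


subsection \<open>The protocol\<close>

definition one_candidate_protocol :: "('t, 'o, 'a, 'c, 'x, 'w) step \<Rightarrow> bool" where
  "one_candidate_protocol S \<longleftrightarrow>
     valid_environment S \<and> prob_space (\<Omega> S) \<and>
     0 < n_F S \<and> 0 < n_R S \<and> 0 < n_roll S \<and> 0 < block_gap S \<and>
     risk_V S \<in> {0<..<1} \<and> risk_Z S \<in> {0<..<1} \<and> risk_R S \<in> {0<..<1} \<and> risk_F S \<in> {0<..<1} \<and>
     current S \<in> \<Omega> S \<rightarrow>\<^sub>M Agents S \<and> seed S \<in> \<Omega> S \<rightarrow>\<^sub>M Seeds S \<and>
     (\<forall>n. task S n \<in> \<Omega> S \<rightarrow>\<^sub>M Tasks S) \<and> (\<forall>n. outp S n \<in> \<Omega> S \<rightarrow>\<^sub>M Outputs S) \<and>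
     (\<forall>b e l. rollout S b e l \<in> \<Omega> S \<rightarrow>\<^sub>M Outputs S) \<and>
     (\<forall>\<omega>\<in>space (\<Omega> S). Z S (current S \<omega>) \<in> {0<..<1}) \<and>
     (\<lambda>(A, c). apply_mod S A c) \<in> Agents S \<Otimes>\<^sub>M Mods S \<rightarrow>\<^sub>M Agents S \<and>
     (\<lambda>(A, x). gen_kern S A x) \<in> Agents S \<Otimes>\<^sub>M material_space S \<rightarrow>\<^sub>M prob_algebra (option_space (Mods S)) \<and>
     stopping_time (history S) (gen_start S) \<and>
     (\<forall>B\<in>sets (option_space (Mods S)). AE \<omega> in \<Omega> S. \<forall>x. material S \<omega> = Some x \<longrightarrow>
        cprob (\<Omega> S)
          (sigma_gen (\<Omega> S) (Agents S \<Otimes>\<^sub>M option_space (material_space S)) (\<lambda>\<omega>. (current S \<omega>, material S \<omega>)))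
          {\<omega>'\<in>space (\<Omega> S). delta_C S \<omega>' \<in> B} \<omega>
        = measure (gen_kern S (current S \<omega>) x) B) \<and>
     (\<forall>\<omega>\<in>space (\<Omega> S). material S \<omega> = None \<longrightarrow> delta_C S \<omega> = None) \<and>
     \<comment> \<open>nothing frozen depends on arrivals of the window or later ones\<close>
     stopping_time (history S) (win_start S) \<and>
     delta_C S \<in> frozen_info S \<rightarrow>\<^sub>M option_space (Mods S) \<and>
     offset S \<in> frozen_info S \<rightarrow>\<^sub>M count_space UNIV \<and>
     avail S \<in> sets (frozen_info S) \<and>
     horizon S \<in> frozen_info S \<rightarrow>\<^sub>M count_space UNIV \<and>
     eps_F S \<in> borel_measurable (frozen_info S) \<and>
     (\<forall>\<omega>\<in>Cand S. \<forall>n\<in>set (gen_pos S \<omega>). n < win_start S \<omega>) \<and>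
     (\<forall>\<omega>\<in>avail S. \<forall>j<n_R S. stored_pos S (offset S \<omega>) j < win_start S \<omega>) \<and>
     \<comment> \<open>fresh rollouts: on \<open>Cand \<inter> Ready\<close> and conditionally on everything else, they are
        independent across agents, slots and repetitions, with laws given by the agents' kernels\<close>
     (\<forall>K. finite K \<longrightarrow> (\<forall>B. (\<forall>k\<in>K. B k \<in> sets (Outputs S)) \<longrightarrow>
        (AE \<omega> in \<Omega> S. \<omega> \<in> Cand S \<inter> Ready S \<and> K \<subseteq> UNIV \<times> eval_slots S \<omega> \<times> {..<n_roll S} \<longrightarrow>
           cprob (\<Omega> S) (pre_rollout S)
             {\<omega>'\<in>space (\<Omega> S). \<forall>(b, e, l)\<in>K. rollout S b e l \<omega>' \<in> B (b, e, l)} \<omega>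
           = (\<Prod>(b, e, l)\<in>K. measure (kern S (agent_of S b \<omega>) (task_of S e \<omega>)) (B (b, e, l))))))"


subsection \<open>Standard evaluation conditions\<close>

definition stream_condition :: "('t, 'o, 'a, 'c, 'x, 'w) step \<Rightarrow> bool" where
  "stream_condition S \<longleftrightarrow>
     stationary_process (\<Omega> S) (Tasks S) (task S) \<and>
     ergodic_process (\<Omega> S) (Tasks S) (task S) \<and>
     (\<forall>n. distr (\<Omega> S) (Tasks S) (task S n) = D_user S) \<and>
     beta S \<longlonglongrightarrow> 0"

text \<open>Conditionally on its task and on everything else in the stream, an output follows the current
  agent's kernel; conditional independence of the rollouts is part of \<open>one_candidate_protocol\<close>.\<close>

definition output_condition :: "('t, 'o, 'a, 'c, 'x, 'w) step \<Rightarrow> bool" where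
  "output_condition S \<longleftrightarrow>
     (\<forall>n. \<forall>B\<in>sets (Outputs S). AE \<omega> in \<Omega> S.
        cprob (\<Omega> S) (all_but_output S n) {\<omega>'\<in>space (\<Omega> S). outp S n \<omega>' \<in> B} \<omega>
        = measure (kern S (current S \<omega>) (task S n \<omega>)) B)"

definition is_reference_law :: "('t, 'o, 'a, 'c, 'x, 'w) step \<Rightarrow>
    (('a \<times> 'c option \<times> (nat \<Rightarrow> 't) option \<times> nat \<times> 'x) \<times> ((nat \<Rightarrow> 't) \<times> (nat \<Rightarrow> bool))) measure \<Rightarrow> bool" where
  "is_reference_law S Q \<longleftrightarrow>
     prob_space Q \<and> sets Q = sets (G_space S \<Otimes>\<^sub>M records_space S) \<and>
     distr Q (G_space S) fst = distr (\<Omega> S) (G_space S) (G_info S) \<and>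
     (\<forall>B. (\<forall>j<n_R S. B j \<in> sets (Tasks S)) \<longrightarrow>
        (AE (g, t, b) in Q.
           cprob Q (sigma_gen Q (G_space S) fst)
             {(g', t', b')\<in>space Q. \<forall>j<n_R S. t' j \<in> B j} (g, t, b)
           = (\<Prod>j<n_R S. measure (D_user S) (B j)))) \<and>
     (\<forall>y. AE (g, t, b) in Q.
        cprob Q (sigma_gen Q (G_space S \<Otimes>\<^sub>M stored_tasks_space S) (\<lambda>(g, t, b). (g, t)))
          {(g', t', b')\<in>space Q. \<forall>j<n_R S. b' j = y j} (g, t, b)
        = (\<Prod>j<n_R S. pmf (bernoulli_pmf (psi S (fst g) (t j))) (y j)))"

definition stored_sample_condition :: "('t, 'o, 'a, 'c, 'x, 'w) step \<Rightarrow> bool" where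
  "stored_sample_condition S \<longleftrightarrow>
     (\<forall>\<omega>\<in>Cand S \<inter> Ready S.
        set (gen_pos S \<omega>) \<inter>
          (set (batch_pos S \<omega>) \<union> stored_pos S (offset S \<omega>) ` {..<n_R S}) = {}) \<and>
     (\<exists>Q. is_reference_law S Q \<and>
        tv_dist (distr (\<Omega> S) (G_space S \<Otimes>\<^sub>M records_space S) (\<lambda>\<omega>. (G_info S \<omega>, records S \<omega>))) Q
        \<le> coupling_cost S)"

definition failure_batch_condition :: "('t, 'o, 'a, 'c, 'x, 'w) step \<Rightarrow> bool" where
  "failure_batch_condition S \<longleftrightarrow>
     measure (\<Omega> S) {\<omega> \<in> Cand S \<inter> Ret_F S.
        eps_F S \<omega> <
        \<bar>(1 / real (n_F S)) * (\<Sum>i<n_F S. Adv S (current S \<omega>) (candidate S \<omega>) (t_F S i \<omega>))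
          - (\<integral>t. Adv S (current S \<omega>) (candidate S \<omega>) t \<partial>D_F S (current S \<omega>))\<bar>}
     \<le> risk_F S"

definition standard_evaluation_conditions :: "('t, 'o, 'a, 'c, 'x, 'w) step \<Rightarrow> bool" where
  "standard_evaluation_conditions S \<longleftrightarrow>
     stream_condition S \<and> output_condition S \<and> stored_sample_condition S \<and>
     failure_batch_condition S \<and> coupling_cost S < min (risk_Z S) (risk_R S)"

end

theory Submission
  imports Defs
begin

text \<open>
  Write \<open>f\<close> for the advantage of the candidate. The gain equals
  \<open>Z E\<^sub>F f + E[(1 - \<psi>) f]\<close>, which is at least \<open>Z E\<^sub>F f - E[(1 - \<psi>) \<bar>f\<bar>]\<close>. The first term is
  controlled by the failure batch and \<open>Z_hat\<close>; the second is the mean of the bounded function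
  \<open>(t, \<phi>) \<mapsto> (1 - \<phi>) \<bar>f t\<bar>\<close> of one stored record, so Hoeffding's inequality applies to the whole
  stored sample and no conditioning on its success-marked part is needed. Both Hoeffding bounds on
  stored records are proved under the reference law, where the records are i.i.d. given the frozen
  information, and transferred at the price of the coupling cost. Rollouts are handled slot by slot,
  conditionally on everything else. A union bound over these events uses \<open>risk_Z\<close> only once.
\<close>

section \<open>Conditional laws given by product kernels\<close>

text \<open>The conditions give conditional laws as \<open>cprob\<close> identities, one almost-sure
  statement per fixed rectangle, with a null set that may vary with the rectangle. The deviation
  events are not of that shape: agent, candidate and tasks enter them as random parameters of the
  sampled function. The bridge is a disintegration: the joint law of parameter and sample on the
  conditioning event, and the mixture of product kernels, are finite measures that agree on
  rectangles and hence everywhere. The kernels are given explicitly, so this works on arbitrary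
  measurable spaces. Hoeffding's inequality is then applied at fixed parameters only. The events fit
  together because \<open>1 - Z_hat\<close> is exactly the fraction of success-marked records:
  \<open>D_R_hat\<close> times this fraction is an average over all \<open>n_R\<close> records with
  a deterministic normalisation, the same one as for the bounded function above.\<close>

lemma measurable_sigma_gen: "X \<in> M \<rightarrow>\<^sub>M N \<Longrightarrow> X \<in> sigma_gen M N X \<rightarrow>\<^sub>M N"
  unfolding sigma_gen_def by (rule measurable_vimage_algebra1) (simp add: measurable_space Pi_iff)

lemma space_sigma_gen [simp]: "space (sigma_gen M N X) = space M"
  by (simp add: sigma_gen_def)

lemma sets_sigma_gen_subset:
  assumes "space F = space M" "X \<in> F \<rightarrow>\<^sub>M N"
  shows "sets (sigma_gen M N X) \<subseteq> sets F"
proof -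
  have "X \<in> space M \<rightarrow> space N"
    using measurable_space[OF assms(2)] assms(1) by auto
  then have "sets (sigma_gen M N X) = {X -` A \<inter> space M | A. A \<in> sets N}"
    unfolding sigma_gen_def by (rule sets_vimage_algebra2)
  also have "\<dots> \<subseteq> sets F"
    using measurable_sets[OF assms(2)] assms(1) by auto
  finally show ?thesis .
qed

lemma subalgebra_sigma_gen: "X \<in> M \<rightarrow>\<^sub>M N \<Longrightarrow> subalgebra M (sigma_gen M N X)"
  unfolding subalgebra_def by (simp add: sets_sigma_gen_subset)

text \<open>Averaging property of conditional expectation on the \<open>F\<close>-event
  \<open>A\<close>. The formula \<open>g\<close> has to match \<open>cprob\<close> on
  \<open>A\<close> only, because nothing outside \<open>A\<close> is integrated; this fits the
  rollout law, which is assumed only on \<open>Cand\<close> and \<open>Ready\<close>.\<close>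

lemma emeasure_Int_cprob:
  assumes "prob_space M" and F: "subalgebra M F" and A: "A \<in> sets F" and B: "B \<in> sets M"
    and g: "AE \<omega> in M. \<omega> \<in> A \<longrightarrow> cprob M F B \<omega> = g \<omega>"
  shows "emeasure M (A \<inter> B) = (\<integral>\<^sup>+\<omega>. ennreal (g \<omega>) * indicator A \<omega> \<partial>M)"
proof -
  interpret prob_space M by fact
  interpret finite_measure_subalgebra M F by unfold_locales (rule F)
  interpret sigma_finite_subalgebra M F
    by (rule finite_measure_subalgebra_is_sigma_finite) unfold_locales
  have AM [measurable]: "A \<in> sets M" using F A by (auto simp: subalgebra_def)
  note B [measurable]
  have nn: "AE \<omega> in M. 0 \<le> cprob M F B \<omega>"
    unfolding cprob_def by (rule real_cond_exp_pos) auto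
  have int: "integrable M (cprob M F B)"
    unfolding cprob_def
    by (intro real_cond_exp_int integrable_const_bound[where B=1]) auto
  have "emeasure M (A \<inter> B) = ennreal (measure M (A \<inter> B))"
    by (rule emeasure_eq_measure)
  also have "measure M (A \<inter> B) = (\<integral>\<omega>\<in>A. indicator B \<omega> \<partial>M)"
    by (simp add: set_lebesgue_integral_def indicator_inter_arith[symmetric])
  also have "\<dots> = (\<integral>\<omega>\<in>A. cprob M F B \<omega> \<partial>M)"
    unfolding cprob_def using A
    by (intro real_cond_exp_intA integrable_const_bound[where B=1]) auto
  also have "ennreal \<dots> = (\<integral>\<^sup>+\<omega>. ennreal (indicator A \<omega> * cprob M F B \<omega>) \<partial>M)"
    unfolding set_lebesgue_integral_def real_scaleR_def
    using nn by (intro nn_integral_eq_integral[symmetric] integrable_real_mult_indicator[of A M "cprob M F B", simplified mult.commute] int AM)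
       (auto split: split_indicator)
  also have "\<dots> = (\<integral>\<^sup>+\<omega>. ennreal (g \<omega>) * indicator A \<omega> \<partial>M)"
    using g by (intro nn_integral_cong_AE) (auto split: split_indicator)
  finally show ?thesis .
qed

text \<open>The radius solves \<open>2 * exp (- 2 * n * e^2) = b\<close>. The sample space is a
  product measure because the conditional laws of rollouts and records take that form.\<close>

lemma Hoeffding_PiM:
  fixes f :: "'b \<Rightarrow> real"
  assumes "prob_space D" and f [measurable]: "f \<in> borel_measurable D"
    and bnd: "\<And>x. x \<in> space D \<Longrightarrow> f x \<in> {0..1}" and n: "0 < n" and b: "0 < b"
  shows "measure (PiM {..<n} (\<lambda>_. D)) {x \<in> space (PiM {..<n} (\<lambda>_. D)).
           sqrt (ln (2 / b) / (2 * real n)) < \<bar>(1 / real n) * (\<Sum>l<n. f (x l)) - (\<integral>y. f y \<partial>D)\<bar>} \<le> b"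
proof -
  define P where "P = PiM {..<n} (\<lambda>_. D)"
  define e where "e = sqrt (ln (2 / b) / (2 * real n))"
  interpret D: prob_space D by fact
  interpret P: prob_space P unfolding P_def by (intro prob_space_PiM assms(1))
  have comp [measurable]: "(\<lambda>x. x i) \<in> P \<rightarrow>\<^sub>M D" if "i \<in> {..<n}" for i
    unfolding P_def using that by (rule measurable_component_singleton)
  have distr_comp: "distr P D (\<lambda>x. x i) = D" if "i \<in> {..<n}" for i
    unfolding P_def using distr_PiM_component[of "{..<n}" "\<lambda>_. D" i] assms(1) that by simp
  have "P.indep_vars (\<lambda>_. D) (\<lambda>i x. x i) {..<n}"
  proof (subst P.indep_vars_iff_distr_eq_PiM')
    have "distr P (PiM {..<n} (\<lambda>_. D)) (\<lambda>x. \<lambda>i\<in>{..<n}. x i) = distr P P (\<lambda>x. x)"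
      unfolding P_def by (intro distr_cong) (auto simp: space_PiM fun_eq_iff PiE_def extensional_def)
    also have "\<dots> = PiM {..<n} (\<lambda>i. distr P D (\<lambda>x. x i))"
      by (subst distr_id) (auto simp: P_def distr_comp[unfolded P_def] intro!: PiM_cong)
    finally show "distr P (PiM {..<n} (\<lambda>_. D)) (\<lambda>x. \<lambda>i\<in>{..<n}. x i) = PiM {..<n} (\<lambda>i. distr P D (\<lambda>x. x i))" .
  qed (use n in auto)
  then have indep: "P.indep_vars (\<lambda>_. borel) (\<lambda>i x. f (x i)) {..<n}"
    by (rule P.indep_vars_compose2) simp
  have E: "P.expectation (\<lambda>x. f (x i)) = (\<integral>y. f y \<partial>D)" if "i \<in> {..<n}" for i
    using integral_distr[OF comp[OF that] f] distr_comp[OF that] by simp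
  interpret H: Hoeffding_ineq P "{..<n}" "\<lambda>i x. f (x i)" "\<lambda>_. 0" "\<lambda>_. 1" "real n * (\<integral>y. f y \<partial>D)"
  proof unfold_locales
    show "AE x in P. f (x i) \<in> {0..1}" if "i \<in> {..<n}" for i
      using measurable_space[OF comp[OF that]] bnd by (intro AE_I2) auto
    show "real n * (\<integral>y. f y \<partial>D) \<equiv> \<Sum>i<n. P.expectation (\<lambda>x. f (x i))"
      by (rule eq_reflection) (simp add: E)
  qed (use indep in auto)
  show ?thesis
  \<comment> \<open>For \<open>b < 1\<close> the logarithm is positive, so the square of the radius
    is its radicand. Otherwise the bound holds because probabilities are at most 1.\<close>
  proof (cases "b < 1")
    case False
    then show ?thesis using P.prob_le_1 unfolding P_def by (meson not_less order_trans)
  next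
    case True
    have e2: "e\<^sup>2 = ln (2 / b) / (2 * real n)" and e0: "0 \<le> e"
      using b True unfolding e_def by (auto intro!: divide_nonneg_nonneg)
    have "measure P {x \<in> space P. e < \<bar>(1 / real n) * (\<Sum>l<n. f (x l)) - (\<integral>y. f y \<partial>D)\<bar>}
        \<le> measure P {x \<in> space P. \<bar>(\<Sum>l<n. f (x l)) - real n * (\<integral>y. f y \<partial>D)\<bar> \<ge> real n * e}"
    proof (rule P.finite_measure_mono)
      show "{x \<in> space P. e < \<bar>(1 / real n) * (\<Sum>l<n. f (x l)) - (\<integral>y. f y \<partial>D)\<bar>}
        \<subseteq> {x \<in> space P. \<bar>(\<Sum>l<n. f (x l)) - real n * (\<integral>y. f y \<partial>D)\<bar> \<ge> real n * e}"
      proof safe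
        fix x assume "e < \<bar>(1 / real n) * (\<Sum>l<n. f (x l)) - (\<integral>y. f y \<partial>D)\<bar>"
        then have "real n * e \<le> real n * \<bar>(1 / real n) * (\<Sum>l<n. f (x l)) - (\<integral>y. f y \<partial>D)\<bar>"
          by (intro mult_left_mono) auto
        also have "\<dots> = \<bar>(\<Sum>l<n. f (x l)) - real n * (\<integral>y. f y \<partial>D)\<bar>"
          using n by (subst abs_of_nat[symmetric], subst abs_mult[symmetric]) (simp add: right_diff_distrib)
        finally show "real n * e \<le> \<bar>(\<Sum>l<n. f (x l)) - real n * (\<integral>y. f y \<partial>D)\<bar>" .
      qed
    qed measurable
    also have "\<dots> \<le> 2 * exp (- 2 * (real n * e)\<^sup>2 / (\<Sum>i<n. (1 - 0)\<^sup>2))"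
      by (rule H.Hoeffding_ineq_abs_ge) (use n e0 in auto)
    also have "- 2 * (real n * e)\<^sup>2 / (\<Sum>i<n. (1 - 0)\<^sup>2) = - ln (2 / b)"
      using n by (simp add: power_mult_distrib e2) (simp add: power2_eq_square)
    also have "2 * exp (- ln (2 / b)) = b"
      using b by (simp add: exp_minus)
    finally show ?thesis unfolding P_def e_def .
  qed
qed

text \<open>A product kernel can be tested on finite rectangles, where its value is a finite product
  of measurable functions of \<open>y\<close>.\<close>

lemma measurable_PiM_kernel:
  assumes I: "finite I" and K: "K \<in> N \<rightarrow>\<^sub>M prob_algebra P"
  shows "(\<lambda>y. PiM I (\<lambda>_. K y)) \<in> N \<rightarrow>\<^sub>M prob_algebra (PiM I (\<lambda>_. P))"
proof (rule measurable_prob_algebra_generated)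
  have prob: "prob_space (K y)" "sets (K y) = sets P" if "y \<in> space N" for y
    using measurable_space[OF K that] by (auto simp: space_prob_algebra)
  show "sets (PiM I (\<lambda>_. P)) = sigma_sets (\<Pi>\<^sub>E i\<in>I. space P) (prod_algebra I (\<lambda>_. P))"
    by (rule sets_PiM)
  show "Int_stable (prod_algebra I (\<lambda>_. P))" by (rule Int_stable_prod_algebra)
  show "prod_algebra I (\<lambda>_. P) \<subseteq> Pow (\<Pi>\<^sub>E i\<in>I. space P)" by (rule prod_algebra_sets_into_space)
  show "prob_space (PiM I (\<lambda>_. K y))" if "y \<in> space N" for y
    by (intro prob_space_PiM prob that)
  show "sets (PiM I (\<lambda>_. K y)) = sets (PiM I (\<lambda>_. P))" if "y \<in> space N" for y
    by (intro sets_PiM_cong prob that refl)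
  fix A assume "A \<in> prod_algebra I (\<lambda>_. P)"
  then obtain E where E: "A = Pi\<^sub>E I E" "\<And>i. i \<in> I \<Longrightarrow> E i \<in> sets P"
    by (auto simp: prod_algebra_eq_finite[OF I])
  have "emeasure (PiM I (\<lambda>_. K y)) A = (\<Prod>i\<in>I. emeasure (K y) (E i))" if "y \<in> space N" for y
  proof -
    interpret Ky: prob_space "K y" by (rule prob that)+
    interpret product_sigma_finite "\<lambda>_. K y" by unfold_locales
    show ?thesis unfolding E(1) by (rule emeasure_PiM) (use I E prob that in auto)
  qed
  moreover have "(\<lambda>y. \<Prod>i\<in>I. emeasure (K y) (E i)) \<in> borel_measurable N"
    using K[THEN measurable_prob_algebraD] E(2)
    by (intro borel_measurable_prod_ennreal measurable_compose[OF _ measurable_emeasure_subprob_algebra]) auto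
  ultimately show "(\<lambda>y. emeasure (PiM I (\<lambda>_. K y)) A) \<in> borel_measurable N"
    by (simp cong: measurable_cong)
qed

text \<open>On \<open>W\<close>, the random vector \<open>X\<close> has conditional law \<open>K (Y \<omega>)\<^sup>I\<close>. Testing this on
  rectangles suffices, as these form an intersection-stable generator.\<close>

lemma nn_integral_disintegrate_PiM:
  assumes "prob_space M" and I: "finite I"
    and Y [measurable]: "Y \<in> M \<rightarrow>\<^sub>M N" and X [measurable]: "X \<in> M \<rightarrow>\<^sub>M PiM I (\<lambda>_. P)"
    and W [measurable]: "W \<in> sets M" and K: "K \<in> N \<rightarrow>\<^sub>M prob_algebra P"
    and rect: "\<And>C E. C \<in> sets N \<Longrightarrow> (\<And>i. i \<in> I \<Longrightarrow> E i \<in> sets P) \<Longrightarrow>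
      emeasure M {\<omega> \<in> W. Y \<omega> \<in> C \<and> (\<forall>i\<in>I. X \<omega> i \<in> E i)}
      = (\<integral>\<^sup>+\<omega>. (\<Prod>i\<in>I. emeasure (K (Y \<omega>)) (E i)) * indicator {\<omega> \<in> W. Y \<omega> \<in> C} \<omega> \<partial>M)"
    and h [measurable]: "h \<in> borel_measurable (N \<Otimes>\<^sub>M PiM I (\<lambda>_. P))"
  shows "(\<integral>\<^sup>+\<omega>. h (Y \<omega>, X \<omega>) * indicator W \<omega> \<partial>M)
    = (\<integral>\<^sup>+\<omega>. (\<integral>\<^sup>+x. h (Y \<omega>, x) \<partial>PiM I (\<lambda>_. K (Y \<omega>))) * indicator W \<omega> \<partial>M)"
proof -
  interpret prob_space M by fact
  let ?PI = "PiM I (\<lambda>_. P)"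
  define L where "L y = PiM I (\<lambda>_. K y)" for y
  have L: "L \<in> N \<rightarrow>\<^sub>M prob_algebra ?PI"
    unfolding L_def by (rule measurable_PiM_kernel) fact+
  note L' [measurable] = L[THEN measurable_prob_algebraD]
  \<comment> \<open>Weighting by \<open>indicator W\<close> restricts \<open>M\<close> to the
    conditioning event and keeps the measure finite, which the uniqueness theorem for measures uses
    below.\<close>
  define MW where "MW = density M (indicator W)"
  \<comment> \<open>\<open>k \<omega>\<close> freezes the first coordinate at
    \<open>Y \<omega>\<close> and draws the second one from the product kernel.\<close>
  define k where "k \<omega> = distr (L (Y \<omega>)) (N \<Otimes>\<^sub>M ?PI) (Pair (Y \<omega>))" for \<omega>
  have k: "k \<in> MW \<rightarrow>\<^sub>M subprob_algebra (N \<Otimes>\<^sub>M ?PI)"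
    unfolding k_def MW_def by (rule measurable_distr2[where M="?PI"]) measurable
  have kM: "k \<in> M \<rightarrow>\<^sub>M subprob_algebra (N \<Otimes>\<^sub>M ?PI)" using k by (simp add: MW_def)
  have prob: "prob_space (K y)" "sets (K y) = sets P" if "y \<in> space N" for y
    using measurable_space[OF K that] by (auto simp: space_prob_algebra)
  have setsL: "sets (L y) = sets ?PI" if "y \<in> space N" for y
    unfolding L_def by (intro sets_PiM_cong prob that refl)
  have spN: "Y \<omega> \<in> space N" if "\<omega> \<in> space M" for \<omega>
    using measurable_space[OF Y that] .
  have neM: "space MW \<noteq> {}" using not_empty by (simp add: MW_def)
  have int_k: "(\<integral>\<^sup>+z. g z \<partial>k \<omega>) = (\<integral>\<^sup>+x. g (Y \<omega>, x) \<partial>L (Y \<omega>))"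
    if "\<omega> \<in> space M" and g: "g \<in> borel_measurable (N \<Otimes>\<^sub>M ?PI)" for \<omega> g
  proof -
    have "Pair (Y \<omega>) \<in> L (Y \<omega>) \<rightarrow>\<^sub>M N \<Otimes>\<^sub>M ?PI"
      using spN[OF that(1)] setsL[OF spN[OF that(1)]]
      by (simp add: measurable_cong_sets[OF setsL[OF spN[OF that(1)]] refl])
    then show ?thesis unfolding k_def by (rule nn_integral_distr) (use g in simp)
  qed
  \<comment> \<open>Both sides are finite measures on the product space; agreement on rectangles,
    which is \<open>rect\<close>, extends to all events and then to every integrand
    \<open>h\<close>.\<close>
  have eq: "distr MW (N \<Otimes>\<^sub>M ?PI) (\<lambda>\<omega>. (Y \<omega>, X \<omega>)) = MW \<bind> k" (is "?l = ?r")
  proof (rule measure_eqI_generator_eq[where E="{a \<times> b | a b. a \<in> sets N \<and> b \<in> prod_algebra I (\<lambda>_. P)}"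
        and \<Omega>="space N \<times> space ?PI" and A="\<lambda>_. space N \<times> space ?PI"])
    let ?E = "{a \<times> b | a b. a \<in> sets N \<and> b \<in> prod_algebra I (\<lambda>_. P)}"
    have top: "(\<Pi>\<^sub>E i\<in>I. space P) \<in> prod_algebra I (\<lambda>_. P)"
      by (rule prod_algebraI_finite) (use I in auto)
    show "Int_stable ?E"
    proof (rule Int_stableI)
      fix a b assume "a \<in> ?E" "b \<in> ?E"
      then obtain a1 a2 b1 b2 where ab: "a = a1 \<times> a2" "b = b1 \<times> b2" "a1 \<in> sets N" "b1 \<in> sets N"
        "a2 \<in> prod_algebra I (\<lambda>_. P)" "b2 \<in> prod_algebra I (\<lambda>_. P)" by blast
      then have "a \<inter> b = (a1 \<inter> b1) \<times> (a2 \<inter> b2)" by auto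
      moreover have "a2 \<inter> b2 \<in> prod_algebra I (\<lambda>_. P)"
        using Int_stableD[OF Int_stable_prod_algebra] ab by blast
      ultimately show "a \<inter> b \<in> ?E" using ab by blast
    qed
    show "?E \<subseteq> Pow (space N \<times> space ?PI)"
      using sets.sets_into_space[of _ N] prod_algebra_sets_into_space[of I "\<lambda>_. P"]
      by (fastforce simp: space_PiM)
    have gen: "sets (N \<Otimes>\<^sub>M ?PI) = sigma_sets (space N \<times> space ?PI) ?E"
    proof -
      have "sets (N \<Otimes>\<^sub>M ?PI) = sets (sigma (space N \<times> space ?PI) ?E)"
        by (rule sets_pair_eq[where Ca="{space N}" and Cb="{space ?PI}"])
           (use sets.space_closed[of N] prod_algebra_sets_into_space[of I "\<lambda>_. P"] top
            in \<open>auto simp: sets.sigma_sets_eq sets_PiM space_PiM\<close>)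
      also have "\<dots> = sigma_sets (space N \<times> space ?PI) ?E"
        by (rule sets_measure_of) fact
      finally show ?thesis .
    qed
    show "sets ?l = sigma_sets (space N \<times> space ?PI) ?E"
      using gen by simp
    show "sets ?r = sigma_sets (space N \<times> space ?PI) ?E"
      using gen sets_bind_measurable[OF k neM] by simp
    show "range (\<lambda>_. space N \<times> space ?PI) \<subseteq> ?E"
      using top by (auto simp: space_PiM)
    show "(\<Union>i. space N \<times> space ?PI) = space N \<times> space ?PI" by simp
    have "emeasure ?l (space N \<times> space ?PI) \<le> emeasure ?l (space ?l)"
      by (rule emeasure_mono) (auto simp: space_pair_measure)
    also have "\<dots> \<le> 1"
      by (simp add: emeasure_distr MW_def emeasure_restricted emeasure_le_1)
    finally show "emeasure ?l (space N \<times> space ?PI) \<noteq> \<infinity>" for i :: nat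
      by (auto simp: top_unique)
    fix D assume "D \<in> ?E"
    then obtain C E where D: "D = C \<times> Pi\<^sub>E I E" and C [measurable]: "C \<in> sets N"
      and E: "\<And>i. i \<in> I \<Longrightarrow> E i \<in> sets P"
      by (auto simp: prod_algebra_eq_finite[OF I])
    have PE [measurable]: "Pi\<^sub>E I E \<in> sets ?PI" by (rule sets_PiM_I_finite) (use I E in auto)
    have XD: "X \<omega> \<in> Pi\<^sub>E I E \<longleftrightarrow> (\<forall>i\<in>I. X \<omega> i \<in> E i)" if "\<omega> \<in> space M" for \<omega>
      using measurable_space[OF X that] by (auto simp: space_PiM PiE_iff)
    have Dm [measurable]: "D \<in> sets (N \<Otimes>\<^sub>M ?PI)" unfolding D by measurable
    have "emeasure ?l D = (\<integral>\<^sup>+z. indicator D z \<partial>?l)" by simp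
    also have "\<dots> = (\<integral>\<^sup>+\<omega>. indicator W \<omega> * indicator D (Y \<omega>, X \<omega>) \<partial>M)"
      using Dm by (simp add: MW_def nn_integral_distr nn_integral_density del: nn_integral_indicator)
    also have "\<dots> = (\<integral>\<^sup>+\<omega>. indicator {\<omega> \<in> W. Y \<omega> \<in> C \<and> (\<forall>i\<in>I. X \<omega> i \<in> E i)} \<omega> \<partial>M)"
      using XD by (intro nn_integral_cong) (auto simp: D split: split_indicator)
    also have "\<dots> = emeasure M {\<omega> \<in> W. Y \<omega> \<in> C \<and> (\<forall>i\<in>I. X \<omega> i \<in> E i)}"
    proof (rule nn_integral_indicator)
      have "{\<omega> \<in> W. Y \<omega> \<in> C \<and> (\<forall>i\<in>I. X \<omega> i \<in> E i)} = W \<inter> {\<omega> \<in> space M. Y \<omega> \<in> C \<and> X \<omega> \<in> Pi\<^sub>E I E}"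
        using XD sets.sets_into_space[OF W] by auto
      also have "\<dots> \<in> sets M" by measurable
      finally show "{\<omega> \<in> W. Y \<omega> \<in> C \<and> (\<forall>i\<in>I. X \<omega> i \<in> E i)} \<in> sets M" .
    qed
    also have "\<dots> = (\<integral>\<^sup>+\<omega>. (\<Prod>i\<in>I. emeasure (K (Y \<omega>)) (E i)) * indicator {\<omega> \<in> W. Y \<omega> \<in> C} \<omega> \<partial>M)"
      by (rule rect) fact+
    also have "\<dots> = (\<integral>\<^sup>+\<omega>. indicator W \<omega> * (\<integral>\<^sup>+z. indicator D z \<partial>k \<omega>) \<partial>M)"
    proof (intro nn_integral_cong)
      fix \<omega> assume w: "\<omega> \<in> space M"
      interpret Ky: prob_space "K (Y \<omega>)" by (rule prob spN w)+
      interpret product_sigma_finite "\<lambda>_. K (Y \<omega>)" by unfold_locales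
      have "(\<integral>\<^sup>+z. indicator D z \<partial>k \<omega>) = (\<integral>\<^sup>+x. indicator C (Y \<omega>) * indicator (Pi\<^sub>E I E) x \<partial>L (Y \<omega>))"
        by (subst int_k[OF w]) (auto simp: D indicator_def intro!: nn_integral_cong)
      also have "\<dots> = indicator C (Y \<omega>) * emeasure (L (Y \<omega>)) (Pi\<^sub>E I E)"
        using PE setsL[OF spN[OF w]] by (intro nn_integral_cmult_indicator) auto
      also have "emeasure (L (Y \<omega>)) (Pi\<^sub>E I E) = (\<Prod>i\<in>I. emeasure (K (Y \<omega>)) (E i))"
        unfolding L_def by (rule emeasure_PiM) (use I E prob spN w in auto)
      finally show "(\<Prod>i\<in>I. emeasure (K (Y \<omega>)) (E i)) * indicator {\<omega> \<in> W. Y \<omega> \<in> C} \<omega>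
          = indicator W \<omega> * (\<integral>\<^sup>+z. indicator D z \<partial>k \<omega>)"
        by (auto split: split_indicator)
    qed
    also have "\<dots> = emeasure ?r D"
    proof -
      have "emeasure ?r D = (\<integral>\<^sup>+\<omega>. (\<integral>\<^sup>+z. indicator D z \<partial>k \<omega>) \<partial>MW)"
        using sets_kernel[OF k] Dm
        by (subst emeasure_bind[OF neM k Dm]) (auto intro!: nn_integral_cong)
      also have "\<dots> = (\<integral>\<^sup>+\<omega>. indicator W \<omega> * (\<integral>\<^sup>+z. indicator D z \<partial>k \<omega>) \<partial>M)"
        unfolding MW_def
        by (rule nn_integral_density)
           (use Dm in \<open>auto intro!: measurable_compose[OF kM nn_integral_measurable_subprob_algebra]\<close>)
      finally show ?thesis by simp
    qed
    finally show "emeasure ?l D = emeasure ?r D" .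
  qed
  have "(\<integral>\<^sup>+\<omega>. h (Y \<omega>, X \<omega>) * indicator W \<omega> \<partial>M) = (\<integral>\<^sup>+z. h z \<partial>distr MW (N \<Otimes>\<^sub>M ?PI) (\<lambda>\<omega>. (Y \<omega>, X \<omega>)))"
    unfolding MW_def by (simp add: nn_integral_distr nn_integral_density mult.commute)
  also have "\<dots> = (\<integral>\<^sup>+\<omega>. (\<integral>\<^sup>+z. h z \<partial>k \<omega>) \<partial>MW)"
    unfolding eq by (rule nn_integral_bind[OF h k])
  also have "\<dots> = (\<integral>\<^sup>+\<omega>. indicator W \<omega> * (\<integral>\<^sup>+z. h z \<partial>k \<omega>) \<partial>M)"
    unfolding MW_def
    by (rule nn_integral_density)
       (auto intro!: measurable_compose[OF kM nn_integral_measurable_subprob_algebra] h)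
  also have "\<dots> = (\<integral>\<^sup>+\<omega>. (\<integral>\<^sup>+x. h (Y \<omega>, x) \<partial>PiM I (\<lambda>_. K (Y \<omega>))) * indicator W \<omega> \<partial>M)"
    by (intro nn_integral_cong) (simp add: int_k h L_def mult.commute)
  finally show ?thesis .
qed

text \<open>A bound valid at every frozen \<open>y\<close> survives integration over the random
  \<open>Y \<omega>\<close>. This is how an inequality for fixed parameters is applied to random
  ones.\<close>

lemma measure_disintegrate_PiM_le:
  assumes "prob_space M" and I: "finite I"
    and Y [measurable]: "Y \<in> M \<rightarrow>\<^sub>M N" and X [measurable]: "X \<in> M \<rightarrow>\<^sub>M PiM I (\<lambda>_. P)"
    and W [measurable]: "W \<in> sets M" and K: "K \<in> N \<rightarrow>\<^sub>M prob_algebra P"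
    and rect: "\<And>C E. C \<in> sets N \<Longrightarrow> (\<And>i. i \<in> I \<Longrightarrow> E i \<in> sets P) \<Longrightarrow>
      emeasure M {\<omega> \<in> W. Y \<omega> \<in> C \<and> (\<forall>i\<in>I. X \<omega> i \<in> E i)}
      = (\<integral>\<^sup>+\<omega>. (\<Prod>i\<in>I. emeasure (K (Y \<omega>)) (E i)) * indicator {\<omega> \<in> W. Y \<omega> \<in> C} \<omega> \<partial>M)"
    and H [measurable]: "H \<in> sets (N \<Otimes>\<^sub>M PiM I (\<lambda>_. P))"
    and b: "0 \<le> b"
    and le: "\<And>y. y \<in> space N \<Longrightarrow>
      measure (PiM I (\<lambda>_. K y)) {x \<in> space (PiM I (\<lambda>_. K y)). (y, x) \<in> H} \<le> b"
  shows "measure M {\<omega> \<in> W. (Y \<omega>, X \<omega>) \<in> H} \<le> b"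
proof -
  interpret prob_space M by fact
  have HW: "{\<omega> \<in> W. (Y \<omega>, X \<omega>) \<in> H} \<in> sets M"
  proof -
    have "{\<omega> \<in> W. (Y \<omega>, X \<omega>) \<in> H} = W \<inter> {\<omega> \<in> space M. (Y \<omega>, X \<omega>) \<in> H}"
      using sets.sets_into_space[OF W] by auto
    then show ?thesis by simp
  qed
  have "emeasure M {\<omega> \<in> W. (Y \<omega>, X \<omega>) \<in> H} = (\<integral>\<^sup>+\<omega>. indicator {\<omega> \<in> W. (Y \<omega>, X \<omega>) \<in> H} \<omega> \<partial>M)"
    using HW by simp
  also have "\<dots> = (\<integral>\<^sup>+\<omega>. indicator H (Y \<omega>, X \<omega>) * indicator W \<omega> \<partial>M)"
    by (intro nn_integral_cong) (auto split: split_indicator)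
  also have "\<dots> = (\<integral>\<^sup>+\<omega>. (\<integral>\<^sup>+x. indicator H (Y \<omega>, x) \<partial>PiM I (\<lambda>_. K (Y \<omega>))) * indicator W \<omega> \<partial>M)"
    by (rule nn_integral_disintegrate_PiM[OF assms(1-6) rect]) auto
  also have "\<dots> \<le> (\<integral>\<^sup>+\<omega>. ennreal b \<partial>M)"
  proof (rule nn_integral_mono)
    fix \<omega> assume "\<omega> \<in> space M"
    then have y: "Y \<omega> \<in> space N" by (rule measurable_space[OF Y])
    let ?Q = "PiM I (\<lambda>_. K (Y \<omega>))"
    have Ky: "prob_space (K (Y \<omega>))" "sets (K (Y \<omega>)) = sets P"
      using measurable_space[OF K y] by (auto simp: space_prob_algebra)
    interpret Q: prob_space ?Q by (intro prob_space_PiM Ky)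
    have sQ: "sets ?Q = sets (PiM I (\<lambda>_. P))" by (intro sets_PiM_cong Ky refl)
    note [measurable_cong] = sQ
    have [measurable]: "{x \<in> space ?Q. (Y \<omega>, x) \<in> H} \<in> sets ?Q"
      using y by measurable
    have "(\<integral>\<^sup>+x. indicator H (Y \<omega>, x) \<partial>?Q) = (\<integral>\<^sup>+x. indicator {x \<in> space ?Q. (Y \<omega>, x) \<in> H} x \<partial>?Q)"
      by (intro nn_integral_cong) (auto split: split_indicator)
    also have "\<dots> = ennreal (measure ?Q {x \<in> space ?Q. (Y \<omega>, x) \<in> H})"
      by (simp add: Q.emeasure_eq_measure)
    also have "\<dots> \<le> ennreal b"
      by (rule ennreal_leI) (rule le[OF y])
    finally show "(\<integral>\<^sup>+x. indicator H (Y \<omega>, x) \<partial>?Q) * indicator W \<omega> \<le> ennreal b"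
      by (auto split: split_indicator)
  qed
  also have "\<dots> = ennreal b" by (simp add: emeasure_space_1)
  finally show ?thesis
    using b by (simp add: emeasure_eq_measure)
qed

section \<open>Measurability and total variation\<close>

lemma space_option_space: "space (option_space N) = insert None (Some ` space N)"
  unfolding option_space_def
  by (rule space_measure_of) (use sets.sets_into_space[of _ N] in auto)

lemma None_in_option_space: "{None} \<in> sets (option_space N)"
  and Some_image_in_option_space: "A \<in> sets N \<Longrightarrow> Some ` A \<in> sets (option_space N)"
  using sets.sets_into_space[of _ N] by (auto simp: option_space_def)

text \<open>\<open>option_space N\<close> is the disjoint sum of \<open>N\<close> and a point, so
  measurability can be checked on each piece. The extra argument \<open>x\<close> lets both branches
  depend on the agent.\<close>

lemma measurable_case_option_pair:
  assumes g: "g \<in> M \<rightarrow>\<^sub>M P" and f: "(\<lambda>(x, c). f x c) \<in> M \<Otimes>\<^sub>M N \<rightarrow>\<^sub>M P"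
  shows "(\<lambda>(x, z). case z of None \<Rightarrow> g x | Some c \<Rightarrow> f x c) \<in> M \<Otimes>\<^sub>M option_space N \<rightarrow>\<^sub>M P"
proof -
  let ?O = "M \<Otimes>\<^sub>M option_space N"
  let ?S = "Some ` space N"
  have S [measurable]: "?S \<in> sets (option_space N)" by (rule Some_image_in_option_space) simp
  have [measurable]: "{z \<in> space ?O. snd z \<in> ?S} \<in> sets ?O" by measurable
  \<comment> \<open>\<open>the None\<close> is unspecified and may lie outside
    \<open>space N\<close>, so \<open>the\<close> is considered on the \<open>Some\<close> part
    only.\<close>
  have the: "the \<in> restrict_space (option_space N) ?S \<rightarrow>\<^sub>M N"
  proof (rule measurableI)
    fix A assume A: "A \<in> sets N"
    have "the -` A \<inter> space (restrict_space (option_space N) ?S) = Some ` A"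
      using sets.sets_into_space[OF A] by (auto simp: space_restrict_space space_option_space)
    then show "the -` A \<inter> space (restrict_space (option_space N) ?S) \<in> sets (restrict_space (option_space N) ?S)"
      using Some_image_in_option_space[OF A] sets.sets_into_space[OF A] S
      by (auto simp: sets_restrict_space_iff space_option_space)
  qed (auto simp: space_restrict_space space_option_space)
  have "(\<lambda>z. if snd z \<in> ?S then (\<lambda>(x, c). f x c) (fst z, the (snd z)) else g (fst z)) \<in> ?O \<rightarrow>\<^sub>M P"
  proof (subst measurable_If_restrict_space_iff, measurable, intro conjI)
    let ?R = "restrict_space ?O {z. snd z \<in> ?S}"
    have "snd \<in> ?R \<rightarrow>\<^sub>M restrict_space (option_space N) ?S"
      by (rule measurable_restrict_space3) auto
    from measurable_compose[OF this the]
    have "(\<lambda>z. (fst z, the (snd z))) \<in> ?R \<rightarrow>\<^sub>M M \<Otimes>\<^sub>M N"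
      by (intro measurable_Pair measurable_restrict_space1[OF measurable_fst])
    from measurable_compose[OF this f]
    show "(\<lambda>z. (\<lambda>(x, c). f x c) (fst z, the (snd z))) \<in> ?R \<rightarrow>\<^sub>M P" .
    show "(\<lambda>z. g (fst z)) \<in> restrict_space ?O {z. snd z \<notin> ?S} \<rightarrow>\<^sub>M P"
      using g by (intro measurable_restrict_space1 measurable_compose[OF measurable_fst])
  qed
  also have "?this \<longleftrightarrow> ?thesis"
    by (intro measurable_cong)
       (auto simp: space_pair_measure space_option_space split: option.splits)
  finally show ?thesis .
qed

lemma measurable_Some_option_space: "Some \<in> N \<rightarrow>\<^sub>M option_space N"
  unfolding option_space_def
proof (rule measurable_measure_of)
  show "insert {None} ((`) Some ` sets N) \<subseteq> Pow (insert None (Some ` space N))"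
    using sets.sets_into_space[of _ N] by auto
  fix A assume "A \<in> insert {None} ((`) Some ` sets N)"
  then consider "A = {None}" | B where "A = Some ` B" "B \<in> sets N" by blast
  then show "Some -` A \<inter> space N \<in> sets N"
  proof cases
    case 1
    then have "Some -` A = {}" by auto
    then show ?thesis by simp
  next
    case 2
    then have "Some -` A = B" by auto
    with 2 show ?thesis by simp
  qed
qed simp

text \<open>The failure-marked positions form one random element of the discrete space of lists; its
  length and entries are then measurable by composition.\<close>

lemma measurable_filter_list:
  assumes [measurable]: "\<And>n. Measurable.pred M (\<lambda>\<omega>. P n \<omega>)"
  shows "(\<lambda>\<omega>. filter (\<lambda>n. P n \<omega>) xs) \<in> M \<rightarrow>\<^sub>M count_space UNIV"
proof (induction xs)
  case (Cons n xs)
  have [measurable]: "(\<lambda>\<omega>. n # filter (\<lambda>n. P n \<omega>) xs) \<in> M \<rightarrow>\<^sub>M count_space UNIV"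
    by (rule measurable_compose[OF Cons]) simp
  note Cons [measurable]
  have "(\<lambda>\<omega>. if P n \<omega> then n # filter (\<lambda>n. P n \<omega>) xs else filter (\<lambda>n. P n \<omega>) xs) \<in> M \<rightarrow>\<^sub>M count_space UNIV"
    by measurable
  then show ?case by simp
qed simp

text \<open>A real-valued \<open>SUP\<close> dominates its members only for a family bounded above;
  differences of probabilities are bounded by 1.\<close>

lemma tv_dist_upper:
  assumes "prob_space P" "prob_space Q" "A \<in> sets P"
  shows "\<bar>measure P A - measure Q A\<bar> \<le> tv_dist P Q"
proof -
  have "\<bar>measure P B - measure Q B\<bar> \<le> 1" for B
    using prob_space.prob_le_1[OF assms(1), of B] prob_space.prob_le_1[OF assms(2), of B]
      measure_nonneg[of P B] measure_nonneg[of Q B] by linarith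
  then show ?thesis
    unfolding tv_dist_def by (intro cSUP_upper assms bdd_aboveI[where M=1]) auto
qed

text \<open>Integrand and kernel both depend on \<open>x\<close>. Pushing \<open>L x\<close> forward
  along \<open>Pair x\<close> moves the dependence into the measure and leaves a fixed integrand on
  the product space.\<close>

lemma integral_measurable_kernel:
  fixes f :: "'b \<Rightarrow> 'c \<Rightarrow> real"
  assumes f [measurable]: "(\<lambda>(x, y). f x y) \<in> borel_measurable (M \<Otimes>\<^sub>M N)"
    and L [measurable]: "L \<in> M \<rightarrow>\<^sub>M subprob_algebra N"
  shows "(\<lambda>x. \<integral>y. f x y \<partial>L x) \<in> borel_measurable M"
proof -
  have "(\<lambda>x. distr (L x) (M \<Otimes>\<^sub>M N) (Pair x)) \<in> M \<rightarrow>\<^sub>M subprob_algebra (M \<Otimes>\<^sub>M N)"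
    by (rule measurable_distr2[where M=N]) measurable
  from measurable_compose[OF this integral_measurable_subprob_algebra[OF f]]
  have "(\<lambda>x. \<integral>z. (\<lambda>(x, y). f x y) z \<partial>distr (L x) (M \<Otimes>\<^sub>M N) (Pair x)) \<in> borel_measurable M" .
  also have "?this \<longleftrightarrow> ?thesis"
  proof (rule measurable_cong)
    fix x assume x: "x \<in> space M"
    have "Pair x \<in> L x \<rightarrow>\<^sub>M M \<Otimes>\<^sub>M N"
      using x by (simp add: measurable_cong_sets[OF sets_kernel[OF L x] refl])
    then show "(\<integral>z. (\<lambda>(x, y). f x y) z \<partial>distr (L x) (M \<Otimes>\<^sub>M N) (Pair x)) = (\<integral>y. f x y \<partial>L x)"
      by (subst integral_distr[OF _ f]) auto
  qed
  finally show ?thesis .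
qed

section \<open>Environments\<close>

locale valid_env =
  fixes E :: "('t, 'o, 'a, 'z) environment_scheme"
  assumes valid: "valid_environment E"
begin

lemma kern_measurable: "(\<lambda>(A, t). kern E A t) \<in> Agents E \<Otimes>\<^sub>M Tasks E \<rightarrow>\<^sub>M prob_algebra (Outputs E)"
  and reward_measurable [measurable]: "(\<lambda>(t, u). reward E t u) \<in> borel_measurable (Tasks E \<Otimes>\<^sub>M Outputs E)"
  and reward_bounds: "\<And>t u. t \<in> space (Tasks E) \<Longrightarrow> u \<in> space (Outputs E) \<Longrightarrow> reward E t u \<in> {0..1}"
  and failure_measurable [measurable]: "(\<lambda>(t, u). failure E t u) \<in> Tasks E \<Otimes>\<^sub>M Outputs E \<rightarrow>\<^sub>M count_space UNIV"
  and prob_D_user: "prob_space (D_user E)"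
  and sets_D_user [measurable_cong]: "sets (D_user E) = sets (Tasks E)"
  using valid by (auto simp: valid_environment_def)

lemma space_D_user: "space (D_user E) = space (Tasks E)"
  by (rule sets_eq_imp_space_eq) (rule sets_D_user)

sublocale D: prob_space "D_user E"
  by (rule prob_D_user)

lemma prob_kern: "A \<in> space (Agents E) \<Longrightarrow> t \<in> space (Tasks E) \<Longrightarrow> prob_space (kern E A t)"
  and sets_kern: "A \<in> space (Agents E) \<Longrightarrow> t \<in> space (Tasks E) \<Longrightarrow> sets (kern E A t) = sets (Outputs E)"
  using measurable_space[OF kern_measurable, of "(A, t)"]
  by (auto simp: space_prob_algebra space_pair_measure)

lemma kern_integral_measurable:
  fixes f :: "'t \<Rightarrow> 'o \<Rightarrow> real"
  assumes [measurable]: "(\<lambda>(t, u). f t u) \<in> borel_measurable (Tasks E \<Otimes>\<^sub>M Outputs E)"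
  shows "(\<lambda>(A, t). \<integral>u. f t u \<partial>kern E A t) \<in> borel_measurable (Agents E \<Otimes>\<^sub>M Tasks E)"
proof -
  have "(\<lambda>x. \<integral>u. f (snd x) u \<partial>(\<lambda>(A, t). kern E A t) x) \<in> borel_measurable (Agents E \<Otimes>\<^sub>M Tasks E)"
    by (rule integral_measurable_kernel[OF _ measurable_prob_algebraD[OF kern_measurable]]) measurable
  then show ?thesis by (simp add: case_prod_beta')
qed

lemma kern_integral_bounds:
  fixes f :: "'t \<Rightarrow> 'o \<Rightarrow> real"
  assumes [measurable]: "(\<lambda>(t, u). f t u) \<in> borel_measurable (Tasks E \<Otimes>\<^sub>M Outputs E)"
    and b: "\<And>u. u \<in> space (Outputs E) \<Longrightarrow> f t u \<in> {0..1}"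
    and A: "A \<in> space (Agents E)" and t [measurable]: "t \<in> space (Tasks E)"
  shows "(\<integral>u. f t u \<partial>kern E A t) \<in> {0..1}"
proof -
  interpret prob_space "kern E A t" by (rule prob_kern) fact+
  note sets_kern[OF A t, measurable_cong]
  have sp: "space (kern E A t) = space (Outputs E)"
    by (rule sets_eq_imp_space_eq) (rule sets_kern[OF A t])
  have "f t \<in> borel_measurable (kern E A t)" by measurable
  then have int: "integrable (kern E A t) (f t)"
    by (rule integrable_const_bound[where B=1, rotated]) (use b in \<open>auto intro!: AE_I2 simp: sp\<close>)
  have "(\<integral>u. f t u \<partial>kern E A t) \<le> 1"
    by (rule integral_le_const[OF int]) (use b in \<open>auto intro!: AE_I2 simp: sp\<close>)
  moreover have "0 \<le> (\<integral>u. f t u \<partial>kern E A t)"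
    by (rule integral_nonneg_AE) (use b in \<open>auto intro!: AE_I2 simp: sp\<close>)
  ultimately show ?thesis by simp
qed

lemma V_measurable [measurable (raw)]:
  assumes [measurable]: "f \<in> M \<rightarrow>\<^sub>M Agents E" "g \<in> M \<rightarrow>\<^sub>M Tasks E"
  shows "(\<lambda>x. V E (f x) (g x)) \<in> borel_measurable M"
  using measurable_compose[OF measurable_Pair[OF assms] kern_integral_measurable[OF reward_measurable]]
  by (simp add: V_def)

lemma V_bounds: "A \<in> space (Agents E) \<Longrightarrow> t \<in> space (Tasks E) \<Longrightarrow> V E A t \<in> {0..1}"
  unfolding V_def by (rule kern_integral_bounds[OF reward_measurable]) (use reward_bounds in auto)

lemma of_bool_failure_measurable:
  "(\<lambda>(t, u). of_bool (failure E t u) :: real) \<in> borel_measurable (Tasks E \<Otimes>\<^sub>M Outputs E)"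
  using measurable_compose[OF failure_measurable, of "of_bool :: bool \<Rightarrow> real" borel]
  by (simp add: case_prod_beta')

lemma psi_measurable [measurable (raw)]:
  assumes [measurable]: "f \<in> M \<rightarrow>\<^sub>M Agents E" "g \<in> M \<rightarrow>\<^sub>M Tasks E"
  shows "(\<lambda>x. psi E (f x) (g x)) \<in> borel_measurable M"
  using measurable_compose[OF measurable_Pair[OF assms] kern_integral_measurable[OF of_bool_failure_measurable]]
  by (simp add: psi_def)

lemma psi_bounds: "A \<in> space (Agents E) \<Longrightarrow> t \<in> space (Tasks E) \<Longrightarrow> psi E A t \<in> {0..1}"
  unfolding psi_def by (rule kern_integral_bounds[OF of_bool_failure_measurable]) auto

lemma J_user_measurable [measurable]: "J_user E \<in> borel_measurable (Agents E)"
  unfolding J_user_def by (rule D.borel_measurable_lebesgue_integral) measurable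

lemma Z_measurable [measurable]: "Z E \<in> borel_measurable (Agents E)"
  unfolding Z_def by (rule D.borel_measurable_lebesgue_integral) measurable

lemma Adv_measurable [measurable (raw)]:
  assumes [measurable]: "f \<in> M \<rightarrow>\<^sub>M Agents E" "f' \<in> M \<rightarrow>\<^sub>M Agents E" "g \<in> M \<rightarrow>\<^sub>M Tasks E"
  shows "(\<lambda>x. Adv E (f x) (f' x) (g x)) \<in> borel_measurable M"
  unfolding Adv_def by measurable

lemma
  assumes [measurable]: "A \<in> space (Agents E)" "A' \<in> space (Agents E)"
  shows psi_measurable_task [measurable]: "psi E A \<in> borel_measurable (Tasks E)"
    and Adv_measurable_task [measurable]: "Adv E A A' \<in> borel_measurable (Tasks E)"
  by (measurable, measurable)

lemma Adv_bound:
  assumes "A \<in> space (Agents E)" "A' \<in> space (Agents E)" "t \<in> space (Tasks E)"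
  shows "\<bar>Adv E A A' t\<bar> \<le> 1"
  using V_bounds[OF assms(1,3)] V_bounds[OF assms(2,3)] by (auto simp: Adv_def)

lemma
  assumes A [measurable]: "A \<in> space (Agents E)"
  shows integrable_V: "integrable (D_user E) (V E A)"
    and integrable_psi: "integrable (D_user E) (psi E A)"
proof -
  show "integrable (D_user E) (V E A)"
    by (rule D.integrable_const_bound[where B=1]) (use V_bounds[OF A] in \<open>auto simp: space_D_user\<close>)
  show "integrable (D_user E) (psi E A)"
    by (rule D.integrable_const_bound[where B=1]) (use psi_bounds[OF A] in \<open>auto simp: space_D_user\<close>)
qed

lemma
  assumes A [measurable]: "A \<in> space (Agents E)" and A' [measurable]: "A' \<in> space (Agents E)"
  shows integrable_psi_Adv: "integrable (D_user E) (\<lambda>t. psi E A t * Adv E A A' t)"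
    and integrable_Adv: "integrable (D_user E) (\<lambda>t. Adv E A A' t)"
    and integrable_psi_abs_Adv: "integrable (D_user E) (\<lambda>t. (1 - psi E A t) * \<bar>Adv E A A' t\<bar>)"
proof -
  have b: "\<bar>x * y\<bar> \<le> 1" if "x \<in> {0..1}" "\<bar>y\<bar> \<le> 1" for x y :: real
    using mult_mono[of "\<bar>x\<bar>" 1 "\<bar>y\<bar>" 1] that by (auto simp: abs_mult)
  show "integrable (D_user E) (\<lambda>t. psi E A t * Adv E A A' t)"
    by (rule D.integrable_const_bound[where B=1])
       (use b[OF psi_bounds[OF A] Adv_bound[OF A A']] in \<open>auto simp: space_D_user\<close>)
  show "integrable (D_user E) (\<lambda>t. Adv E A A' t)"
    by (rule D.integrable_const_bound[where B=1]) (use Adv_bound[OF A A'] in \<open>auto simp: space_D_user\<close>)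
  have "\<bar>(1 - psi E A t) * \<bar>Adv E A A' t\<bar>\<bar> \<le> 1" if "t \<in> space (Tasks E)" for t
    using psi_bounds[OF A that] Adv_bound[OF A A' that] by (intro b) auto
  then show "integrable (D_user E) (\<lambda>t. (1 - psi E A t) * \<bar>Adv E A A' t\<bar>)"
    by (intro D.integrable_const_bound[where B=1]) (auto simp: space_D_user)
qed

lemma integral_D_F:
  fixes g :: "'t \<Rightarrow> real"
  assumes A [measurable]: "A \<in> space (Agents E)" and Z: "0 < Z E A"
    and g [measurable]: "g \<in> borel_measurable (Tasks E)"
  shows "(\<integral>t. g t \<partial>D_F E A) = (\<integral>t. psi E A t * g t \<partial>D_user E) / Z E A"
proof -
  have "(\<integral>t. g t \<partial>D_F E A) = (\<integral>t. (psi E A t / Z E A) *\<^sub>R g t \<partial>D_user E)"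
    unfolding D_F_def
    by (rule integral_density)
       (use Z psi_bounds[OF A] in \<open>auto simp: space_D_user intro!: AE_I2 divide_nonneg_pos\<close>)
  then show ?thesis by simp
qed

text \<open>Since \<open>\<bar>Adv\<bar> \<le> 1\<close>, the integral of \<open>psi * Adv\<close>
  is at most that of \<open>psi\<close> in absolute value, and the latter is the normalising
  constant \<open>Z\<close>. The bound 1 limits the cost of replacing \<open>Z\<close> by its
  estimate to \<open>eps_Z\<close>.\<close>

lemma D_F_Adv_bound:
  assumes A: "A \<in> space (Agents E)" and A': "A' \<in> space (Agents E)" and Z: "0 < Z E A"
  shows "\<bar>\<integral>t. Adv E A A' t \<partial>D_F E A\<bar> \<le> 1"
proof -
  note [measurable] = A A'
  have "\<bar>\<integral>t. psi E A t * Adv E A A' t \<partial>D_user E\<bar> \<le> (\<integral>t. \<bar>psi E A t * Adv E A A' t\<bar> \<partial>D_user E)"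
    by (rule integral_abs_bound)
  also have "\<dots> \<le> (\<integral>t. psi E A t \<partial>D_user E)"
  proof (rule integral_mono)
    fix t assume "t \<in> space (D_user E)"
    then have t: "t \<in> space (Tasks E)" by (simp add: space_D_user)
    show "\<bar>psi E A t * Adv E A A' t\<bar> \<le> psi E A t"
      using mult_left_mono[OF Adv_bound[OF A A' t], of "psi E A t"] psi_bounds[OF A t]
      by (simp add: abs_mult)
  qed (intro integrable_abs integrable_psi_Adv integrable_psi A A')+
  finally have "\<bar>\<integral>t. psi E A t * Adv E A A' t \<partial>D_user E\<bar> \<le> Z E A"
    by (simp add: Z_def)
  then show ?thesis
    using Z by (simp add: integral_D_F[OF A Z Adv_measurable_task[OF A A']])
qed

text \<open>Pointwise, \<open>f - psi * f = (1 - psi) * f\<close>, which is at least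
  \<open>- (1 - psi) * \<bar>f\<bar>\<close> because \<open>1 - psi\<close> is nonnegative. The
  success part stays unnormalised, so no division by \<open>1 - Z\<close> arises.\<close>

lemma J_user_diff_lower:
  assumes A: "A \<in> space (Agents E)" and A': "A' \<in> space (Agents E)" and Z: "0 < Z E A"
  shows "Z E A * (\<integral>t. Adv E A A' t \<partial>D_F E A) - (\<integral>t. (1 - psi E A t) * \<bar>Adv E A A' t\<bar> \<partial>D_user E)
    \<le> J_user E A' - J_user E A"
proof -
  note [measurable] = A A'
  have "Z E A * (\<integral>t. Adv E A A' t \<partial>D_F E A) - (\<integral>t. (1 - psi E A t) * \<bar>Adv E A A' t\<bar> \<partial>D_user E)
      = (\<integral>t. psi E A t * Adv E A A' t - (1 - psi E A t) * \<bar>Adv E A A' t\<bar> \<partial>D_user E)"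
    using Z A A'
    by (simp add: integral_D_F[OF A Z Adv_measurable_task] integrable_psi_Adv integrable_psi_abs_Adv)
  also have "\<dots> \<le> (\<integral>t. Adv E A A' t \<partial>D_user E)"
  proof (rule integral_mono)
    fix t assume "t \<in> space (D_user E)"
    then have "0 \<le> 1 - psi E A t" using psi_bounds[OF A] by (auto simp: space_D_user)
    from mult_left_mono[OF abs_ge_minus_self this, of "Adv E A A' t"]
    show "psi E A t * Adv E A A' t - (1 - psi E A t) * \<bar>Adv E A A' t\<bar> \<le> Adv E A A' t"
      by (simp add: algebra_simps)
  qed (intro Bochner_Integration.integrable_diff integrable_psi_Adv integrable_psi_abs_Adv integrable_Adv A A')+
  also have "\<dots> = J_user E A' - J_user E A"
    unfolding Adv_def J_user_def
    by (rule Bochner_Integration.integral_diff) (rule integrable_V[OF A'] integrable_V[OF A])+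
  finally show ?thesis .
qed

text \<open>Joint law of one stored record under the reference law, given the agent: a task from
  \<open>D_user\<close> and then a Bernoulli label. As a density against counting measure on the
  labels, it turns integrals into two-term sums.\<close>

definition record_law :: "'a \<Rightarrow> ('t \<times> bool) measure" where
  "record_law A = density (D_user E \<Otimes>\<^sub>M count_space UNIV)
     (\<lambda>(t, b). ennreal (pmf (bernoulli_pmf (psi E A t)) b))"

text \<open>\<open>bernoulli_pmf\<close> clamps its parameter to the unit interval, so the plain
  formula relies on \<open>psi_bounds\<close>.\<close>

lemma pmf_bernoulli_psi:
  assumes "A \<in> space (Agents E)" "t \<in> space (Tasks E)"
  shows "pmf (bernoulli_pmf (psi E A t)) b = (if b then psi E A t else 1 - psi E A t)"
  using psi_bounds[OF assms] by (cases b) auto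

lemma pmf_bernoulli_psi_measurable [measurable (raw)]:
  assumes [measurable]: "f \<in> M \<rightarrow>\<^sub>M Agents E" "g \<in> M \<rightarrow>\<^sub>M Tasks E" "Measurable.pred M h"
  shows "(\<lambda>x. pmf (bernoulli_pmf (psi E (f x) (g x))) (h x)) \<in> borel_measurable M"
proof -
  have "(\<lambda>x. if h x then psi E (f x) (g x) else 1 - psi E (f x) (g x)) \<in> borel_measurable M"
    by measurable
  also have "?this \<longleftrightarrow> ?thesis"
    by (intro measurable_cong) (auto simp: pmf_bernoulli_psi[OF measurable_space[OF assms(1)] measurable_space[OF assms(2)]])
  finally show ?thesis .
qed

lemma sets_record_law [measurable_cong]:
  "sets (record_law A) = sets (Tasks E \<Otimes>\<^sub>M count_space UNIV)"
  unfolding record_law_def sets_density by (rule sets_pair_measure_cong) (rule sets_D_user refl)+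

lemma nn_integral_record_law:
  assumes A [measurable]: "A \<in> space (Agents E)"
    and f [measurable]: "f \<in> borel_measurable (Tasks E \<Otimes>\<^sub>M count_space UNIV)"
  shows "(\<integral>\<^sup>+z. f z \<partial>record_law A)
    = (\<integral>\<^sup>+t. (\<Sum>b\<in>UNIV. ennreal (pmf (bernoulli_pmf (psi E A t)) b) * f (t, b)) \<partial>D_user E)"
proof -
  interpret B: sigma_finite_measure "count_space (UNIV :: bool set)"
    by (rule sigma_finite_measure_count_space)
  have "(\<integral>\<^sup>+z. f z \<partial>record_law A) = (\<integral>\<^sup>+z. (\<lambda>(t, b). ennreal (pmf (bernoulli_pmf (psi E A t)) b)) z * f z
      \<partial>(D_user E \<Otimes>\<^sub>M count_space UNIV))"
    unfolding record_law_def by (rule nn_integral_density) measurable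
  also have "\<dots> = (\<integral>\<^sup>+t. \<integral>\<^sup>+b. ennreal (pmf (bernoulli_pmf (psi E A t)) b) * f (t, b) \<partial>count_space UNIV \<partial>D_user E)"
  proof -
    have "(\<lambda>z. (\<lambda>(t, b). ennreal (pmf (bernoulli_pmf (psi E A t)) b)) z * f z)
        \<in> borel_measurable (D_user E \<Otimes>\<^sub>M count_space UNIV)"
      by measurable
    from B.nn_integral_fst[OF this] show ?thesis by simp
  qed
  finally show ?thesis
    by (simp add: nn_integral_count_space_finite)
qed

lemma prob_record_law:
  assumes A: "A \<in> space (Agents E)"
  shows "prob_space (record_law A)"
proof
  have "emeasure (record_law A) (space (record_law A)) = (\<integral>\<^sup>+z. 1 \<partial>record_law A)"
    by simp
  also have "\<dots> = (\<integral>\<^sup>+t. 1 \<partial>D_user E)"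
    by (subst nn_integral_record_law[OF A])
       (simp_all add: sum_pmf_eq_1)
  finally show "emeasure (record_law A) (space (record_law A)) = 1"
    by (simp add: D.emeasure_space_1)
qed

text \<open>The current agent is random, so the record law must be a kernel in the agent before it
  can enter the disintegration. The integral formula covers every measurable set, hence the whole
  sigma-algebra serves as its own generator.\<close>

lemma record_law_measurable:
  "record_law \<in> Agents E \<rightarrow>\<^sub>M prob_algebra (Tasks E \<Otimes>\<^sub>M count_space UNIV)"
proof (rule measurable_prob_algebra_generated[where \<Omega>="space (Tasks E \<Otimes>\<^sub>M count_space UNIV)"])
  let ?R = "Tasks E \<Otimes>\<^sub>M count_space (UNIV :: bool set)"
  show "sets ?R = sigma_sets (space ?R) (sets ?R)" by (rule sets.sigma_sets_eq[symmetric])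
  show "Int_stable (sets ?R)" by (auto intro: Int_stableI)
  show "sets ?R \<subseteq> Pow (space ?R)" by (rule sets.space_closed)
  fix B assume [measurable]: "B \<in> sets ?R"
  have "(\<lambda>A. \<integral>\<^sup>+t. (\<Sum>b\<in>UNIV. ennreal (pmf (bernoulli_pmf (psi E A t)) b) * indicator B (t, b)) \<partial>D_user E)
     \<in> borel_measurable (Agents E)"
    by measurable
  also have "?this \<longleftrightarrow> (\<lambda>A. emeasure (record_law A) B) \<in> borel_measurable (Agents E)"
  proof (rule measurable_cong)
    fix A assume A: "A \<in> space (Agents E)"
    have "emeasure (record_law A) B = (\<integral>\<^sup>+z. indicator B z \<partial>record_law A)"
      by (simp add: sets_record_law)
    then show "(\<integral>\<^sup>+t. (\<Sum>b\<in>UNIV. ennreal (pmf (bernoulli_pmf (psi E A t)) b) * indicator B (t, b)) \<partial>D_user E)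
        = emeasure (record_law A) B"
      using nn_integral_record_law[OF A, of "indicator B"] by simp
  qed
  finally show "(\<lambda>A. emeasure (record_law A) B) \<in> borel_measurable (Agents E)" .
qed (use prob_record_law sets_record_law in auto)

text \<open>Nonnegativity lets both Bochner integrals be read off from \<open>nn_integral\<close>,
  where the two-label formula is already available.\<close>

lemma integral_record_law:
  fixes f :: "'t \<times> bool \<Rightarrow> real"
  assumes A: "A \<in> space (Agents E)"
    and f [measurable]: "f \<in> borel_measurable (Tasks E \<Otimes>\<^sub>M count_space UNIV)"
    and nn: "\<And>t b. t \<in> space (Tasks E) \<Longrightarrow> 0 \<le> f (t, b)"
  shows "(\<integral>z. f z \<partial>record_law A) = (\<integral>t. psi E A t * f (t, True) + (1 - psi E A t) * f (t, False) \<partial>D_user E)"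
proof -
  note [measurable] = A
  have sp: "space (record_law A) = space (Tasks E \<Otimes>\<^sub>M count_space UNIV)"
    by (rule sets_eq_imp_space_eq) (rule sets_record_law)
  have m: "(\<lambda>z. ennreal (f z)) \<in> borel_measurable (Tasks E \<Otimes>\<^sub>M count_space UNIV)"
    by measurable
  have "(\<integral>z. f z \<partial>record_law A) = enn2real (\<integral>\<^sup>+z. ennreal (f z) \<partial>record_law A)"
    by (rule integral_eq_nn_integral) (use nn in \<open>auto simp: sp space_pair_measure intro!: AE_I2\<close>)
  also have "(\<integral>\<^sup>+z. ennreal (f z) \<partial>record_law A)
      = (\<integral>\<^sup>+t. ennreal (psi E A t * f (t, True) + (1 - psi E A t) * f (t, False)) \<partial>D_user E)"
    using nn psi_bounds[OF A]
    by (subst nn_integral_record_law[OF A m])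
       (auto intro!: nn_integral_cong simp: space_D_user pmf_bernoulli_psi[OF A] UNIV_bool
          ennreal_mult'[symmetric] add.commute simp flip: ennreal_plus)
  also have "enn2real \<dots> = (\<integral>t. psi E A t * f (t, True) + (1 - psi E A t) * f (t, False) \<partial>D_user E)"
    by (rule integral_eq_nn_integral[symmetric])
       (use nn psi_bounds[OF A] in \<open>auto simp: space_D_user intro!: AE_I2\<close>)
  finally show ?thesis .
qed

end

section \<open>Measurability of the protocol\<close>

locale step_protocol =
  fixes S :: "('t, 'o, 'a, 'c, 'x, 'w) step"
  assumes protocol: "one_candidate_protocol S"
begin

lemma prob_Omega: "prob_space (\<Omega> S)"
  and n_F_pos: "0 < n_F S" and n_R_pos: "0 < n_R S" and n_roll_pos: "0 < n_roll S"
  and risk_V_pos: "0 < risk_V S"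
  and current_Omega: "current S \<in> \<Omega> S \<rightarrow>\<^sub>M Agents S"
  and seed_Omega: "seed S \<in> \<Omega> S \<rightarrow>\<^sub>M Seeds S"
  and task_Omega: "\<And>n. task S n \<in> \<Omega> S \<rightarrow>\<^sub>M Tasks S"
  and outp_Omega: "\<And>n. outp S n \<in> \<Omega> S \<rightarrow>\<^sub>M Outputs S"
  and rollout_measurable [measurable]: "\<And>b e l. rollout S b e l \<in> \<Omega> S \<rightarrow>\<^sub>M Outputs S"
  and Z_current: "\<And>\<omega>. \<omega> \<in> space (\<Omega> S) \<Longrightarrow> Z S (current S \<omega>) \<in> {0<..<1}"
  and apply_mod_measurable: "(\<lambda>(A, c). apply_mod S A c) \<in> Agents S \<Otimes>\<^sub>M Mods S \<rightarrow>\<^sub>M Agents S"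
  and gen_start_stopping: "stopping_time (history S) (gen_start S)"
  and win_start_stopping: "stopping_time (history S) (win_start S)"
  and delta_C_frozen: "delta_C S \<in> frozen_info S \<rightarrow>\<^sub>M option_space (Mods S)"
  and offset_frozen: "offset S \<in> frozen_info S \<rightarrow>\<^sub>M count_space UNIV"
  and avail_frozen: "avail S \<in> sets (frozen_info S)"
  and horizon_frozen: "horizon S \<in> frozen_info S \<rightarrow>\<^sub>M count_space UNIV"
  and eps_F_frozen: "eps_F S \<in> borel_measurable (frozen_info S)"
  using protocol unfolding one_candidate_protocol_def by simp_all

lemma rollout_law:
  assumes "finite K" "\<And>k. k \<in> K \<Longrightarrow> B k \<in> sets (Outputs S)"
  shows "AE \<omega> in \<Omega> S. \<omega> \<in> Cand S \<inter> Ready S \<and> K \<subseteq> UNIV \<times> eval_slots S \<omega> \<times> {..<n_roll S} \<longrightarrow>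
    cprob (\<Omega> S) (pre_rollout S)
      {\<omega>'\<in>space (\<Omega> S). \<forall>(b, e, l)\<in>K. rollout S b e l \<omega>' \<in> B (b, e, l)} \<omega>
    = (\<Prod>(b, e, l)\<in>K. measure (kern S (agent_of S b \<omega>) (task_of S e \<omega>)) (B (b, e, l)))"
proof -
  have "\<forall>K. finite K \<longrightarrow> (\<forall>B. (\<forall>k\<in>K. B k \<in> sets (Outputs S)) \<longrightarrow>
        (AE \<omega> in \<Omega> S. \<omega> \<in> Cand S \<inter> Ready S \<and> K \<subseteq> UNIV \<times> eval_slots S \<omega> \<times> {..<n_roll S} \<longrightarrow>
           cprob (\<Omega> S) (pre_rollout S)
             {\<omega>'\<in>space (\<Omega> S). \<forall>(b, e, l)\<in>K. rollout S b e l \<omega>' \<in> B (b, e, l)} \<omega>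
           = (\<Prod>(b, e, l)\<in>K. measure (kern S (agent_of S b \<omega>) (task_of S e \<omega>)) (B (b, e, l)))))"
    using protocol unfolding one_candidate_protocol_def by (elim conjE)
  with assms show ?thesis by blast
qed

sublocale valid_env S
  using protocol by unfold_locales (simp add: one_candidate_protocol_def)

sublocale prob_space "\<Omega> S"
  by (rule prob_Omega)

abbreviation \<F> where "\<F> \<equiv> pre_rollout S"

lemma space_pre_rollout [simp]: "space \<F> = space (\<Omega> S)"
  by (simp add: pre_rollout_def)

lemma pre_rollout_generators:
  "(\<lambda>\<omega>. (current S \<omega>, seed S \<omega>, \<lambda>i. task S i \<omega>, \<lambda>i. outp S i \<omega>)) \<in> \<Omega> S \<rightarrow>\<^sub>M
     Agents S \<Otimes>\<^sub>M Seeds S \<Otimes>\<^sub>M PiM UNIV (\<lambda>_. Tasks S) \<Otimes>\<^sub>M PiM UNIV (\<lambda>_. Outputs S)"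
  by (intro measurable_Pair current_Omega seed_Omega measurable_PiM_single')
     (use task_Omega outp_Omega in \<open>auto dest: measurable_space\<close>)

lemma subalgebra_pre_rollout: "subalgebra (\<Omega> S) \<F>"
  unfolding pre_rollout_def by (rule subalgebra_sigma_gen[OF pre_rollout_generators])

lemma measurable_pre_rollout_Omega: "f \<in> \<F> \<rightarrow>\<^sub>M N \<Longrightarrow> f \<in> \<Omega> S \<rightarrow>\<^sub>M N"
  by (rule measurable_from_subalg[OF subalgebra_pre_rollout])

lemma sets_pre_rollout_Omega: "A \<in> sets \<F> \<Longrightarrow> A \<in> sets (\<Omega> S)"
  using subalgebra_pre_rollout by (auto simp: subalgebra_def)

lemma current_measurable [measurable]: "current S \<in> \<F> \<rightarrow>\<^sub>M Agents S"
  and seed_measurable [measurable]: "seed S \<in> \<F> \<rightarrow>\<^sub>M Seeds S"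
  and task_measurable [measurable]: "task S n \<in> \<F> \<rightarrow>\<^sub>M Tasks S"
  and outp_measurable [measurable]: "outp S n \<in> \<F> \<rightarrow>\<^sub>M Outputs S"
proof -
  note X = measurable_sigma_gen[OF pre_rollout_generators, folded pre_rollout_def]
  show "current S \<in> \<F> \<rightarrow>\<^sub>M Agents S"
    using measurable_compose[OF X measurable_fst] by simp
  show "seed S \<in> \<F> \<rightarrow>\<^sub>M Seeds S"
    using measurable_compose[OF X measurable_compose[OF measurable_snd measurable_fst]] by simp
  show "task S n \<in> \<F> \<rightarrow>\<^sub>M Tasks S"
    using measurable_compose[OF measurable_compose[OF X measurable_compose[OF measurable_snd
      measurable_compose[OF measurable_snd measurable_fst]]] measurable_component_singleton[of n UNIV]] by simp
  show "outp S n \<in> \<F> \<rightarrow>\<^sub>M Outputs S"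
    using measurable_compose[OF measurable_compose[OF X measurable_compose[OF measurable_snd
      measurable_compose[OF measurable_snd measurable_snd]]] measurable_component_singleton[of n UNIV]] by simp
qed

lemma space_history [simp]: "space (history S n) = space (\<Omega> S)"
  by (simp add: history_def)

text \<open>\<open>G\<close> is kept general: a later history gives monotonicity of the filtration,
  and \<open>pre_rollout\<close> gives the inclusion used for stopping times.\<close>

lemma sets_history_subset:
  assumes sp: "space G = space (\<Omega> S)"
    and [measurable]: "current S \<in> G \<rightarrow>\<^sub>M Agents S" "seed S \<in> G \<rightarrow>\<^sub>M Seeds S"
    "\<And>i. i \<in> {..<n} \<Longrightarrow> task S i \<in> G \<rightarrow>\<^sub>M Tasks S" "\<And>i. i \<in> {..<n} \<Longrightarrow> outp S i \<in> G \<rightarrow>\<^sub>M Outputs S"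
  shows "sets (history S n) \<subseteq> sets G"
  unfolding history_def
  by (rule sets_sigma_gen_subset[OF sp]) (intro measurable_Pair measurable_restrict; fact)

lemma history_generators:
  "(\<lambda>\<omega>. (current S \<omega>, seed S \<omega>, \<lambda>i\<in>{..<n}. task S i \<omega>, \<lambda>i\<in>{..<n}. outp S i \<omega>)) \<in> history S n \<rightarrow>\<^sub>M
     Agents S \<Otimes>\<^sub>M Seeds S \<Otimes>\<^sub>M PiM {..<n} (\<lambda>_. Tasks S) \<Otimes>\<^sub>M PiM {..<n} (\<lambda>_. Outputs S)"
  unfolding history_def
  by (rule measurable_sigma_gen)
     (intro measurable_Pair measurable_restrict current_Omega seed_Omega task_Omega outp_Omega)

lemma filtration_history: "filtration (space (\<Omega> S)) (history S)"
proof
  fix m n :: nat assume "m \<le> n"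
  note X = history_generators[of n]
  show "sets (history S m) \<subseteq> sets (history S n)"
  proof (rule sets_history_subset)
    show "current S \<in> history S n \<rightarrow>\<^sub>M Agents S"
      using measurable_compose[OF X measurable_fst] by simp
    show "seed S \<in> history S n \<rightarrow>\<^sub>M Seeds S"
      using measurable_compose[OF X measurable_compose[OF measurable_snd measurable_fst]] by simp
    fix i assume "i \<in> {..<m}"
    then have i: "i \<in> {..<n}" using \<open>m \<le> n\<close> by auto
    show "task S i \<in> history S n \<rightarrow>\<^sub>M Tasks S"
      using measurable_compose[OF measurable_compose[OF X measurable_compose[OF measurable_snd
        measurable_compose[OF measurable_snd measurable_fst]]] measurable_component_singleton[OF i]] i by simp
    show "outp S i \<in> history S n \<rightarrow>\<^sub>M Outputs S"
      using measurable_compose[OF measurable_compose[OF X measurable_compose[OF measurable_snd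
        measurable_compose[OF measurable_snd measurable_snd]]] measurable_component_singleton[OF i]] i by simp
  qed simp
qed simp

lemma sets_history_pre_rollout: "sets (history S n) \<subseteq> sets \<F>"
  by (rule sets_history_subset) auto

lemma stopping_time_measurable:
  fixes T :: "'w \<Rightarrow> nat"
  assumes "stopping_time (history S) T"
  shows "T \<in> \<F> \<rightarrow>\<^sub>M count_space UNIV"
  using measurable_stopping_time[OF assms, of \<F>] sets_history_pre_rollout
  by (simp add: measurable_cong_sets[OF refl sets_borel_eq_count_space])

lemma gen_start_measurable [measurable]: "gen_start S \<in> \<F> \<rightarrow>\<^sub>M count_space UNIV"
  by (rule stopping_time_measurable[OF gen_start_stopping])

lemma win_start_measurable [measurable]: "win_start S \<in> \<F> \<rightarrow>\<^sub>M count_space UNIV"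
  by (rule stopping_time_measurable[OF win_start_stopping])

lemma space_frozen_info [simp]: "space (frozen_info S) = space (\<Omega> S)"
  unfolding frozen_info_def by (rule filtration.space_pre_sigma[OF filtration_history])

text \<open>\<open>win_start\<close> is a natural number at every point, so an event known at that
  time is the countable union of its parts on \<open>win_start \<le> n\<close>, each of which lies
  in \<open>history S n\<close>. Frozen quantities may therefore be conditioned on in the rollout
  law.\<close>

lemma sets_frozen_info_subset: "sets (frozen_info S) \<subseteq> sets \<F>"
proof
  fix A assume A: "A \<in> sets (frozen_info S)"
  have "{\<omega> \<in> A. win_start S \<omega> \<le> n} \<in> sets \<F>" for n
    using filtration.sets_pre_sigmaD[OF filtration_history win_start_stopping, of A n] A
      sets_history_pre_rollout[of n] by (auto simp: frozen_info_def)
  then have "(\<Union>n. {\<omega> \<in> A. win_start S \<omega> \<le> n}) \<in> sets \<F>" by blast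
  also have "(\<Union>n. {\<omega> \<in> A. win_start S \<omega> \<le> n}) = A" by auto
  finally show "A \<in> sets \<F>" .
qed

lemma measurable_frozen_info: "f \<in> frozen_info S \<rightarrow>\<^sub>M N \<Longrightarrow> f \<in> \<F> \<rightarrow>\<^sub>M N"
  using sets_frozen_info_subset by (auto simp: measurable_def)

lemmas frozen_measurable [measurable] =
  delta_C_frozen[THEN measurable_frozen_info] offset_frozen[THEN measurable_frozen_info]
  horizon_frozen[THEN measurable_frozen_info] eps_F_frozen[THEN measurable_frozen_info]

lemma avail_measurable [measurable]: "avail S \<in> sets \<F>"
  using avail_frozen sets_frozen_info_subset by blast

section \<open>Measurability of batches, records and events that are settled before the
  rollouts\<close>

lemma mark_measurable [measurable]: "Measurable.pred \<F> (mark S n)"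
  unfolding mark_def by measurable

lemma task_at_measurable:
  "p \<in> \<F> \<rightarrow>\<^sub>M count_space UNIV \<Longrightarrow> (\<lambda>\<omega>. task S (p \<omega>) \<omega>) \<in> \<F> \<rightarrow>\<^sub>M Tasks S"
  by (rule measurable_compose_countable[OF task_measurable])

lemma first_failures_measurable:
  assumes s: "s \<in> \<F> \<rightarrow>\<^sub>M count_space UNIV" and h: "h \<in> \<F> \<rightarrow>\<^sub>M count_space UNIV"
  shows "(\<lambda>\<omega>. first_failures S (s \<omega>) (h \<omega>) \<omega>) \<in> \<F> \<rightarrow>\<^sub>M count_space UNIV"
\<comment> \<open>Start and length are random but countably valued, so each can be fixed in
  turn.\<close>
proof (rule measurable_compose_countable[OF _ s])
  fix s show "(\<lambda>\<omega>. first_failures S s (h \<omega>) \<omega>) \<in> \<F> \<rightarrow>\<^sub>M count_space UNIV"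
  proof (rule measurable_compose_countable[OF _ h])
    fix h show "(\<lambda>\<omega>. first_failures S s h \<omega>) \<in> \<F> \<rightarrow>\<^sub>M count_space UNIV"
      unfolding first_failures_def
      by (rule measurable_compose[OF measurable_filter_list]) auto
  qed
qed

lemma gen_pos_measurable [measurable]: "gen_pos S \<in> \<F> \<rightarrow>\<^sub>M count_space UNIV"
  unfolding gen_pos_def by (rule first_failures_measurable) auto

lemma batch_pos_measurable [measurable]: "batch_pos S \<in> \<F> \<rightarrow>\<^sub>M count_space UNIV"
  unfolding batch_pos_def by (rule first_failures_measurable) auto

lemma t_F_measurable [measurable]: "t_F S i \<in> \<F> \<rightarrow>\<^sub>M Tasks S"
  unfolding t_F_def by (rule task_at_measurable) (rule measurable_compose[OF batch_pos_measurable], simp)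

lemma t_R_measurable [measurable]: "t_R S j \<in> \<F> \<rightarrow>\<^sub>M Tasks S"
  unfolding t_R_def by (rule task_at_measurable) measurable

lemma phi_R_measurable [measurable]: "Measurable.pred \<F> (phi_R S j)"
  unfolding phi_R_def
  by (rule measurable_compose_countable[OF mark_measurable]) measurable

lemma task_of_measurable [measurable]: "task_of S e \<in> \<F> \<rightarrow>\<^sub>M Tasks S"
  by (cases e) (simp_all add: t_F_measurable t_R_measurable)

lemma material_measurable [measurable]: "material S \<in> \<F> \<rightarrow>\<^sub>M option_space (material_space S)"
  unfolding material_def
proof (rule measurable_If)
  show "(\<lambda>\<omega>. Some (\<lambda>i\<in>{..<n_F S}. task S (gen_pos S \<omega> ! i) \<omega>)) \<in> \<F> \<rightarrow>\<^sub>M option_space (material_space S)"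
    by (intro measurable_compose[OF _ measurable_Some_option_space] measurable_restrict task_at_measurable
        measurable_compose[OF gen_pos_measurable]) simp
  show "(\<lambda>\<omega>. None) \<in> \<F> \<rightarrow>\<^sub>M option_space (material_space S)"
    by (rule measurable_const) (simp add: space_option_space)
  show "{x \<in> space \<F>. length (gen_pos S x) = n_F S} \<in> sets \<F>"
    by measurable
qed

text \<open>The reference law lives on frozen information and records, where no
  \<open>\<omega>\<close> is at hand. The candidate is therefore written as a function of values
  that are components of \<open>G_info\<close>.\<close>

definition cand_agent :: "'a \<times> 'c option \<Rightarrow> 'a" where
  "cand_agent = (\<lambda>(A, z). case z of None \<Rightarrow> A | Some c \<Rightarrow> apply_mod S A c)"

lemma cand_agent_measurable [measurable]: "cand_agent \<in> Agents S \<Otimes>\<^sub>M option_space (Mods S) \<rightarrow>\<^sub>M Agents S"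
  unfolding cand_agent_def by (rule measurable_case_option_pair) (auto intro: apply_mod_measurable)

lemma candidate_eq: "candidate S \<omega> = cand_agent (current S \<omega>, delta_C S \<omega>)"
  by (simp add: candidate_def cand_agent_def)

lemma candidate_measurable [measurable]: "candidate S \<in> \<F> \<rightarrow>\<^sub>M Agents S"
  unfolding candidate_eq[abs_def] by measurable

lemma agent_of_measurable [measurable]: "agent_of S b \<in> \<F> \<rightarrow>\<^sub>M Agents S"
  by (cases b) (simp_all add: current_measurable candidate_measurable)

lemma Cand_measurable [measurable]: "Cand S \<in> sets \<F>"
proof -
  have "delta_C S -` {None} \<inter> space \<F> \<in> sets \<F>"
    by (rule measurable_sets[OF _ None_in_option_space]) measurable
  then have "space \<F> - (delta_C S -` {None} \<inter> space \<F>) \<in> sets \<F>" by (rule sets.compl_sets)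
  also have "space \<F> - (delta_C S -` {None} \<inter> space \<F>) = Cand S" by (auto simp: Cand_def)
  finally show ?thesis .
qed

lemma Ret_F_measurable [measurable]: "Ret_F S \<in> sets \<F>"
proof -
  have "{\<omega> \<in> space \<F>. length (batch_pos S \<omega>) = n_F S} \<in> sets \<F>" by measurable
  then show ?thesis by (simp add: Ret_F_def)
qed

text \<open>The index range on the right is fixed, so measurability follows from that of the labels
  although \<open>S_R\<close> is a random set.\<close>

lemma card_S_R: "card (S_R S \<omega>) = (\<Sum>j<n_R S. of_bool (\<not> phi_R S j \<omega>))"
proof -
  have "S_R S \<omega> = {j \<in> {..<n_R S}. \<not> phi_R S j \<omega>}" by (auto simp: S_R_def)
  then show ?thesis by (simp add: sum.If_cases of_bool_def Int_def)
qed

lemma card_S_R_measurable [measurable]: "(\<lambda>\<omega>. card (S_R S \<omega>)) \<in> \<F> \<rightarrow>\<^sub>M count_space UNIV"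
  unfolding card_S_R by measurable

lemma Ready_measurable [measurable]: "Ready S \<in> sets \<F>"
proof -
  have "{\<omega> \<in> space \<F>. \<omega> \<in> avail S \<and> 1 \<le> card (S_R S \<omega>)} \<in> sets \<F>" by measurable
  then show ?thesis by (simp add: Ready_def Ready_R_def sets.Int)
qed

lemma Z_hat_measurable [measurable]: "Z_hat S \<in> borel_measurable \<F>"
  unfolding Z_hat_def by measurable

lemma Delta_measurable [measurable]: "Delta S \<in> borel_measurable \<F>"
  unfolding Delta_def eps_L_def eps_D_def by measurable

lemmas Omega_measurable [measurable] =
  current_measurable[THEN measurable_pre_rollout_Omega]
  candidate_measurable[THEN measurable_pre_rollout_Omega]
  seed_measurable[THEN measurable_pre_rollout_Omega]
  frozen_measurable[THEN measurable_pre_rollout_Omega]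
  material_measurable[THEN measurable_pre_rollout_Omega]
  task_of_measurable[THEN measurable_pre_rollout_Omega]
  agent_of_measurable[THEN measurable_pre_rollout_Omega]
  t_F_measurable[THEN measurable_pre_rollout_Omega]
  t_R_measurable[THEN measurable_pre_rollout_Omega]
  phi_R_measurable[THEN measurable_pre_rollout_Omega]
  card_S_R_measurable[THEN measurable_pre_rollout_Omega]
  Z_hat_measurable[THEN measurable_pre_rollout_Omega]
  Delta_measurable[THEN measurable_pre_rollout_Omega]
  Cand_measurable[THEN sets_pre_rollout_Omega]
  Ret_F_measurable[THEN sets_pre_rollout_Omega]
  Ready_measurable[THEN sets_pre_rollout_Omega]

lemma V_hat_measurable [measurable]: "V_hat S b e \<in> borel_measurable (\<Omega> S)"
  unfolding V_hat_def by measurable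

lemma L_hat_measurable [measurable]: "L_hat S \<in> borel_measurable (\<Omega> S)"
  unfolding L_hat_def by measurable

text \<open>Label weights in place of a random index set give measurability; they also present a sum
  over successes as one over all \<open>n_R\<close> records, the form in which Hoeffding's
  inequality is applied.\<close>

lemma sum_S_R:
  fixes g :: "nat \<Rightarrow> real"
  shows "(\<Sum>j\<in>S_R S \<omega>. g j) = (\<Sum>j<n_R S. of_bool (\<not> phi_R S j \<omega>) * g j)"
  by (rule sum.mono_neutral_cong_left) (auto simp: S_R_def)

lemma D_R_hat_measurable [measurable]: "D_R_hat S \<in> borel_measurable (\<Omega> S)"
  unfolding D_R_hat_def sum_S_R by measurable

lemma Acc_measurable [measurable]: "Acc S \<in> sets (\<Omega> S)"
proof -
  have "Acc S = {\<omega> \<in> space (\<Omega> S). \<omega> \<in> Cand S \<inter> Ready S \<and> tau S \<le> L_hat S \<omega> \<and> D_R_hat S \<omega> \<le> delta S \<and> 0 < Delta S \<omega>}"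
    by (auto simp: Acc_def Cand_def)
  also have "\<dots> \<in> sets (\<Omega> S)" by measurable
  finally show ?thesis .
qed

lemma improvement_measurable [measurable]: "improvement S \<in> borel_measurable (\<Omega> S)"
proof -
  have "next_agent S \<in> \<Omega> S \<rightarrow>\<^sub>M Agents S"
    unfolding next_agent_def by measurable
  then show ?thesis unfolding improvement_def by measurable
qed

section \<open>Deviation of the rollouts\<close>

lemma Cand_Ready_measurable: "Cand S \<inter> Ready S \<in> sets \<F>"
  by measurable

text \<open>Which slots are evaluated is settled before any rollout, so this event can serve as the
  conditioning event for the rollout law.\<close>

lemma eval_slot_measurable:
  "{\<omega> \<in> Cand S \<inter> Ready S. e \<in> eval_slots S \<omega>} \<in> sets \<F>"
proof (cases e)
  case (FSlot i)
  then have "{\<omega> \<in> Cand S \<inter> Ready S. e \<in> eval_slots S \<omega>} = (if i < n_F S then Cand S \<inter> Ready S else {})"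
    by (auto simp: eval_slots_def)
  then show ?thesis using Cand_Ready_measurable by simp
next
  case (RSlot j)
  then have "{\<omega> \<in> Cand S \<inter> Ready S. e \<in> eval_slots S \<omega>}
      = Cand S \<inter> Ready S \<inter> {\<omega> \<in> space \<F>. j < n_R S \<and> \<not> phi_R S j \<omega>}"
    by (auto simp: eval_slots_def S_R_def Cand_def)
  also have "\<dots> \<in> sets \<F>" by measurable
  finally show ?thesis .
qed

text \<open>Given \<open>pre_rollout\<close>, the repetitions in one evaluated slot are i.i.d. from
  the kernel of one agent at one task, and the mean reward is \<open>V\<close>. Disintegration over
  this pair reduces the claim to \<open>Hoeffding_PiM\<close>.\<close>

lemma rollout_deviation:
  "measure (\<Omega> S) {\<omega> \<in> Cand S \<inter> Ready S. e \<in> eval_slots S \<omega> \<and>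
     eps_V S < \<bar>V_hat S b e \<omega> - V S (agent_of S b \<omega>) (task_of S e \<omega>)\<bar>} \<le> risk_V S"
proof -
  let ?m = "n_roll S"
  let ?N = "Agents S \<Otimes>\<^sub>M Tasks S"
  define W where "W = {\<omega> \<in> Cand S \<inter> Ready S. e \<in> eval_slots S \<omega>}"
  define Y where "Y \<omega> = (agent_of S b \<omega>, task_of S e \<omega>)" for \<omega>
  define X where "X \<omega> = (\<lambda>l\<in>{..<?m}. rollout S b e l \<omega>)" for \<omega>
  define K where "K = (\<lambda>(A, t). kern S A t)"
  define H where "H = {z \<in> space (?N \<Otimes>\<^sub>M PiM {..<?m} (\<lambda>_. Outputs S)).
    eps_V S < \<bar>(1 / real ?m) * (\<Sum>l<?m. reward S (snd (fst z)) (snd z l)) - V S (fst (fst z)) (snd (fst z))\<bar>}"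
  have WF: "W \<in> sets \<F>" unfolding W_def by (rule eval_slot_measurable)
  have YF [measurable]: "Y \<in> \<F> \<rightarrow>\<^sub>M ?N" unfolding Y_def by measurable
  have "measure (\<Omega> S) {\<omega> \<in> W. (Y \<omega>, X \<omega>) \<in> H} \<le> risk_V S"
  proof (rule measure_disintegrate_PiM_le[where I="{..<?m}" and P="Outputs S" and N="?N" and K=K])
    show "prob_space (\<Omega> S)" by (rule prob_Omega)
    show "W \<in> events" by (rule sets_pre_rollout_Omega[OF WF])
    show "Y \<in> \<Omega> S \<rightarrow>\<^sub>M ?N" by (rule measurable_pre_rollout_Omega[OF YF])
    show "X \<in> \<Omega> S \<rightarrow>\<^sub>M PiM {..<?m} (\<lambda>_. Outputs S)" unfolding X_def by measurable
    show "K \<in> ?N \<rightarrow>\<^sub>M prob_algebra (Outputs S)" unfolding K_def by (rule kern_measurable)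
    show "H \<in> sets (?N \<Otimes>\<^sub>M PiM {..<?m} (\<lambda>_. Outputs S))" unfolding H_def by measurable
    show "0 \<le> risk_V S" using risk_V_pos by simp
    show "measure (PiM {..<?m} (\<lambda>_. K y)) {x \<in> space (PiM {..<?m} (\<lambda>_. K y)). (y, x) \<in> H} \<le> risk_V S"
      if "y \<in> space ?N" for y
    proof -
      obtain A t where y: "y = (A, t)" by (cases y)
      have A: "A \<in> space (Agents S)" and t [measurable]: "t \<in> space (Tasks S)"
        using that by (auto simp: y space_pair_measure)
      note sets_kern[OF A t, measurable_cong]
      have sp: "space (kern S A t) = space (Outputs S)"
        by (rule sets_eq_imp_space_eq) (rule sets_kern[OF A t])
      have "{x \<in> space (PiM {..<?m} (\<lambda>_. K y)). (y, x) \<in> H} =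
        {x \<in> space (PiM {..<?m} (\<lambda>_. kern S A t)).
           sqrt (ln (2 / risk_V S) / (2 * real ?m)) < \<bar>(1 / real ?m) * (\<Sum>l<?m. reward S t (x l)) - (\<integral>u. reward S t u \<partial>kern S A t)\<bar>}"
        using A t by (auto simp: H_def K_def y space_PiM space_pair_measure sp eps_V_def V_def)
      then show ?thesis
        using Hoeffding_PiM[OF prob_kern[OF A t], of "reward S t" ?m "risk_V S"]
          reward_bounds[OF t] n_roll_pos risk_V_pos
        by (simp add: K_def y sp)
    qed
    fix C B assume C: "C \<in> sets ?N" and B: "\<And>l. l \<in> {..<?m} \<Longrightarrow> B l \<in> sets (Outputs S)"
    define A where "A = {\<omega> \<in> W. Y \<omega> \<in> C}"
    \<comment> \<open>This is the block of \<open>rollout_law\<close> with a single role and a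
      single slot; the sets vary with the repetition only.\<close>
    define B' where "B' = {\<omega>'\<in>space (\<Omega> S). \<forall>(b, e, l)\<in>{b} \<times> {e} \<times> {..<?m}. rollout S b e l \<omega>' \<in> (\<lambda>(b, e, l). B l) (b, e, l)}"
    have A: "A \<in> sets \<F>"
    proof -
      have "A = W \<inter> (Y -` C \<inter> space \<F>)"
        using sets.sets_into_space[OF WF] by (auto simp: A_def)
      then show ?thesis using WF measurable_sets[OF YF C] by auto
    qed
    have B': "B' \<in> events"
    proof -
      note B [measurable]
      have "B' = {\<omega>'\<in>space (\<Omega> S). \<forall>l\<in>{..<?m}. rollout S b e l \<omega>' \<in> B l}"
        by (auto simp: B'_def)
      also have "\<dots> \<in> events" by measurable
      finally show ?thesis .
    qed
    have "AE \<omega> in \<Omega> S. \<omega> \<in> A \<longrightarrow> cprob (\<Omega> S) \<F> B' \<omega> = (\<Prod>l<?m. measure (K (Y \<omega>)) (B l))"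
    proof -
      have "AE \<omega> in \<Omega> S. \<omega> \<in> Cand S \<inter> Ready S \<and> {b} \<times> {e} \<times> {..<?m} \<subseteq> UNIV \<times> eval_slots S \<omega> \<times> {..<?m} \<longrightarrow>
        cprob (\<Omega> S) \<F> B' \<omega> = (\<Prod>(b, e, l)\<in>{b} \<times> {e} \<times> {..<?m}.
          measure (kern S (agent_of S b \<omega>) (task_of S e \<omega>)) ((\<lambda>(b, e, l). B l) (b, e, l)))"
        unfolding B'_def by (rule rollout_law) (use B in auto)
      then show ?thesis
      proof eventually_elim
        case (elim \<omega>)
        have *: "(\<Prod>(b, e, l)\<in>{b} \<times> {e} \<times> {..<?m}.
            measure (kern S (agent_of S b \<omega>) (task_of S e \<omega>)) ((\<lambda>(b, e, l). B l) (b, e, l)))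
          = (\<Prod>l<?m. measure (K (Y \<omega>)) (B l))"
          by (rule prod.reindex_bij_witness[where i="\<lambda>l. (b, e, l)" and j="\<lambda>(b, e, l). l"])
             (auto simp: K_def Y_def)
        show ?case
          using elim unfolding * by (auto simp: A_def W_def)
      qed
    qed
    from emeasure_Int_cprob[OF prob_Omega subalgebra_pre_rollout A B' this]
    have "emeasure (\<Omega> S) (A \<inter> B') = (\<integral>\<^sup>+\<omega>. ennreal (\<Prod>l<?m. measure (K (Y \<omega>)) (B l)) * indicator A \<omega> \<partial>\<Omega> S)" .
    also have "\<dots> = (\<integral>\<^sup>+\<omega>. (\<Prod>l<?m. emeasure (K (Y \<omega>)) (B l)) * indicator A \<omega> \<partial>\<Omega> S)"
    proof (intro nn_integral_cong)
      fix \<omega> assume "\<omega> \<in> space (\<Omega> S)"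
      then have "Y \<omega> \<in> space ?N"
        using measurable_space[OF YF] by simp
      then interpret Ky: prob_space "K (Y \<omega>)"
        unfolding K_def by (auto simp: space_pair_measure intro: prob_kern)
      show "ennreal (\<Prod>l<?m. measure (K (Y \<omega>)) (B l)) * indicator A \<omega>
        = (\<Prod>l<?m. emeasure (K (Y \<omega>)) (B l)) * indicator A \<omega>"
        by (simp add: Ky.emeasure_eq_measure prod_ennreal)
    qed
    also have "A \<inter> B' = {\<omega> \<in> W. Y \<omega> \<in> C \<and> (\<forall>l\<in>{..<?m}. X \<omega> l \<in> B l)}"
      using sets.sets_into_space[OF WF] by (auto simp: A_def B'_def X_def)
    finally show "emeasure (\<Omega> S) {\<omega> \<in> W. Y \<omega> \<in> C \<and> (\<forall>l\<in>{..<?m}. X \<omega> l \<in> B l)}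
      = (\<integral>\<^sup>+\<omega>. (\<Prod>l\<in>{..<?m}. emeasure (K (Y \<omega>)) (B l)) * indicator {\<omega> \<in> W. Y \<omega> \<in> C} \<omega> \<partial>\<Omega> S)"
      unfolding A_def .
  qed simp
  also have "{\<omega> \<in> W. (Y \<omega>, X \<omega>) \<in> H} = {\<omega> \<in> Cand S \<inter> Ready S. e \<in> eval_slots S \<omega> \<and>
     eps_V S < \<bar>V_hat S b e \<omega> - V S (agent_of S b \<omega>) (task_of S e \<omega>)\<bar>}"
  proof -
    have "(Y \<omega>, X \<omega>) \<in> space (?N \<Otimes>\<^sub>M PiM {..<?m} (\<lambda>_. Outputs S))" if "\<omega> \<in> Cand S" for \<omega>
      using that measurable_space[OF YF, of \<omega>] measurable_space[OF rollout_measurable, of \<omega>]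
      by (auto simp: space_pair_measure space_PiM X_def Cand_def)
    then show ?thesis
      by (auto simp: W_def H_def X_def Y_def V_hat_def)
  qed
  finally show ?thesis .
qed

section \<open>Deviation of the stored sample\<close>

text \<open>The reference law specifies the tasks and the labels in two stages. Pairing each task with
  its label turns it into i.i.d. sampling from \<open>record_law\<close>, given the frozen information.\<close>

definition zip_records :: "(nat \<Rightarrow> 't) \<times> (nat \<Rightarrow> bool) \<Rightarrow> nat \<Rightarrow> 't \<times> bool" where
  "zip_records = (\<lambda>(t, b). \<lambda>j\<in>{..<n_R S}. (t j, b j))"

abbreviation pairs_space :: "(nat \<Rightarrow> 't \<times> bool) measure" where
  "pairs_space \<equiv> PiM {..<n_R S} (\<lambda>_. Tasks S \<Otimes>\<^sub>M count_space UNIV)"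

lemma zip_records_measurable [measurable]: "zip_records \<in> records_space S \<rightarrow>\<^sub>M pairs_space"
  unfolding zip_records_def records_space_def case_prod_beta' by measurable

lemma G_info_measurable [measurable]: "G_info S \<in> \<Omega> S \<rightarrow>\<^sub>M G_space S"
  unfolding G_info_def G_space_def by measurable

lemma records_measurable [measurable]: "records S \<in> \<Omega> S \<rightarrow>\<^sub>M records_space S"
  unfolding records_def records_space_def by measurable

lemma current_of_G_measurable: "fst \<in> G_space S \<rightarrow>\<^sub>M Agents S"
  unfolding G_space_def by measurable

lemma
  assumes "is_reference_law S Q"
  shows reference_law_tasks: "\<And>B. (\<And>j. j < n_R S \<Longrightarrow> B j \<in> sets (Tasks S)) \<Longrightarrow>
      AE z in Q. cprob Q (sigma_gen Q (G_space S) fst)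
        {(g', t', b')\<in>space Q. \<forall>j<n_R S. t' j \<in> B j} z = (\<Prod>j<n_R S. measure (D_user S) (B j))"
    and reference_law_labels: "\<And>y. AE z in Q.
      cprob Q (sigma_gen Q (G_space S \<Otimes>\<^sub>M stored_tasks_space S) (\<lambda>(g, t, b). (g, t)))
        {(g', t', b')\<in>space Q. \<forall>j<n_R S. b' j = y j} z
      = (\<Prod>j<n_R S. pmf (bernoulli_pmf (psi S (fst (fst z)) (fst (snd z) j))) (y j))"
  using assms unfolding is_reference_law_def by (simp_all add: case_prod_beta')

text \<open>The event is split by the label vector. For a fixed vector the label law produces a
  product of Bernoulli weights, and the task law integrates each factor separately. Over all
  vectors, the sum of these products factors into a product of two-term sums, each being the
  \<open>record_law\<close> measure of one side of the rectangle.\<close>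

lemma reference_law_rectangle:
  assumes Q: "is_reference_law S Q" and C: "C \<in> sets (G_space S)"
    and E: "\<And>j. j \<in> {..<n_R S} \<Longrightarrow> E j \<in> sets (Tasks S \<Otimes>\<^sub>M count_space UNIV)"
  shows "emeasure Q {z \<in> space Q. fst z \<in> C \<and> (\<forall>j\<in>{..<n_R S}. zip_records (snd z) j \<in> E j)}
    = (\<integral>\<^sup>+z. (\<Prod>j\<in>{..<n_R S}. emeasure (record_law (fst (fst z))) (E j)) * indicator {z \<in> space Q. fst z \<in> C} z \<partial>Q)"
proof -
  let ?n = "n_R S"
  let ?T = "stored_tasks_space S"
  interpret Q: prob_space Q using Q by (simp add: is_reference_law_def)
  have sQ: "sets Q = sets (G_space S \<Otimes>\<^sub>M records_space S)"
    using Q by (simp add: is_reference_law_def)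
  note [measurable_cong] = sQ
  have spQ: "space Q = space (G_space S) \<times> space ?T \<times> space (PiM {..<?n} (\<lambda>_. count_space (UNIV :: bool set)))"
    using sets_eq_imp_space_eq[OF sQ] by (simp add: space_pair_measure records_space_def)
  have [measurable]: "(\<lambda>z. fst (snd z)) \<in> Q \<rightarrow>\<^sub>M ?T"
    "(\<lambda>z. snd (snd z)) \<in> Q \<rightarrow>\<^sub>M PiM {..<?n} (\<lambda>_. count_space UNIV)" "fst \<in> Q \<rightarrow>\<^sub>M G_space S"
    by (simp_all add: measurable_cong_sets[OF sQ refl] records_space_def)
  note current_of_G_measurable [measurable]
  note C [measurable]
  \<comment> \<open>The task law is needed for functions and not only for rectangles, because the
    Bernoulli weights integrated below depend on the tasks. The conditioning event is the whole
    space.\<close>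
  have tasks: "(\<integral>\<^sup>+z. h (fst z, fst (snd z)) * indicator (space Q) z \<partial>Q)
      = (\<integral>\<^sup>+z. (\<integral>\<^sup>+t. h (fst z, t) \<partial>PiM {..<?n} (\<lambda>_. D_user S)) * indicator (space Q) z \<partial>Q)"
    if h: "h \<in> borel_measurable (G_space S \<Otimes>\<^sub>M ?T)" for h
  proof (rule nn_integral_disintegrate_PiM[where K="\<lambda>_. D_user S" and P="Tasks S", OF Q.prob_space_axioms _ _ _ _ _ _ h])
    show "(\<lambda>_. D_user S) \<in> G_space S \<rightarrow>\<^sub>M prob_algebra (Tasks S)"
      using prob_D_user sets_D_user by (intro measurable_const) (simp add: space_prob_algebra)
    fix C' B assume C' [measurable]: "C' \<in> sets (G_space S)" and B: "\<And>j. j \<in> {..<?n} \<Longrightarrow> B j \<in> sets (Tasks S)"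
    define F where "F = sigma_gen Q (G_space S) fst"
    have F: "subalgebra Q F" unfolding F_def by (rule subalgebra_sigma_gen) measurable
    define A where "A = {z \<in> space Q. fst z \<in> C'}"
    have A: "A \<in> sets F"
    proof -
      have "fst \<in> F \<rightarrow>\<^sub>M G_space S" unfolding F_def by (rule measurable_sigma_gen) measurable
      from measurable_sets[OF this C'] show ?thesis
        by (simp add: F_def A_def vimage_def Int_def conj_commute)
    qed
    define B' where "B' = {(g', t', b')\<in>space Q. \<forall>j<?n. t' j \<in> B j}"
    have B': "B' \<in> sets Q"
    proof -
      note B [measurable]
      have "B' = {z \<in> space Q. \<forall>j\<in>{..<?n}. fst (snd z) j \<in> B j}"
        by (auto simp: B'_def)
      also have "\<dots> \<in> sets Q" by measurable
      finally show ?thesis .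
    qed
    have "AE z in Q. z \<in> A \<longrightarrow> cprob Q F B' z = (\<Prod>j<?n. measure (D_user S) (B j))"
      using reference_law_tasks[OF Q, of B] B unfolding F_def B'_def by auto
    from emeasure_Int_cprob[OF Q.prob_space_axioms F A B' this]
    have "emeasure Q (A \<inter> B') = (\<integral>\<^sup>+z. ennreal (\<Prod>j<?n. measure (D_user S) (B j)) * indicator A z \<partial>Q)" .
    also have "A \<inter> B' = {z \<in> space Q. fst z \<in> C' \<and> (\<forall>j\<in>{..<?n}. fst (snd z) j \<in> B j)}"
      by (auto simp: A_def B'_def)
    also have "ennreal (\<Prod>j<?n. measure (D_user S) (B j)) = (\<Prod>j\<in>{..<?n}. emeasure (D_user S) (B j))"
      by (simp add: D.emeasure_eq_measure prod_ennreal)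
    finally show "emeasure Q {z \<in> space Q. fst z \<in> C' \<and> (\<forall>j\<in>{..<?n}. fst (snd z) j \<in> B j)}
      = (\<integral>\<^sup>+z. (\<Prod>j\<in>{..<?n}. emeasure (D_user S) (B j)) * indicator {z \<in> space Q. fst z \<in> C'} z \<partial>Q)"
      by (simp add: A_def)
  qed simp_all
  \<comment> \<open>Label vectors are extensional on the index range, which leaves finitely many of
    them.\<close>
  let ?Ys = "Pi\<^sub>E {..<?n} (\<lambda>_. UNIV :: bool set)"
  \<comment> \<open>Weight of record \<open>j\<close> with task \<open>t\<close> and label
    \<open>y\<close>: membership in \<open>E j\<close> times the label probability.\<close>
  define p where "p y g j t = indicator (E j) (t, y) * ennreal (pmf (bernoulli_pmf (psi S (fst g) t)) y)"
    for y :: bool and g :: "'a \<times> 'c option \<times> (nat \<Rightarrow> 't) option \<times> nat \<times> 'x" and j and t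
  define Sy where "Sy y = {z \<in> space Q. fst z \<in> C \<and> (\<forall>j\<in>{..<?n}. (fst (snd z) j, y j) \<in> E j) \<and> (\<forall>j\<in>{..<?n}. snd (snd z) j = y j)}" for y
  have Sy_meas: "Sy y \<in> sets Q" for y
  proof -
    note E [measurable]
    show ?thesis unfolding Sy_def by measurable
  qed
  have em_Sy: "emeasure Q (Sy y) = (\<integral>\<^sup>+z. (\<Prod>j<?n. \<integral>\<^sup>+t. p (y j) (fst z) j t \<partial>D_user S) * indicator {z \<in> space Q. fst z \<in> C} z \<partial>Q)"
    for y :: "nat \<Rightarrow> bool"
  proof -
    define F where "F = sigma_gen Q (G_space S \<Otimes>\<^sub>M ?T) (\<lambda>(g, t, b). (g, t))"
    have gt: "(\<lambda>(g, t, b). (g, t)) \<in> Q \<rightarrow>\<^sub>M G_space S \<Otimes>\<^sub>M ?T"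
      unfolding case_prod_beta' by measurable
    have F: "subalgebra Q F" unfolding F_def by (rule subalgebra_sigma_gen[OF gt])
    define A where "A = {z \<in> space Q. fst z \<in> C \<and> (\<forall>j\<in>{..<?n}. (fst (snd z) j, y j) \<in> E j)}"
    have A: "A \<in> sets F"
    proof -
      note E [measurable]
      have "{x \<in> space (G_space S \<Otimes>\<^sub>M ?T). fst x \<in> C \<and> (\<forall>j\<in>{..<?n}. (snd x j, y j) \<in> E j)} \<in> sets (G_space S \<Otimes>\<^sub>M ?T)"
        by measurable
      from measurable_sets[OF measurable_sigma_gen[OF gt] this]
      have "(\<lambda>(g, t, b). (g, t)) -` {x \<in> space (G_space S \<Otimes>\<^sub>M ?T). fst x \<in> C \<and> (\<forall>j\<in>{..<?n}. (snd x j, y j) \<in> E j)} \<inter> space Q \<in> sets F"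
        by (simp add: F_def)
      also have "(\<lambda>(g, t, b). (g, t)) -` {x \<in> space (G_space S \<Otimes>\<^sub>M ?T). fst x \<in> C \<and> (\<forall>j\<in>{..<?n}. (snd x j, y j) \<in> E j)} \<inter> space Q = A"
        by (auto simp: A_def spQ space_pair_measure)
      finally show ?thesis .
    qed
    define B' where "B' = {(g', t', b')\<in>space Q. \<forall>j<?n. b' j = y j}"
    have B': "B' \<in> sets Q"
    proof -
      have "B' = {z \<in> space Q. \<forall>j\<in>{..<?n}. snd (snd z) j = y j}"
        unfolding B'_def case_prod_beta' by (simp add: Ball_def)
      also have "\<dots> \<in> sets Q" by measurable
      finally show ?thesis .
    qed
    let ?p = "\<lambda>z. \<Prod>j<?n. pmf (bernoulli_pmf (psi S (fst (fst z)) (fst (snd z) j))) (y j)"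
    have "AE z in Q. z \<in> A \<longrightarrow> cprob Q F B' z = ?p z"
      using reference_law_labels[OF Q, of y] unfolding F_def B'_def by auto
    from emeasure_Int_cprob[OF Q.prob_space_axioms F A B' this]
    have "emeasure Q (A \<inter> B') = (\<integral>\<^sup>+z. ennreal (?p z) * indicator A z \<partial>Q)" .
    also have "A \<inter> B' = Sy y"
      unfolding A_def B'_def Sy_def case_prod_beta' Int_def by (rule Collect_cong) (auto simp: Ball_def)
    also have "(\<integral>\<^sup>+z. ennreal (?p z) * indicator A z \<partial>Q)
        = (\<integral>\<^sup>+z. (\<lambda>(g, t). indicator C g * (\<Prod>j<?n. p (y j) g j (t j))) (fst z, fst (snd z)) * indicator (space Q) z \<partial>Q)"
    proof (intro nn_integral_cong)
      fix z assume z: "z \<in> space Q"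
      have "(\<Prod>j<?n. p (y j) (fst z) j (fst (snd z) j))
          = (\<Prod>j<?n. indicator (E j) (fst (snd z) j, y j)) * ennreal (?p z)"
        unfolding p_def prod.distrib by (simp add: prod_ennreal)
      moreover have "(\<Prod>j<?n. indicator (E j) (fst (snd z) j, y j)) =
          (if \<forall>j\<in>{..<?n}. (fst (snd z) j, y j) \<in> E j then 1 else (0::ennreal))"
        by (auto simp: indicator_def intro: prod_zero)
      ultimately show "ennreal (?p z) * indicator A z =
          (\<lambda>(g, t). indicator C g * (\<Prod>j<?n. p (y j) g j (t j))) (fst z, fst (snd z)) * indicator (space Q) z"
        using z by (simp add: A_def indicator_def)
    qed
    also have "\<dots> = (\<integral>\<^sup>+z. (\<integral>\<^sup>+t. (\<lambda>(g, t). indicator C g * (\<Prod>j<?n. p (y j) g j (t j))) (fst z, t) \<partial>PiM {..<?n} (\<lambda>_. D_user S)) * indicator (space Q) z \<partial>Q)"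
    proof (rule tasks)
      note E [measurable]
      show "(\<lambda>(g, t). indicator C g * (\<Prod>j<?n. p (y j) g j (t j))) \<in> borel_measurable (G_space S \<Otimes>\<^sub>M ?T)"
        unfolding p_def by measurable
    qed
    also have "\<dots> = (\<integral>\<^sup>+z. (\<Prod>j<?n. \<integral>\<^sup>+t. p (y j) (fst z) j t \<partial>D_user S) * indicator {z \<in> space Q. fst z \<in> C} z \<partial>Q)"
    proof (intro nn_integral_cong)
      fix z assume z: "z \<in> space Q"
      interpret product_sigma_finite "\<lambda>_. D_user S" by unfold_locales
      have g [measurable]: "fst (fst z) \<in> space (Agents S)"
        using z by (auto simp: spQ G_space_def space_pair_measure)
      have pm [measurable]: "p (y j) (fst z) j \<in> borel_measurable (D_user S)" if "j \<in> {..<?n}" for j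
        unfolding p_def using E[OF that] by measurable
      have "(\<integral>\<^sup>+t. (\<lambda>(g, t). indicator C g * (\<Prod>j<?n. p (y j) g j (t j))) (fst z, t) \<partial>PiM {..<?n} (\<lambda>_. D_user S))
          = indicator C (fst z) * (\<integral>\<^sup>+t. (\<Prod>j<?n. p (y j) (fst z) j (t j)) \<partial>PiM {..<?n} (\<lambda>_. D_user S))"
        by (simp add: nn_integral_cmult)
      also have "(\<integral>\<^sup>+t. (\<Prod>j<?n. p (y j) (fst z) j (t j)) \<partial>PiM {..<?n} (\<lambda>_. D_user S))
          = (\<Prod>j<?n. \<integral>\<^sup>+t. p (y j) (fst z) j t \<partial>D_user S)"
        by (rule product_nn_integral_prod) (use pm in auto)
      finally show "(\<integral>\<^sup>+t. (\<lambda>(g, t). indicator C g * (\<Prod>j<?n. p (y j) g j (t j))) (fst z, t) \<partial>PiM {..<?n} (\<lambda>_. D_user S)) * indicator (space Q) z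
          = (\<Prod>j<?n. \<integral>\<^sup>+t. p (y j) (fst z) j t \<partial>D_user S) * indicator {z \<in> space Q. fst z \<in> C} z"
        using z by (simp add: indicator_def)
    qed
    finally show ?thesis .
  qed
  have "{z \<in> space Q. fst z \<in> C \<and> (\<forall>j\<in>{..<?n}. zip_records (snd z) j \<in> E j)} = (\<Union>y\<in>?Ys. Sy y)"
  proof safe
    fix g t b assume z: "(g, t, b) \<in> space Q" "fst (g, t, b) \<in> C"
      "\<forall>j\<in>{..<?n}. zip_records (snd (g, t, b)) j \<in> E j"
    then have "b \<in> ?Ys" by (simp add: spQ space_PiM)
    moreover have "(g, t, b) \<in> Sy b" using z by (auto simp: Sy_def zip_records_def)
    ultimately show "(g, t, b) \<in> (\<Union>y\<in>?Ys. Sy y)" by blast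
  qed (auto simp: Sy_def zip_records_def case_prod_beta')
  also have "emeasure Q (\<Union>y\<in>?Ys. Sy y) = (\<Sum>y\<in>?Ys. emeasure Q (Sy y))"
  proof (rule sum_emeasure[symmetric])
    show "disjoint_family_on Sy ?Ys"
      unfolding disjoint_family_on_def
    proof (intro ballI impI)
      fix y y' assume y: "y \<in> ?Ys" "y' \<in> ?Ys" "y \<noteq> y'"
      then obtain j where "j \<in> {..<?n}" "y j \<noteq> y' j"
        using PiE_ext[OF y(1,2)] by blast
      then show "Sy y \<inter> Sy y' = {}" unfolding Sy_def by blast
    qed
  qed (use Sy_meas in \<open>auto intro: finite_PiE\<close>)
  also have "\<dots> = (\<Sum>y\<in>?Ys. \<integral>\<^sup>+z. (\<Prod>j<?n. \<integral>\<^sup>+t. p (y j) (fst z) j t \<partial>D_user S) * indicator {z \<in> space Q. fst z \<in> C} z \<partial>Q)"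
    by (simp add: em_Sy)
  also have "\<dots> = (\<integral>\<^sup>+z. (\<Sum>y\<in>?Ys. (\<Prod>j<?n. \<integral>\<^sup>+t. p (y j) (fst z) j t \<partial>D_user S) * indicator {z \<in> space Q. fst z \<in> C} z) \<partial>Q)"
  proof (rule nn_integral_sum[symmetric])
    fix y :: "nat \<Rightarrow> bool"
    note E [measurable]
    have [measurable]: "(\<lambda>(z, t). p (y j) (fst z) j t) \<in> borel_measurable (Q \<Otimes>\<^sub>M D_user S)" if "j \<in> {..<?n}" for j
      unfolding p_def using that by measurable
    show "(\<lambda>z. (\<Prod>j<?n. \<integral>\<^sup>+t. p (y j) (fst z) j t \<partial>D_user S) * indicator {z \<in> space Q. fst z \<in> C} z) \<in> borel_measurable Q"
      by measurable
  qed
  also have "\<dots> = (\<integral>\<^sup>+z. (\<Prod>j\<in>{..<?n}. emeasure (record_law (fst (fst z))) (E j)) * indicator {z \<in> space Q. fst z \<in> C} z \<partial>Q)"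
  proof (intro nn_integral_cong)
    fix z assume z: "z \<in> space Q"
    have g [measurable]: "fst (fst z) \<in> space (Agents S)"
      using z by (auto simp: spQ G_space_def space_pair_measure)
    have "(\<Sum>b\<in>UNIV. \<integral>\<^sup>+t. p b (fst z) j t \<partial>D_user S) = emeasure (record_law (fst (fst z))) (E j)"
      if j: "j \<in> {..<?n}" for j
    proof -
      note E[OF j, measurable]
      have pm: "p b (fst z) j \<in> borel_measurable (D_user S)" for b
        unfolding p_def by measurable
      have "(\<Sum>b\<in>UNIV. \<integral>\<^sup>+t. p b (fst z) j t \<partial>D_user S) = (\<integral>\<^sup>+t. (\<Sum>b\<in>UNIV. p b (fst z) j t) \<partial>D_user S)"
        by (rule nn_integral_sum[symmetric]) (rule pm)
      also have "\<dots> = (\<integral>\<^sup>+z'. indicator (E j) z' \<partial>record_law (fst (fst z)))"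
        using nn_integral_record_law[OF g, of "indicator (E j)"] by (simp add: p_def mult.commute)
      finally show ?thesis using E[OF j] by (simp add: sets_record_law)
    qed
    then have "(\<Prod>j<?n. emeasure (record_law (fst (fst z))) (E j)) = (\<Prod>j<?n. \<Sum>b\<in>UNIV. \<integral>\<^sup>+t. p b (fst z) j t \<partial>D_user S)"
      by simp
    also have "\<dots> = (\<Sum>y\<in>?Ys. \<Prod>j<?n. \<integral>\<^sup>+t. p (y j) (fst z) j t \<partial>D_user S)"
      by (rule prod_sum_PiE) auto
    finally show "(\<Sum>y\<in>?Ys. (\<Prod>j<?n. \<integral>\<^sup>+t. p (y j) (fst z) j t \<partial>D_user S) * indicator {z \<in> space Q. fst z \<in> C} z)
       = (\<Prod>j\<in>{..<?n}. emeasure (record_law (fst (fst z))) (E j)) * indicator {z \<in> space Q. fst z \<in> C} z"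
      by (simp add: sum_distrib_right)
  qed
  finally show ?thesis .
qed

lemma measure_stored_sample_le:
  assumes cond: "stored_sample_condition S"
    and H [measurable]: "H \<in> sets (G_space S \<Otimes>\<^sub>M pairs_space)" and b: "0 \<le> b"
    and le: "\<And>g. g \<in> space (G_space S) \<Longrightarrow>
      measure (PiM {..<n_R S} (\<lambda>_. record_law (fst g)))
        {x \<in> space (PiM {..<n_R S} (\<lambda>_. record_law (fst g))). (g, x) \<in> H} \<le> b"
  shows "measure (\<Omega> S) {\<omega> \<in> space (\<Omega> S). (G_info S \<omega>, zip_records (records S \<omega>)) \<in> H} \<le> b + coupling_cost S"
proof -
  let ?GR = "G_space S \<Otimes>\<^sub>M records_space S"
  let ?P = "distr (\<Omega> S) ?GR (\<lambda>\<omega>. (G_info S \<omega>, records S \<omega>))"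
  obtain Q where Q: "is_reference_law S Q" and tv: "tv_dist ?P Q \<le> coupling_cost S"
    using cond by (auto simp: stored_sample_condition_def)
  interpret Q: prob_space Q using Q by (simp add: is_reference_law_def)
  have sQ: "sets Q = sets ?GR" using Q by (simp add: is_reference_law_def)
  have [measurable]: "fst \<in> Q \<rightarrow>\<^sub>M G_space S" "(\<lambda>z. zip_records (snd z)) \<in> Q \<rightarrow>\<^sub>M pairs_space"
    by (simp_all add: measurable_cong_sets[OF sQ refl])
  have "measure Q {z \<in> space Q. (fst z, zip_records (snd z)) \<in> H} \<le> b"
  proof (rule measure_disintegrate_PiM_le[where I="{..<n_R S}" and P="Tasks S \<Otimes>\<^sub>M count_space UNIV" and K="\<lambda>g. record_law (fst g)",
        OF Q.prob_space_axioms _ _ _ _ _ reference_law_rectangle[OF Q] H b le])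
    show "(\<lambda>g. record_law (fst g)) \<in> G_space S \<rightarrow>\<^sub>M prob_algebra (Tasks S \<Otimes>\<^sub>M count_space UNIV)"
      by (rule measurable_compose[OF current_of_G_measurable record_law_measurable])
  qed auto
  moreover define H' where "H' = {z \<in> space ?GR. (fst z, zip_records (snd z)) \<in> H}"
  moreover have "space Q = space ?GR" using sQ by (rule sets_eq_imp_space_eq)
  ultimately have "measure Q H' \<le> b" by simp
  moreover have H': "H' \<in> sets ?GR" unfolding H'_def by measurable
  moreover have "\<bar>measure ?P H' - measure Q H'\<bar> \<le> tv_dist ?P Q"
    by (rule tv_dist_upper) (use H' in \<open>auto intro: prob_space_distr Q.prob_space_axioms\<close>)
  ultimately have "measure ?P H' \<le> b + coupling_cost S" using tv by linarith
  also have "measure ?P H' = measure (\<Omega> S) ((\<lambda>\<omega>. (G_info S \<omega>, records S \<omega>)) -` H' \<inter> space (\<Omega> S))"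
    by (rule measure_distr) (use H' in auto)
  also have "(\<lambda>\<omega>. (G_info S \<omega>, records S \<omega>)) -` H' \<inter> space (\<Omega> S)
      = {\<omega> \<in> space (\<Omega> S). (G_info S \<omega>, zip_records (records S \<omega>)) \<in> H}"
    using measurable_space[OF G_info_measurable] measurable_space[OF records_measurable]
    by (auto simp: H'_def space_pair_measure)
  finally show ?thesis .
qed

text \<open>The radius is computed from the reduced risk; the coupling cost makes up the difference.\<close>

lemma stored_mean_deviation:
  fixes f :: "'a \<times> 'c option \<times> (nat \<Rightarrow> 't) option \<times> nat \<times> 'x \<Rightarrow> 't \<times> bool \<Rightarrow> real"
  assumes cond: "stored_sample_condition S"
    and f [measurable]: "(\<lambda>(g, z). f g z) \<in> borel_measurable (G_space S \<Otimes>\<^sub>M (Tasks S \<Otimes>\<^sub>M count_space UNIV))"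
    and bnd: "\<And>g t b. g \<in> space (G_space S) \<Longrightarrow> t \<in> space (Tasks S) \<Longrightarrow> f g (t, b) \<in> {0..1}"
    and risk: "coupling_cost S < risk"
  shows "measure (\<Omega> S) {\<omega> \<in> space (\<Omega> S).
      sqrt (ln (2 / (risk - coupling_cost S)) / (2 * real (n_R S)))
      < \<bar>(1 / real (n_R S)) * (\<Sum>j<n_R S. f (G_info S \<omega>) (t_R S j \<omega>, phi_R S j \<omega>))
        - (\<integral>t. psi S (current S \<omega>) t * f (G_info S \<omega>) (t, True)
             + (1 - psi S (current S \<omega>) t) * f (G_info S \<omega>) (t, False) \<partial>D_user S)\<bar>} \<le> risk"
proof -
  let ?n = "n_R S"
  let ?e = "sqrt (ln (2 / (risk - coupling_cost S)) / (2 * real ?n))"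
  \<comment> \<open>The mean of \<open>f g\<close> under \<open>record_law\<close>, expanded over
    the two labels.\<close>
  let ?I = "\<lambda>g. \<integral>t. psi S (fst g) t * f g (t, True) + (1 - psi S (fst g) t) * f g (t, False) \<partial>D_user S"
  note current_of_G_measurable [measurable]
  have [measurable]: "?I \<in> borel_measurable (G_space S)"
    by (rule D.borel_measurable_lebesgue_integral) measurable
  define H where "H = {z \<in> space (G_space S \<Otimes>\<^sub>M pairs_space).
    ?e < \<bar>(1 / real ?n) * (\<Sum>j<?n. f (fst z) (snd z j)) - ?I (fst z)\<bar>}"
  have H: "H \<in> sets (G_space S \<Otimes>\<^sub>M pairs_space)" unfolding H_def by measurable
  have "measure (\<Omega> S) {\<omega> \<in> space (\<Omega> S). (G_info S \<omega>, zip_records (records S \<omega>)) \<in> H}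
      \<le> (risk - coupling_cost S) + coupling_cost S"
  proof (rule measure_stored_sample_le[OF cond H])
    show "0 \<le> risk - coupling_cost S" using risk by simp
    fix g assume g [measurable]: "g \<in> space (G_space S)"
    then have A: "fst g \<in> space (Agents S)"
      by (rule measurable_space[OF current_of_G_measurable])
    have sp: "space (record_law (fst g)) = space (Tasks S \<Otimes>\<^sub>M count_space UNIV)"
      by (rule sets_eq_imp_space_eq) (rule sets_record_law)
    have fg: "f g \<in> borel_measurable (Tasks S \<Otimes>\<^sub>M count_space UNIV)" by measurable
    have "{x \<in> space (PiM {..<?n} (\<lambda>_. record_law (fst g))). (g, x) \<in> H}
        = {x \<in> space (PiM {..<?n} (\<lambda>_. record_law (fst g))).
           ?e < \<bar>(1 / real ?n) * (\<Sum>j<?n. f g (x j)) - (\<integral>z. f g z \<partial>record_law (fst g))\<bar>}"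
      using g bnd[OF g] integral_record_law[OF A fg]
      by (auto simp: H_def space_pair_measure space_PiM sp)
    also have "measure (PiM {..<?n} (\<lambda>_. record_law (fst g))) \<dots> \<le> risk - coupling_cost S"
      by (rule Hoeffding_PiM)
         (use prob_record_law[OF A] fg bnd[OF g] n_R_pos risk in
          \<open>auto simp: sp space_pair_measure measurable_cong_sets[OF sets_record_law refl]\<close>)
    finally show "measure (PiM {..<?n} (\<lambda>_. record_law (fst g)))
        {x \<in> space (PiM {..<?n} (\<lambda>_. record_law (fst g))). (g, x) \<in> H} \<le> risk - coupling_cost S" .
  qed
  also have "{\<omega> \<in> space (\<Omega> S). (G_info S \<omega>, zip_records (records S \<omega>)) \<in> H}
    = {\<omega> \<in> space (\<Omega> S). ?e < \<bar>(1 / real ?n) * (\<Sum>j<?n. f (G_info S \<omega>) (t_R S j \<omega>, phi_R S j \<omega>))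
        - (\<integral>t. psi S (current S \<omega>) t * f (G_info S \<omega>) (t, True)
             + (1 - psi S (current S \<omega>) t) * f (G_info S \<omega>) (t, False) \<partial>D_user S)\<bar>}"
    using measurable_space[OF G_info_measurable]
      measurable_space[OF measurable_compose[OF records_measurable zip_records_measurable]]
    by (auto simp: H_def space_pair_measure G_info_def zip_records_def records_def)
  finally show ?thesis by simp
qed

text \<open>This is \<open>1 - Z\<close> times the mean of \<open>\<bar>Adv\<bar>\<close> over the
  success distribution of tasks.\<close>

abbreviation success_loss :: "'w \<Rightarrow> real" where
  "success_loss \<omega> \<equiv> \<integral>t. (1 - psi S (current S \<omega>) t) * \<bar>Adv S (current S \<omega>) (candidate S \<omega>) t\<bar> \<partial>D_user S"

text \<open>The sampled function is the label itself, whose mean under the record law is the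
  integral of \<open>psi\<close>.\<close>

lemma Z_hat_deviation:
  assumes cond: "stored_sample_condition S" and "coupling_cost S < risk_Z S"
  shows "measure (\<Omega> S) {\<omega> \<in> space (\<Omega> S). eps_Z S < \<bar>Z_hat S \<omega> - Z S (current S \<omega>)\<bar>} \<le> risk_Z S"
proof -
  have "(\<lambda>(g, z). of_bool (snd z) :: real) \<in> borel_measurable (G_space S \<Otimes>\<^sub>M (Tasks S \<Otimes>\<^sub>M count_space UNIV))"
    by measurable
  from stored_mean_deviation[OF cond this _ assms(2)]
  show ?thesis by (simp add: eps_Z_def Z_hat_def Z_def)
qed

lemma success_loss_deviation:
  assumes cond: "stored_sample_condition S" and "coupling_cost S < risk_R S"
  shows "measure (\<Omega> S) {\<omega> \<in> space (\<Omega> S). eps_R S <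
      \<bar>(1 / real (n_R S)) * (\<Sum>j\<in>S_R S \<omega>. \<bar>Adv S (current S \<omega>) (candidate S \<omega>) (t_R S j \<omega>)\<bar>) - success_loss \<omega>\<bar>}
    \<le> risk_R S"
proof -
  define cand where "cand = (\<lambda>g :: 'a \<times> 'c option \<times> (nat \<Rightarrow> 't) option \<times> nat \<times> 'x. cand_agent (fst g, fst (snd g)))"
  define f where "f = (\<lambda>g (t, b). of_bool (\<not> b) * \<bar>Adv S (fst g) (cand g) t\<bar>)"
  have [measurable]: "cand \<in> G_space S \<rightarrow>\<^sub>M Agents S"
    unfolding cand_def G_space_def by measurable
  note current_of_G_measurable [measurable]
  have fm: "(\<lambda>(g, z). f g z) \<in> borel_measurable (G_space S \<Otimes>\<^sub>M (Tasks S \<Otimes>\<^sub>M count_space UNIV))"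
    unfolding f_def case_prod_beta' by measurable
  have "f g (t, b) \<in> {0..1}" if "g \<in> space (G_space S)" "t \<in> space (Tasks S)" for g t b
    using Adv_bound[OF measurable_space[OF current_of_G_measurable that(1)] measurable_space[OF \<open>cand \<in> _\<close> that(1)] that(2)]
    by (simp add: f_def)
  from stored_mean_deviation[OF cond fm this assms(2)]
  show ?thesis
    by (simp add: eps_R_def sum_S_R f_def cand_def G_info_def candidate_eq)
qed

section \<open>The adoption bound\<close>

text \<open>The deterministic part. The gate on \<open>L_hat\<close> bounds the failure contribution
  to the gain from below by \<open>tau - eps_L\<close>; the gate on \<open>D_R_hat\<close> bounds
  \<open>success_loss\<close> from above by the remaining term of \<open>Delta\<close>.\<close>

lemma improvement_ge_Delta:
  assumes acc: "\<omega> \<in> Acc S"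
    and V: "\<And>b e. e \<in> eval_slots S \<omega> \<Longrightarrow>
      \<bar>V_hat S b e \<omega> - V S (agent_of S b \<omega>) (task_of S e \<omega>)\<bar> \<le> eps_V S"
    and Z: "\<bar>Z_hat S \<omega> - Z S (current S \<omega>)\<bar> \<le> eps_Z S"
    and R: "\<bar>(1 / real (n_R S)) * (\<Sum>j\<in>S_R S \<omega>. \<bar>Adv S (current S \<omega>) (candidate S \<omega>) (t_R S j \<omega>)\<bar>)
      - success_loss \<omega>\<bar> \<le> eps_R S"
    and F: "\<bar>(1 / real (n_F S)) * (\<Sum>i<n_F S. Adv S (current S \<omega>) (candidate S \<omega>) (t_F S i \<omega>))
      - (\<integral>t. Adv S (current S \<omega>) (candidate S \<omega>) t \<partial>D_F S (current S \<omega>))\<bar> \<le> eps_F S \<omega>"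
  shows "Delta S \<omega> \<le> improvement S \<omega>"
proof -
  let ?A = "current S \<omega>" and ?A' = "candidate S \<omega>"
  let ?nF = "real (n_F S)" and ?nR = "real (n_R S)"
  let ?z = "Z_hat S \<omega>"
  let ?d = "\<lambda>e. V_hat S Candidate e \<omega> - V_hat S Current e \<omega>"
  let ?f = "\<lambda>e. Adv S ?A ?A' (task_of S e \<omega>)"
  define EF where "EF = (\<integral>t. Adv S ?A ?A' t \<partial>D_F S ?A)"
  have w: "\<omega> \<in> Cand S" "\<omega> \<in> Ready S" and L: "tau S \<le> L_hat S \<omega>" and D: "D_R_hat S \<omega> \<le> delta S"
    using acc by (auto simp: Acc_def)
  then have wO: "\<omega> \<in> space (\<Omega> S)" by (simp add: Cand_def)
  have AA: "?A \<in> space (Agents S)" "?A' \<in> space (Agents S)"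
    using measurable_space[OF current_measurable] measurable_space[OF candidate_measurable] wO by auto
  have Zpos: "0 < Z S ?A" using Z_current[OF wO] by simp
  have nF: "0 < ?nF" and nR: "0 < ?nR" using n_F_pos n_R_pos by auto
  have slot: "\<bar>?d e - ?f e\<bar> \<le> 2 * eps_V S" if "e \<in> eval_slots S \<omega>" for e
    using V[OF that, of Candidate] V[OF that, of Current] unfolding Adv_def agent_of.simps
    by linarith
  \<comment> \<open>Nonnegativity of the radii is read off from the hypotheses: each bounds an
    absolute value. For \<open>eps_V\<close> this takes an evaluated slot, and
    \<open>FSlot 0\<close> is one because \<open>n_F\<close> is positive.\<close>
  have eV: "0 \<le> eps_V S"
    using V[of "FSlot 0" Current] n_F_pos by (force simp: eval_slots_def)
  have eZ: "0 \<le> eps_Z S" and eR: "0 \<le> eps_R S" and eF: "0 \<le> eps_F S \<omega>"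
    using Z R F by linarith+
  \<comment> \<open>An exact identity: passing from the average over successes to the average over
    all records introduces no error from estimating \<open>Z\<close>.\<close>
  have card: "real (card (S_R S \<omega>)) = ?nR * (1 - ?z)"
  proof -
    have "real (card (S_R S \<omega>)) = (\<Sum>j<n_R S. 1 - of_bool (phi_R S j \<omega>))"
      unfolding card_S_R of_nat_sum of_nat_of_bool by (rule sum.cong) auto
    also have "\<dots> = ?nR - (\<Sum>j<n_R S. of_bool (phi_R S j \<omega>))"
      by (simp add: sum_subtractf)
    also have "\<dots> = ?nR * (1 - ?z)"
      using nR by (simp add: Z_hat_def right_diff_distrib)
    finally show ?thesis .
  qed
  \<comment> \<open>\<open>Ready\<close> supplies at least one success, hence
    \<open>Z_hat < 1\<close> and the denominator of \<open>eps_D\<close> is positive.\<close>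
  have card1: "1 \<le> card (S_R S \<omega>)" using w by (simp add: Ready_def Ready_R_def)
  then have "0 < ?nR * (1 - ?z)" unfolding card[symmetric] by simp
  then have z1: "?z < 1" using nR by (simp add: zero_less_mult_iff)
  have z0: "0 \<le> ?z" using nR by (simp add: Z_hat_def sum_nonneg)
  have "\<bar>(1 / ?nF) * (\<Sum>i<n_F S. ?d (FSlot i)) - EF\<bar> \<le> 2 * eps_V S + eps_F S \<omega>"
  proof -
    have "\<bar>(\<Sum>i<n_F S. ?d (FSlot i)) - (\<Sum>i<n_F S. ?f (FSlot i))\<bar> \<le> (\<Sum>i<n_F S. \<bar>?d (FSlot i) - ?f (FSlot i)\<bar>)"
      unfolding sum_subtractf[symmetric] by (rule sum_abs)
    also have "\<dots> \<le> (\<Sum>i<n_F S. 2 * eps_V S)"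
      by (intro sum_mono slot) (auto simp: eval_slots_def)
    finally have "\<bar>(\<Sum>i<n_F S. ?d (FSlot i)) - (\<Sum>i<n_F S. ?f (FSlot i))\<bar> \<le> ?nF * (2 * eps_V S)"
      by simp
    then have "\<bar>(1 / ?nF) * (\<Sum>i<n_F S. ?d (FSlot i)) - (1 / ?nF) * (\<Sum>i<n_F S. ?f (FSlot i))\<bar> \<le> 2 * eps_V S"
      using nF by (simp add: abs_mult diff_divide_distrib[symmetric] divide_le_eq mult.commute)
    then show ?thesis using F unfolding EF_def by simp
  qed
  then have "?z * \<bar>(1 / ?nF) * (\<Sum>i<n_F S. ?d (FSlot i)) - EF\<bar> \<le> ?z * (2 * eps_V S + eps_F S \<omega>)"
    using z0 by (rule mult_left_mono)
  then have "\<bar>L_hat S \<omega> - ?z * EF\<bar> \<le> ?z * (2 * eps_V S + eps_F S \<omega>)"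
    using z0 unfolding L_hat_def right_diff_distrib[symmetric] abs_mult by simp
  \<comment> \<open>Exchanging the estimated for the true failure rate costs \<open>eps_Z\<close>
    times the mean advantage, which is at most 1 in absolute value. This is the first summand of
    \<open>eps_L\<close>.\<close>
  moreover have "\<bar>?z * EF - Z S ?A * EF\<bar> \<le> eps_Z S * 1"
    unfolding left_diff_distrib[symmetric] abs_mult EF_def
    by (rule mult_mono) (use Z D_F_Adv_bound[OF AA Zpos] eZ in auto)
  moreover have "?z * (2 * eps_V S + eps_F S \<omega>) \<le> (?z + eps_Z S) * (2 * eps_V S + eps_F S \<omega>)"
    using eZ eV eF by (intro mult_right_mono) auto
  ultimately have fail: "tau S - eps_L S \<omega> \<le> Z S ?A * EF"
    using L unfolding eps_L_def by linarith
  have "(\<Sum>j\<in>S_R S \<omega>. \<bar>?f (RSlot j)\<bar>) \<le> (\<Sum>j\<in>S_R S \<omega>. \<bar>?d (RSlot j)\<bar> + 2 * eps_V S)"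
  proof (rule sum_mono)
    fix j assume "j \<in> S_R S \<omega>"
    then have "RSlot j \<in> eval_slots S \<omega>" by (simp add: eval_slots_def)
    from slot[OF this] show "\<bar>?f (RSlot j)\<bar> \<le> \<bar>?d (RSlot j)\<bar> + 2 * eps_V S" by linarith
  qed
  also have "\<dots> = real (card (S_R S \<omega>)) * (D_R_hat S \<omega> + 2 * eps_V S)"
    using card1 by (simp add: D_R_hat_def sum.distrib distrib_left)
  also have "\<dots> \<le> real (card (S_R S \<omega>)) * (delta S + 2 * eps_V S)"
    using D by (intro mult_left_mono) auto
  finally have "(1 / ?nR) * (\<Sum>j\<in>S_R S \<omega>. \<bar>?f (RSlot j)\<bar>) \<le> (1 - ?z) * (delta S + 2 * eps_V S)"
    using nR by (simp add: card divide_le_eq mult_ac)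
  then have "success_loss \<omega> \<le> (1 - ?z) * (delta S + 2 * eps_V S) + eps_R S"
    using R by simp
  also have "\<dots> \<le> (1 - ?z + eps_Z S) * (delta S + eps_D S \<omega>)"
  proof -
    \<comment> \<open>\<open>delta\<close> dominates \<open>D_R_hat\<close>, an average of absolute
      values, so the gate itself yields its sign.\<close>
    have d0: "0 \<le> delta S" and D0: "0 \<le> eps_D S \<omega>"
      using D z1 eV eR eZ by (auto simp: eps_D_def D_R_hat_def sum_nonneg intro: order_trans[rotated])
    have "(1 - ?z) * (2 * eps_V S) \<le> 1 * (2 * eps_V S)"
      by (rule mult_right_mono) (use z0 eV in auto)
    then have "(1 - ?z) * (delta S + 2 * eps_V S) + eps_R S \<le> (1 - ?z) * delta S + (2 * eps_V S + eps_R S + eps_Z S)"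
      unfolding distrib_left using eZ by linarith
    \<comment> \<open>The factor \<open>1 - ?z\<close> cancels the denominator of
      \<open>eps_D\<close>, leaving its numerator.\<close>
    also have "\<dots> = (1 - ?z) * (delta S + eps_D S \<omega>)"
      unfolding eps_D_def distrib_left[of "1 - Z_hat S \<omega>" "delta S"] using z1 by simp
    also have "\<dots> \<le> (1 - ?z + eps_Z S) * (delta S + eps_D S \<omega>)"
      by (rule mult_right_mono) (use eZ d0 D0 in auto)
    finally show ?thesis .
  qed
  finally have "success_loss \<omega> \<le> (1 - ?z + eps_Z S) * (delta S + eps_D S \<omega>)" .
  moreover have "Z S ?A * EF - success_loss \<omega> \<le> improvement S \<omega>"
    using J_user_diff_lower[OF AA Zpos] acc by (simp add: improvement_def next_agent_def EF_def)
  ultimately show ?thesis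
    using fail w by (simp add: Delta_def)
qed

text \<open>The success-marked slots are random, so the union runs over all \<open>n_R\<close>
  record slots and each event carries the condition that its slot is evaluated. Two agents on
  \<open>n_F + n_R\<close> slots give the factor in front of \<open>risk_V\<close>.\<close>

lemma measure_rollout_deviation_Union_le:
  defines "Slots \<equiv> {Current, Candidate} \<times> (FSlot ` {..<n_F S} \<union> RSlot ` {..<n_R S})"
  defines "Bad \<equiv> \<lambda>(b, e). {\<omega> \<in> Cand S \<inter> Ready S. e \<in> eval_slots S \<omega> \<and>
     eps_V S < \<bar>V_hat S b e \<omega> - V S (agent_of S b \<omega>) (task_of S e \<omega>)\<bar>}"
  shows "(\<Union>k\<in>Slots. Bad k) \<in> sets (\<Omega> S)"
    and "measure (\<Omega> S) (\<Union>k\<in>Slots. Bad k) \<le> 2 * real (n_F S + n_R S) * risk_V S"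
proof -
  have "finite Slots" by (simp add: Slots_def)
  have Bad: "Bad k \<in> sets (\<Omega> S)" for k
  proof -
    obtain b e where k: "k = (b, e)" by (cases k)
    have "Bad k = {\<omega> \<in> Cand S \<inter> Ready S. e \<in> eval_slots S \<omega>} \<inter>
        {\<omega> \<in> space (\<Omega> S). eps_V S < \<bar>V_hat S b e \<omega> - V S (agent_of S b \<omega>) (task_of S e \<omega>)\<bar>}"
      by (auto simp: Bad_def k Cand_def)
    also have "\<dots> \<in> sets (\<Omega> S)"
      by (intro sets.Int sets_pre_rollout_Omega[OF eval_slot_measurable]) measurable
    finally show ?thesis .
  qed
  then show "(\<Union>k\<in>Slots. Bad k) \<in> sets (\<Omega> S)"
    using \<open>finite Slots\<close> by blast
  have "card Slots \<le> 2 * (n_F S + n_R S)"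
  proof -
    have "card (FSlot ` {..<n_F S} \<union> RSlot ` {..<n_R S}) \<le> n_F S + n_R S"
      by (rule order_trans[OF card_Un_le]) (intro add_mono order_trans[OF card_image_le]; simp)
    then show ?thesis by (simp add: Slots_def card_cartesian_product)
  qed
  then have c: "real (card Slots) \<le> 2 * real (n_F S + n_R S)"
    by (metis of_nat_le_iff of_nat_mult of_nat_numeral)
  have "measure (\<Omega> S) (\<Union>k\<in>Slots. Bad k) \<le> (\<Sum>k\<in>Slots. measure (\<Omega> S) (Bad k))"
    using \<open>finite Slots\<close> Bad by (intro finite_measure_subadditive_finite) auto
  also have "\<dots> \<le> (\<Sum>k\<in>Slots. risk_V S)"
    using rollout_deviation by (intro sum_mono) (auto simp: Bad_def)
  also have "\<dots> \<le> 2 * real (n_F S + n_R S) * risk_V S"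
    using c risk_V_pos by (simp add: mult_right_mono)
  finally show "measure (\<Omega> S) (\<Union>k\<in>Slots. Bad k) \<le> 2 * real (n_F S + n_R S) * risk_V S" .
qed

lemma prob_improvement_less_Delta:
  assumes cond: "standard_evaluation_conditions S"
  shows "measure (\<Omega> S) {\<omega> \<in> Acc S. improvement S \<omega> < Delta S \<omega>} \<le> beta_step S"
proof -
  have stored: "stored_sample_condition S" and batch: "failure_batch_condition S"
    and cc: "coupling_cost S < risk_Z S" "coupling_cost S < risk_R S"
    using cond by (auto simp: standard_evaluation_conditions_def)
  define BV where "BV = (\<Union>(b, e)\<in>{Current, Candidate} \<times> (FSlot ` {..<n_F S} \<union> RSlot ` {..<n_R S}).
    {\<omega> \<in> Cand S \<inter> Ready S. e \<in> eval_slots S \<omega> \<and>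
     eps_V S < \<bar>V_hat S b e \<omega> - V S (agent_of S b \<omega>) (task_of S e \<omega>)\<bar>})"
  define BZ where "BZ = {\<omega> \<in> space (\<Omega> S). eps_Z S < \<bar>Z_hat S \<omega> - Z S (current S \<omega>)\<bar>}"
  define BR where "BR = {\<omega> \<in> space (\<Omega> S). eps_R S <
      \<bar>(1 / real (n_R S)) * (\<Sum>j\<in>S_R S \<omega>. \<bar>Adv S (current S \<omega>) (candidate S \<omega>) (t_R S j \<omega>)\<bar>) - success_loss \<omega>\<bar>}"
  define BF where "BF = {\<omega> \<in> Cand S \<inter> Ret_F S. eps_F S \<omega> <
        \<bar>(1 / real (n_F S)) * (\<Sum>i<n_F S. Adv S (current S \<omega>) (candidate S \<omega>) (t_F S i \<omega>))
          - (\<integral>t. Adv S (current S \<omega>) (candidate S \<omega>) t \<partial>D_F S (current S \<omega>))\<bar>}"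
  have [measurable]: "BV \<in> sets (\<Omega> S)"
    unfolding BV_def by (rule measure_rollout_deviation_Union_le(1))
  have [measurable]: "BZ \<in> sets (\<Omega> S)"
    unfolding BZ_def by measurable
  have [measurable]: "(\<lambda>\<omega>. success_loss \<omega>) \<in> borel_measurable (\<Omega> S)"
    "(\<lambda>\<omega>. \<integral>t. psi S (current S \<omega>) t * Adv S (current S \<omega>) (candidate S \<omega>) t \<partial>D_user S) \<in> borel_measurable (\<Omega> S)"
    by (rule D.borel_measurable_lebesgue_integral; measurable)+
  have [measurable]: "BR \<in> sets (\<Omega> S)"
    unfolding BR_def sum_S_R by measurable
  have [measurable]: "BF \<in> sets (\<Omega> S)"
  proof -
    \<comment> \<open>\<open>D_F\<close> is a measure that varies with the random agent. As a
      quotient whose numerator is an integral over the fixed \<open>D_user\<close>, the mean is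
      visibly measurable in \<open>\<omega>\<close>.\<close>
    have DF: "(\<integral>t. Adv S (current S \<omega>) (candidate S \<omega>) t \<partial>D_F S (current S \<omega>))
        = (\<integral>t. psi S (current S \<omega>) t * Adv S (current S \<omega>) (candidate S \<omega>) t \<partial>D_user S) / Z S (current S \<omega>)"
      if "\<omega> \<in> space (\<Omega> S)" for \<omega>
      using Z_current[OF that] measurable_space[OF current_measurable, of \<omega>]
        measurable_space[OF candidate_measurable, of \<omega>] that
      by (intro integral_D_F Adv_measurable_task) auto
    have "BF = {\<omega> \<in> space (\<Omega> S). \<omega> \<in> Cand S \<inter> Ret_F S \<and> eps_F S \<omega> <
        \<bar>(1 / real (n_F S)) * (\<Sum>i<n_F S. Adv S (current S \<omega>) (candidate S \<omega>) (t_F S i \<omega>))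
          - (\<integral>t. psi S (current S \<omega>) t * Adv S (current S \<omega>) (candidate S \<omega>) t \<partial>D_user S) / Z S (current S \<omega>)\<bar>}"
      using DF by (auto simp: BF_def Cand_def)
    also have "\<dots> \<in> sets (\<Omega> S)" by measurable
    finally show ?thesis .
  qed
  have "{\<omega> \<in> Acc S. improvement S \<omega> < Delta S \<omega>} \<subseteq> BV \<union> (BZ \<union> (BR \<union> BF))"
  proof (rule subsetI, rule ccontr)
    fix \<omega> assume "\<omega> \<in> {\<omega> \<in> Acc S. improvement S \<omega> < Delta S \<omega>}" and "\<omega> \<notin> BV \<union> (BZ \<union> (BR \<union> BF))"
    then have acc: "\<omega> \<in> Acc S" and less: "improvement S \<omega> < Delta S \<omega>"
      and nV: "\<omega> \<notin> BV" and nZ: "\<omega> \<notin> BZ" and nR: "\<omega> \<notin> BR" and nF: "\<omega> \<notin> BF" by auto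
    \<comment> \<open>Adoption implies \<open>Cand\<close>, \<open>Ready\<close> and
      \<open>Ret_F\<close>, so the restrictions built into \<open>BV\<close> and \<open>BF\<close>
      are met at this point.\<close>
    have w: "\<omega> \<in> Cand S" "\<omega> \<in> Ready S" "\<omega> \<in> Ret_F S" "\<omega> \<in> space (\<Omega> S)"
      using acc by (auto simp: Acc_def Ready_def Cand_def)
    have "Delta S \<omega> \<le> improvement S \<omega>"
    proof (rule improvement_ge_Delta[OF acc])
      fix b e assume e: "e \<in> eval_slots S \<omega>"
      then have "e \<in> FSlot ` {..<n_F S} \<union> RSlot ` {..<n_R S}"
        by (auto simp: eval_slots_def S_R_def)
      moreover have "b \<in> {Current, Candidate}" by (cases b) auto
      ultimately show "\<bar>V_hat S b e \<omega> - V S (agent_of S b \<omega>) (task_of S e \<omega>)\<bar> \<le> eps_V S"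
        using nV e w unfolding BV_def by fastforce
    qed (use nZ nR nF w in \<open>auto simp: BZ_def BR_def BF_def not_less\<close>)
    with less show False by simp
  qed
  then have "measure (\<Omega> S) {\<omega> \<in> Acc S. improvement S \<omega> < Delta S \<omega>} \<le> measure (\<Omega> S) (BV \<union> (BZ \<union> (BR \<union> BF)))"
    by (rule finite_measure_mono) measurable
  also have "\<dots> \<le> measure (\<Omega> S) BV + (measure (\<Omega> S) BZ + (measure (\<Omega> S) BR + measure (\<Omega> S) BF))"
    by (intro order_trans[OF measure_Un_le] add_left_mono) auto
  also have "\<dots> \<le> 2 * real (n_F S + n_R S) * risk_V S + (risk_Z S + (risk_R S + risk_F S))"
  proof (intro add_mono)
    show "measure (\<Omega> S) BV \<le> 2 * real (n_F S + n_R S) * risk_V S"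
      unfolding BV_def by (rule measure_rollout_deviation_Union_le(2))
    show "measure (\<Omega> S) BZ \<le> risk_Z S"
      unfolding BZ_def by (rule Z_hat_deviation[OF stored cc(1)])
    show "measure (\<Omega> S) BR \<le> risk_R S"
      unfolding BR_def by (rule success_loss_deviation[OF stored cc(2)])
    show "measure (\<Omega> S) BF \<le> risk_F S"
      using batch unfolding BF_def failure_batch_condition_def .
  qed
  \<comment> \<open>The two sides differ by one \<open>risk_Z S\<close>, which the protocol makes
    positive.\<close>
  also have "\<dots> \<le> beta_step S"
    using protocol by (simp add: beta_step_def one_candidate_protocol_def)
  finally show ?thesis .
qed

end

theorem theorem2:
  fixes S :: "('t, 'o, 'a, 'c, 'x, 'w) step"
  assumes "one_candidate_protocol S"
    and "standard_evaluation_conditions S"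
    and "0 < tau S" and "0 < delta S"
  shows "{\<omega> \<in> Acc S. improvement S \<omega> < Delta S \<omega>} \<in> sets (\<Omega> S) \<and>
         measure (\<Omega> S) {\<omega> \<in> Acc S. improvement S \<omega> < Delta S \<omega>} \<le> beta_step S \<and>
         {\<omega> \<in> Acc S. improvement S \<omega> \<le> 0} \<in> sets (\<Omega> S) \<and>
         measure (\<Omega> S) {\<omega> \<in> Acc S. improvement S \<omega> \<le> 0} \<le> beta_step S"
proof -
  interpret step_protocol S by unfold_locales fact
  have meas: "{\<omega> \<in> Acc S. improvement S \<omega> < Delta S \<omega>} \<in> sets (\<Omega> S)"
    "{\<omega> \<in> Acc S. improvement S \<omega> \<le> 0} \<in> sets (\<Omega> S)"
    by measurable
  have "{\<omega> \<in> Acc S. improvement S \<omega> \<le> 0} \<subseteq> {\<omega> \<in> Acc S. improvement S \<omega> < Delta S \<omega>}"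
    by (auto simp: Acc_def)
  from finite_measure_mono[OF this meas(1)] show ?thesis
    using meas prob_improvement_less_Delta[OF assms(2)] by auto
qed

end
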